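(* Let $\ell>0$ and let $f\in W^{1,2}(0,\ell)$ be complex-valued with $f(x)\neq0$ for all $x\in[0,\ell]$ and $f(0)=1$. The transmutation kernel satisfies $\widehat{K}_f\in C(\overline{\mathcal{T}_\ell})\cap W^{1,2}(\mathcal{T}_\ell)$. Furthermore, $\widehat{K}_f$ and $\widehat{K}_{\frac1f}$ satisfy the relations $$\frac{\partial\widehat{K}_{\frac1f}(x,t)}{\partial x}=-f^2(x)\frac{\partial\widehat{K}_f(x,t)}{\partial t}\quad\text{and}\quad\frac{\partial\widehat{K}_f(x,t)}{\partial x}=-\frac1{f^2(x)}\frac{\partial\widehat{K}_{\frac1f}(x,t)}{\partial t}.$$
   Context: All functions are complex-valued. $\mathcal{T}_\ell=\{(x,t)\in\mathbb{R}^2: 0\le x\le\ell,\ |t|\le x\}$; $W^{1,2}(\mathcal{T}_\ell)$ refers to its interior. The impedance operator is $\mathbf{L}_fv=-\frac1{f^2}(f^2v')'$, $v\in W^{2,2}(0,\ell)$. For $\rho\in\mathbb{C}$, $\widehat{e}_f(\rho,\cdot)\in W^{2,2}(0,\ell)$ is the solution of $\mathbf{L}_fv=\rho^2v$ on $(0,\ell)$ with $v(0)=1$, $v'(0)=i\rho$. $\widehat{K}_f\in L^2(\mathcal{T}_\ell)$ is the kernel with $\widehat K_f(x,\cdot)\in L^2(-x,x)$ and $\widehat{e}_f(\rho,x)=e^{i\rho x}-i\rho\int_{-x}^x\widehat{K}_f(x,t)e^{i\rho t}dt$ for all $\rho\in\mathbb{C}$, $x\in(0,\ell]$ (its existence is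 known, and it is unique up to null sets). Membership in $C(\overline{\mathcal{T}_\ell})$ is up to modification on a null set, and the relations between weak partial derivatives hold a.e. $\widehat{K}_{\frac1f}$ is the kernel defined in the same way with $f$ replaced by $\frac1f$. *)

theory Defs
  imports "HOL-Analysis.Analysis"
begin

section \<open>Sobolev spaces on open subsets of a Euclidean space\<close>

primrec C_k :: "nat \<Rightarrow> ('a::euclidean_space \<Rightarrow> real) \<Rightarrow> bool" where
  "C_k 0 \<phi> \<longleftrightarrow> continuous_on UNIV \<phi>"
| "C_k (Suc k) \<phi> \<longleftrightarrow>
     (\<forall>x. \<phi> differentiable at x) \<and>
     (\<forall>i\<in>Basis. C_k k (\<lambda>x. frechet_derivative \<phi> (at x) i))"

text \<open>Real-valued test functions suffice for complex-valued \<open>u\<close>, by linearity.\<close>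

definition test_function :: "'a::euclidean_space set \<Rightarrow> ('a \<Rightarrow> real) \<Rightarrow> bool" where
  "test_function \<Omega> \<phi> \<longleftrightarrow>
     (\<forall>k. C_k k \<phi>) \<and> compact (closure {x. \<phi> x \<noteq> 0}) \<and> closure {x. \<phi> x \<noteq> 0} \<subseteq> \<Omega>"

definition locally_integrable :: "'a::euclidean_space set \<Rightarrow> ('a \<Rightarrow> complex) \<Rightarrow> bool" where
  "locally_integrable \<Omega> u \<longleftrightarrow> (\<forall>C. compact C \<and> C \<subseteq> \<Omega> \<longrightarrow> u absolutely_integrable_on C)"

text \<open>\<open>g\<close> is the weak partial derivative of \<open>u\<close> in the direction \<open>i\<close> on the open set \<open>\<Omega>\<close>;
  local integrability makes \<open>g\<close> unique up to null sets.\<close>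

definition has_weak_partial ::
  "'a::euclidean_space set \<Rightarrow> 'a \<Rightarrow> ('a \<Rightarrow> complex) \<Rightarrow> ('a \<Rightarrow> complex) \<Rightarrow> bool" where
  "has_weak_partial \<Omega> i u g \<longleftrightarrow>
     locally_integrable \<Omega> u \<and> locally_integrable \<Omega> g \<and>
     (\<forall>\<phi>. test_function \<Omega> \<phi> \<longrightarrow>
        (LINT x:\<Omega>|lebesgue. frechet_derivative \<phi> (at x) i *\<^sub>R u x) =
        - (LINT x:\<Omega>|lebesgue. \<phi> x *\<^sub>R g x))"

definition L2_on :: "'a::euclidean_space set \<Rightarrow> ('a \<Rightarrow> complex) \<Rightarrow> bool" where
  "L2_on \<Omega> u \<longleftrightarrow>
     set_borel_measurable lebesgue \<Omega> u \<and> set_integrable lebesgue \<Omega> (\<lambda>x. (norm (u x))\<^sup>2)"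

text \<open>\<open>sobolev k \<Omega> u\<close> is \<open>u \<in> W\<^bsup>k,2\<^esup>(\<Omega>)\<close>.\<close>

primrec sobolev :: "nat \<Rightarrow> 'a::euclidean_space set \<Rightarrow> ('a \<Rightarrow> complex) \<Rightarrow> bool" where
  "sobolev 0 \<Omega> u \<longleftrightarrow> L2_on \<Omega> u"
| "sobolev (Suc k) \<Omega> u \<longleftrightarrow>
     L2_on \<Omega> u \<and> (\<forall>i\<in>Basis. \<exists>g. has_weak_partial \<Omega> i u g \<and> sobolev k \<Omega> g)"


section \<open>The impedance equation and the transmutation kernel\<close>

text \<open>\<open>w = - (1 / f\<^sup>2) (f\<^sup>2 v')'\<close> on \<open>(0,l)\<close>, with weak derivatives; the only basis vector
  of \<open>\<real>\<close> is \<open>1\<close>.\<close>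

definition has_impedance ::
  "real \<Rightarrow> (real \<Rightarrow> complex) \<Rightarrow> (real \<Rightarrow> complex) \<Rightarrow> (real \<Rightarrow> complex) \<Rightarrow> bool" where
  "has_impedance l f v w \<longleftrightarrow>
     (\<exists>v' g. has_weak_partial {0<..<l} 1 v v' \<and>
        has_weak_partial {0<..<l} 1 (\<lambda>x. (f x)\<^sup>2 * v' x) g \<and>
        (AE x in lebesgue_on {0<..<l}. w x = - (1 / (f x)\<^sup>2) * g x))"

text \<open>\<open>v\<close> is the solution with \<open>v(0) = 1\<close>, \<open>v'(0) = i\<rho>\<close>. Continuity on \<open>[0,l]\<close> selects the
  continuous representative of \<open>v \<in> W\<^bsup>2,2\<^esup>(0,l)\<close>, which is then \<open>C\<^sup>1\<close> on \<open>[0,l]\<close>, so that both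
  initial conditions are classical.\<close>

definition is_e_hat :: "real \<Rightarrow> (real \<Rightarrow> complex) \<Rightarrow> complex \<Rightarrow> (real \<Rightarrow> complex) \<Rightarrow> bool" where
  "is_e_hat l f \<rho> v \<longleftrightarrow>
     sobolev 2 {0<..<l} v \<and> continuous_on {0..l} v \<and>
     has_impedance l f v (\<lambda>x. \<rho>\<^sup>2 * v x) \<and>
     v 0 = 1 \<and> (v has_vector_derivative (\<i> * \<rho>)) (at 0 within {0..l})"

definition T_set :: "real \<Rightarrow> (real \<times> real) set" where
  "T_set l = {(x, t). 0 \<le> x \<and> x \<le> l \<and> \<bar>t\<bar> \<le> x}"

definition is_K_hat :: "real \<Rightarrow> (real \<Rightarrow> complex) \<Rightarrow> (real \<times> real \<Rightarrow> complex) \<Rightarrow> bool" where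
  "is_K_hat l f K \<longleftrightarrow>
     L2_on (T_set l) K \<and>
     (\<forall>x\<in>{0<..l}. L2_on {-x<..<x} (\<lambda>t. K (x, t))) \<and>
     (\<forall>\<rho> v. is_e_hat l f \<rho> v \<longrightarrow>
        (\<forall>x\<in>{0<..l}.
           v x = exp (\<i> * \<rho> * of_real x) -
             \<i> * \<rho> * (LINT t:{-x..x}|lebesgue. K (x, t) * exp (\<i> * \<rho> * of_real t))))"

end

theory Submission
  imports Defs
begin

text \<open>Put \<open>q = f'/f\<close>. For \<open>u\<close> and \<open>w\<close> with \<open>u' = i\<rho> w / f\<^sup>2\<close>, \<open>w' = i\<rho> f\<^sup>2 u\<close> and
  \<open>u(0) = w(0) = 1\<close>, which are the solutions \<open>e_hat\<close> for \<open>f\<close> and for \<open>1/f\<close>, the functions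
  \<open>y = f u\<close> and \<open>z = w / f\<close> solve the Dirac system \<open>y' = q y + i\<rho> z\<close>, \<open>z' = - q z + i\<rho> y\<close>.
  This system has transmutation kernels \<open>k\<close>, \<open>h\<close> without the factor \<open>i\<rho>\<close>,
  \<open>y = e\<^bsup>i\<rho>x\<^esup> + \<integral> k e\<^bsup>i\<rho>t\<^esup> dt\<close> and likewise for \<open>z\<close>: the sum and the difference of \<open>k\<close> and
  \<open>h\<close> solve a Goursat problem, by a contraction argument, and are continuous up to one
  explicit term \<open>q((x + t)/2)\<close>.
  Comparing Fourier transforms in \<open>t\<close> for fixed \<open>x\<close> shows that \<open>K\<close> is an indefinite integral of
  \<open>k / f\<close> in \<open>t\<close> and also one of \<open>- h / f\<close> in \<open>x\<close>. So \<open>K\<close> is continuous, \<open>K\<^sub>t = k / f\<close> and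
  \<open>K\<^sub>x = - h / f\<close> are square-integrable, and passing from \<open>f\<close> to \<open>1/f\<close> swaps \<open>k\<close> and \<open>h\<close>,
  which gives the two relations.\<close>

section \<open>Indefinite integrals\<close>

text \<open>The obstacle is regularity: \<open>f\<close> is only W^{1,2}, so \<open>q\<close> is
  merely square-integrable, and neither a Schroedinger potential f''/f nor pointwise derivatives of
  the kernels need exist. Hence every equation is kept in integrated form (\<open>ac_on\<close>):
  the Goursat equations are integral equations, and Fubini turns them into the integrated Dirac
  system for the transforms. The singular term q((x + t)/2) may be unbounded, but as a function of x
  + t alone it has continuous primitives in t and a square that is integrable over the triangle.
  This is what continuity and W^{1,2} require. \<open>K\<close> is known only through its
  transforms, slice by slice in x, and with a factor i\<rho>. That factor costs one integration by
  parts, which makes \<open>K\<close> a primitive of k/f in t. For the primitive vanishing at t =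
  -x, the case \<rho> = 0, where u = 1, gives the value 1 - 1/f(x) at t = x. The x-derivative cannot
  be read off a single slice: a primitive in x with the same edge values is written down and shown
  to have the same transform.\<close>

definition ac_on :: "real \<Rightarrow> real \<Rightarrow> (real \<Rightarrow> complex) \<Rightarrow> (real \<Rightarrow> complex) \<Rightarrow> bool" where
  "ac_on a b F F' \<longleftrightarrow> set_integrable lborel {a..b} F' \<and>
     (\<forall>x\<in>{a..b}. F x = F a + (LINT s:{a..x}|lborel. F' s))"

lemma ac_on_integral_eq:
  assumes "ac_on a b F F'" "x \<in> {a..b}"
  shows "(LINT s:{a..x}|lborel. F' s) = F x - F a"
proof -
  have "F x = F a + (LINT s:{a..x}|lborel. F' s)"
    using assms unfolding ac_on_def by blast
  then show ?thesis by (metis add_diff_cancel_left')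
qed

lemma ac_onI:
  assumes "set_integrable lborel {a..b} F'" 
    and "\<And>x. x \<in> {a..b} \<Longrightarrow> (LINT s:{a..x}|lborel. F' s) = F x - F a"
  shows "ac_on a b F F'"
  unfolding ac_on_def using assms by (metis add_diff_cancel_left' diff_add_cancel add.commute)

lemma ac_on_integrable: "ac_on a b F F' \<Longrightarrow> set_integrable lborel {a..b} F'"
  by (simp add: ac_on_def)

lemma integrable_pair_mult:
  fixes A B :: "real \<Rightarrow> complex"
  assumes [measurable]: "integrable lborel A" "integrable lborel B"
  shows "integrable (lborel \<Otimes>\<^sub>M lborel) (\<lambda>(s, t). A s * B t)"
  by (rule lborel_pair.Fubini_integrable) (use assms in \<open>auto simp: norm_mult\<close>)

text \<open>Tonelli with an integrable majorant of the slice norms, so that the inner integrals of a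
  kernel need only be estimated, not computed.\<close>

lemma integrable_pair_of_slices:
  fixes F :: "real \<Rightarrow> real \<Rightarrow> 'a::{banach, second_countable_topology}"
  assumes F: "case_prod F \<in> borel_measurable (lborel \<Otimes>\<^sub>M lborel)" and i: "\<And>s. integrable lborel (F s)"
    and w: "integrable lborel w" "\<And>s. (\<integral>t. norm (F s t) \<partial>lborel) \<le> w s"
  shows "integrable (lborel \<Otimes>\<^sub>M lborel) (case_prod F)"
proof (rule lborel_pair.Fubini_integrable[OF F])
  show "integrable lborel (\<lambda>s. \<integral>t. norm (case_prod F (s, t)) \<partial>lborel)"
  proof (rule Bochner_Integration.integrable_bound[OF w(1)])
    show "(\<lambda>s. \<integral>t. norm (case_prod F (s, t)) \<partial>lborel) \<in> borel_measurable lborel"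
      using F by (intro lborel.borel_measurable_lebesgue_integral borel_measurable_norm) (simp add: case_prod_beta')
    show "AE s in lborel. norm (\<integral>t. norm (case_prod F (s, t)) \<partial>lborel) \<le> norm (w s)"
      using w(2) by (auto intro!: order_trans[OF w(2) abs_ge_self])
  qed
qed (use i in simp)

lemma set_integrable_mult_continuous:
  fixes g F :: "real \<Rightarrow> complex"
  assumes "set_integrable lborel {a..b} g" "continuous_on {a..b} F"
  shows "set_integrable lborel {a..b} (\<lambda>x. F x * g x)"
proof -
  obtain B where B: "\<And>x. x \<in> {a..b} \<Longrightarrow> norm (F x) \<le> B"
    using continuous_on_compact_bound[OF compact_Icc assms(2)] by blast
  have m: "set_borel_measurable lborel {a..b} F"
    using set_measurable_continuous_on[OF _ assms(2)] by (simp add: set_borel_measurable_def)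
  have g: "integrable lborel (\<lambda>x. indicator {a..b} x *\<^sub>R g x)"
    using assms(1) by (simp add: set_integrable_def)
  have "integrable lborel (\<lambda>x. (indicator {a..b} x *\<^sub>R F x) * (indicator {a..b} x *\<^sub>R g x))"
  proof (rule Bochner_Integration.integrable_bound)
    show "integrable lborel (\<lambda>x. B *\<^sub>R norm (indicator {a..b} x *\<^sub>R g x))"
      using integrable_norm[OF g] by (rule integrable_scaleR_right)
    show "AE x in lborel. norm ((indicator {a..b} x *\<^sub>R F x) * (indicator {a..b} x *\<^sub>R g x))
        \<le> norm (B *\<^sub>R norm (indicator {a..b} x *\<^sub>R g x))"
    proof (rule AE_I2)
      fix x show "norm ((indicator {a..b} x *\<^sub>R F x) * (indicator {a..b} x *\<^sub>R g x))
        \<le> norm (B *\<^sub>R norm (indicator {a..b} x *\<^sub>R g x))"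
        using order_trans[OF B[of x] abs_ge_self[of B]]
          by (auto simp: indicator_def norm_mult abs_mult intro!: mult_right_mono)
    qed
    show "(\<lambda>x. (indicator {a..b} x *\<^sub>R F x) * (indicator {a..b} x *\<^sub>R g x)) \<in> borel_measurable lborel"
      using m borel_measurable_integrable[OF g]
      unfolding set_borel_measurable_def by (intro borel_measurable_times)
  qed
  then show ?thesis
    unfolding set_integrable_def
    by (rule Bochner_Integration.integrable_cong[THEN iffD1, rotated 2]) (auto simp: indicator_def)
qed

lemma ac_on_continuous:
  assumes "ac_on a b F F'"
  shows "continuous_on {a..b} F"
proof -
  have i: "set_integrable lborel {a..b} F'" and e: "\<And>x. x \<in> {a..b} \<Longrightarrow> F x = F a + (LINT s:{a..x}|lborel. F' s)"
    using assms by (auto simp only: ac_on_def)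
  have "F' integrable_on {a..b}"
    using set_borel_integral_eq_integral(1)[OF i] .
  then have c: "continuous_on {a..b} (\<lambda>x. F a + integral {a..x} F')"
    by (intro continuous_intros indefinite_integral_continuous_1)
  have "F x = F a + integral {a..x} F'" if "x \<in> {a..b}" for x
  proof -
    have "set_integrable lborel {a..x} F'"
      using i by (rule set_integrable_subset) (use that in auto)
    then show ?thesis using e[OF that] set_borel_integral_eq_integral(2) by metis
  qed
  then show ?thesis using c by (metis (no_types, lifting) continuous_on_cong)
qed

lemma ac_on_add:
  assumes "ac_on a b F F'" "ac_on a b G G'"
  shows "ac_on a b (\<lambda>x. F x + G x) (\<lambda>x. F' x + G' x)"
proof -
  have i: "set_integrable lborel {a..x} F'" "set_integrable lborel {a..x} G'" if "x \<in> {a..b}" for x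
    using that by (auto intro: set_integrable_subset[OF ac_on_integrable[OF assms(1)]] 
      set_integrable_subset[OF ac_on_integrable[OF assms(2)]])
  show ?thesis
  proof (intro ac_onI)
    show "set_integrable lborel {a..b} (\<lambda>x. F' x + G' x)"
      using ac_on_integrable[OF assms(1)] ac_on_integrable[OF assms(2)] by (rule set_integral_add(1))
    fix x assume x: "x \<in> {a..b}"
    show "(LINT s:{a..x}|lborel. F' s + G' s) = F x + G x - (F a + G a)"
      using x by (subst set_integral_add(2)[OF i[OF x]]) 
        (simp_all add: ac_on_integral_eq[OF assms(1)] ac_on_integral_eq[OF assms(2)])
  qed
qed

lemma ac_on_cmult:
  assumes "ac_on a b F F'"
  shows "ac_on a b (\<lambda>x. c * F x) (\<lambda>x. c * F' x)"
  by (rule ac_onI) (auto simp: ac_on_integrable[OF assms] ac_on_integral_eq[OF assms] right_diff_distrib)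

lemma ac_on_const: "ac_on a b (\<lambda>x. c) (\<lambda>x. 0)"
  by (auto simp: ac_on_def set_integrable_def)

lemma ac_on_cong:
  assumes "ac_on a b F F'" "\<And>x. x \<in> {a..b} \<Longrightarrow> F x = G x" "\<And>x. x \<in> {a..b} \<Longrightarrow> F' x = G' x" 
  shows "ac_on a b G G'"
proof -
  have i: "set_integrable lborel {a..b} G'"
    using ac_on_integrable[OF assms(1)] assms(3) by (metis (full_types) set_integrable_cong)
  have e: "(LINT s:{a..x}|lborel. F' s) = (LINT s:{a..x}|lborel. G' s)" if "x \<in> {a..b}" for x
    by (rule set_lebesgue_integral_cong) (use assms(3) that in auto)
  show ?thesis
  proof (intro ac_onI i)
    fix x assume x: "x \<in> {a..b}"
    then have "a \<in> {a..b}" by auto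
    then show "(LINT s:{a..x}|lborel. G' s) = G x - G a"
      using ac_on_integral_eq[OF assms(1) x] e[OF x] assms(2) x by simp
  qed
qed

text \<open>No pointwise differentiability is used: the product of the increments of
  \<open>F\<close> and \<open>G\<close> is a double integral over a square, which is cut along its
  diagonal. Fubini evaluates each half by integrating the derivative that is not yet paired.\<close>

lemma ac_on_mult:
  assumes F: "ac_on a b F F'" and G: "ac_on a b G G'"
  shows "ac_on a b (\<lambda>x. F x * G x) (\<lambda>x. F' x * G x + F x * G' x)"
proof -
  have cF: "continuous_on {a..b} F" and cG: "continuous_on {a..b} G"
    using ac_on_continuous[OF F] ac_on_continuous[OF G] .
  have iF: "set_integrable lborel {a..b} F'" and iG: "set_integrable lborel {a..b} G'"
    using ac_on_integrable[OF F] ac_on_integrable[OF G] .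
  have i1: "set_integrable lborel {a..b} (\<lambda>x. G x * F' x)"
    and i2: "set_integrable lborel {a..b} (\<lambda>x. F x * G' x)"
    by (auto intro!: set_integrable_mult_continuous cF cG iF iG)
  show ?thesis unfolding ac_on_def
  proof (intro conjI ballI)
    show "set_integrable lborel {a..b} (\<lambda>x. F' x * G x + F x * G' x)"
      using i1 i2 by (simp add: mult.commute[of "F' _"])
    fix x assume x: "x \<in> {a..b}"
    have iFx: "set_integrable lborel {a..x} F'" "set_integrable lborel {a..x} G'"
      "set_integrable lborel {a..x} (\<lambda>x. G x * F' x)" "set_integrable lborel {a..x} (\<lambda>x. F x * G' x)"
      using x by (auto intro!: set_integrable_subset[OF iF] set_integrable_subset[OF iG] 
        set_integrable_subset[OF i1] set_integrable_subset[OF i2])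
    define A where "A = (\<lambda>s. indicator {a..x} s *\<^sub>R F' s)"
    define B where "B = (\<lambda>s. indicator {a..x} s *\<^sub>R G' s)"
    have A: "integrable lborel A" and B: "integrable lborel B"
      using iFx by (auto simp: A_def B_def set_integrable_def)
    have [measurable]: "A \<in> borel_measurable borel" "B \<in> borel_measurable borel"
      using A B by auto
    have AB: "integrable (lborel \<Otimes>\<^sub>M lborel) (\<lambda>(s, t). A s * B t)"
      by (rule integrable_pair_mult[OF A B])
    \<comment> \<open>The two halves of the square: integrating \<open>?L\<close> first in
      \<open>t\<close> produces G(s) - G(a), integrating \<open>?U\<close> first in \<open>s\<close>
      produces F(t) - F(a).\<close>
    let ?L = "\<lambda>s t. indicator {t. t \<le> s} t *\<^sub>R (A s * B t)"
    let ?U = "\<lambda>s t. indicator {t. s < t} t *\<^sub>R (A s * B t)"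
    have iL: "integrable (lborel \<Otimes>\<^sub>M lborel) (case_prod ?L)"
      by (rule Bochner_Integration.integrable_bound[OF AB]) (auto simp: indicator_def)
    have iU: "integrable (lborel \<Otimes>\<^sub>M lborel) (case_prod ?U)"
      by (rule Bochner_Integration.integrable_bound[OF AB]) (auto simp: indicator_def)
    have Fe: "(LINT s:{a..y}|lborel. F' s) = F y - F a" 
      and Ge: "(LINT s:{a..y}|lborel. G' s) = G y - G a" if "y \<in> {a..x}" for y
      using that x by (auto intro!: ac_on_integral_eq[OF F] ac_on_integral_eq[OF G])
    have l: "(\<integral>t. ?L s t \<partial>lborel) = indicator {a..x} s *\<^sub>R (G s * F' s - G a * F' s)" for s
    proof -
      have "(\<integral>t. ?L s t \<partial>lborel) = (\<integral>t. A s * (indicator {a..s} t *\<^sub>R G' t) \<partial>lborel)"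
        by (rule Bochner_Integration.integral_cong) (auto simp: A_def B_def indicator_def)
      also have "\<dots> = A s * (LINT t:{a..s}|lborel. G' t)"
        unfolding set_lebesgue_integral_def by (rule integral_mult_right_zero)
      also have "\<dots> = indicator {a..x} s *\<^sub>R (G s * F' s - G a * F' s)"
        by (cases "s \<in> {a..x}") (simp_all add: A_def Ge right_diff_distrib mult.commute)
      finally show ?thesis .
    qed
    have u: "(\<integral>s. ?U s t \<partial>lborel) = indicator {a..x} t *\<^sub>R (F t * G' t - F a * G' t)" for t
    proof -
      have "(\<integral>s. ?U s t \<partial>lborel) = (\<integral>s. B t * (indicator {a..t} s *\<^sub>R F' s) \<partial>lborel)"
      proof (rule integral_cong_AE)
        show "(\<lambda>s. ?U s t) \<in> borel_measurable lborel" by measurable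
        have "(\<lambda>s. B t * (indicator {a..t} s *\<^sub>R A s)) \<in> borel_measurable lborel" by measurable
        then show "(\<lambda>s. B t * (indicator {a..t} s *\<^sub>R F' s)) \<in> borel_measurable lborel"
          by (rule measurable_cong[THEN iffD1, rotated]) (auto simp: A_def B_def indicator_def)
        \<comment> \<open>The strict inequality in \<open>?U\<close> and the closed interval differ
          only at \<open>s = t\<close>.\<close>
        show "AE s in lborel. ?U s t = B t * (indicator {a..t} s *\<^sub>R F' s)"
          using AE_lborel_singleton[of t]
          by eventually_elim (auto simp: A_def B_def indicator_def)
      qed
      also have "\<dots> = B t * (LINT s:{a..t}|lborel. F' s)"
        unfolding set_lebesgue_integral_def by (rule integral_mult_right_zero)
      also have "\<dots> = indicator {a..x} t *\<^sub>R (F t * G' t - F a * G' t)"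
        by (cases "t \<in> {a..x}") (simp_all add: B_def Fe right_diff_distrib mult.commute)
      finally show ?thesis .
    qed
    have "(F x - F a) * (G x - G a) = (\<integral>s. A s \<partial>lborel) * (\<integral>t. B t \<partial>lborel)"
      using Fe[of x] Ge[of x] x by (auto simp: A_def B_def set_lebesgue_integral_def)
    also have "\<dots> = (\<integral>s. (\<integral>t. A s * B t \<partial>lborel) \<partial>lborel)"
      by simp
    also have "\<dots> = (\<integral>p. (case p of (s, t) \<Rightarrow> A s * B t) \<partial>(lborel \<Otimes>\<^sub>M lborel))"
      using lborel_pair.integral_fst[OF AB] by simp
    also have "\<dots> = (\<integral>p. (case_prod ?L p + case_prod ?U p) \<partial>(lborel \<Otimes>\<^sub>M lborel))"
      by (rule Bochner_Integration.integral_cong) (auto simp: indicator_def split: prod.split)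
    also have "\<dots> = (\<integral>p. case_prod ?L p \<partial>(lborel \<Otimes>\<^sub>M lborel)) + (\<integral>p. case_prod ?U p \<partial>(lborel \<Otimes>\<^sub>M lborel))"
      by (rule Bochner_Integration.integral_add[OF iL iU])
    also have "(\<integral>p. case_prod ?L p \<partial>(lborel \<Otimes>\<^sub>M lborel)) = (\<integral>s. (\<integral>t. ?L s t \<partial>lborel) \<partial>lborel)"
      using lborel_pair.integral_fst[OF iL] by simp
    also have "\<dots> = (LINT s:{a..x}|lborel. G s * F' s - G a * F' s)"
      unfolding l by (simp add: set_lebesgue_integral_def)
    also have "\<dots> = (LINT s:{a..x}|lborel. G s * F' s) - G a * (F x - F a)"
      using x by (subst set_integral_diff(2)[OF iFx(3)]) (simp_all add: iFx Fe)
    also have "(\<integral>p. case_prod ?U p \<partial>(lborel \<Otimes>\<^sub>M lborel)) = (\<integral>t. (\<integral>s. ?U s t \<partial>lborel) \<partial>lborel)"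
      using lborel_pair.integral_snd[OF iU] by simp
    also have "\<dots> = (LINT s:{a..x}|lborel. F s * G' s - F a * G' s)"
      unfolding u by (simp add: set_lebesgue_integral_def)
    also have "\<dots> = (LINT s:{a..x}|lborel. F s * G' s) - F a * (G x - G a)"
      using x by (subst set_integral_diff(2)[OF iFx(4)]) (simp_all add: iFx Ge)
    finally have "F x * G x = F a * G a + ((LINT s:{a..x}|lborel. G s * F' s) + (LINT s:{a..x}|lborel. F s * G' s))"
      by (simp add: algebra_simps)
    also have "\<dots> = F a * G a + (LINT s:{a..x}|lborel. F' s * G s + F s * G' s)"
      by (simp add: set_integral_add(2)[OF iFx(3,4)] mult.commute[of "F' _"])
    finally show "F x * G x = F a * G a + (LINT s:{a..x}|lborel. F' s * G s + F s * G' s)" .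
  qed
qed

lemma ac_on_C1:
  assumes "\<And>x. x \<in> {a..b} \<Longrightarrow> (F has_vector_derivative F' x) (at x within {a..b})"
    and "continuous_on {a..b} F'"
  shows "ac_on a b F F'"
proof -
  have i: "set_integrable lborel {a..b} F'"
    unfolding set_integrable_def by (rule borel_integrable_compact) (use assms in auto)
  show ?thesis unfolding ac_on_def
  proof (intro conjI ballI i)
    fix x assume x: "x \<in> {a..b}"
    have "(F' has_integral (F x - F a)) {a..x}"
      by (rule fundamental_theorem_of_calculus) 
         (use x in \<open>auto intro!: has_vector_derivative_within_subset[OF assms(1)]\<close>)
    moreover have "set_integrable lborel {a..x} F'"
      using i by (rule set_integrable_subset) (use x in auto)
    ultimately show "F x = F a + (LINT s:{a..x}|lborel. F' s)"
      by (simp add: set_borel_integral_eq_integral(2) integral_unique)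
  qed
qed

lemma ac_on_integral:
  assumes "set_integrable lborel {a..b} F'"
  shows "ac_on a b (\<lambda>x. c + (LINT s:{a..x}|lborel. F' s)) F'"
proof -
  have "(LINT s:{a..a}|lborel. F' s) = 0"
    using AE_lborel_singleton[of a] unfolding set_lebesgue_integral_def
    by (intro integral_eq_zero_AE) (auto elim: eventually_mono)
  then show ?thesis using assms by (auto simp: ac_on_def)
qed

section \<open>The Volterra weight for a square-integrable potential\<close>

text \<open>Extension of \<open>q\<close> by zero allows translates and integrals over the whole
  line without tracking domains; Borel measurability on all of the line is what product measures
  need.\<close>

locale potential =
  fixes l :: real and q :: "real \<Rightarrow> complex"
  assumes l_pos: "l > 0"
    and q_borel [measurable]: "q \<in> borel_measurable borel"
    and q_zero: "x \<notin> {0..l} \<Longrightarrow> q x = 0"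
    and q_L2: "integrable lborel (\<lambda>x. (norm (q x))\<^sup>2)"
begin

lemma q_integrable: "integrable lborel q"
proof (rule Bochner_Integration.integrable_bound)
  show "integrable lborel (\<lambda>x. indicator {0..l} x + (norm (q x))\<^sup>2)"
    using q_L2 by (intro Bochner_Integration.integrable_add integrable_real_indicator)
      (auto simp: emeasure_lborel_Icc_eq)
  show "AE x in lborel. norm (q x) \<le> norm (indicator {0..l} x + (norm (q x))\<^sup>2)"
  proof (rule AE_I2)
    fix x
    have "2 * norm (q x) \<le> 1 + (norm (q x))\<^sup>2"
      using zero_le_power2[of "norm (q x) - 1"] by (simp add: power2_eq_square algebra_simps)
    then have "norm (q x) \<le> 1 + (norm (q x))\<^sup>2"
      using norm_ge_zero[of "q x"] by linarith
    then show "norm (q x) \<le> norm (indicator {0..l} x + (norm (q x))\<^sup>2)"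
      by (cases "x \<in> {0..l}") (use q_zero[of x] in \<open>auto\<close>)
  qed
qed simp

lemma q_set_integrable: "A \<in> sets borel \<Longrightarrow> set_integrable lborel A q"
  unfolding set_integrable_def using q_integrable by (rule integrable_mult_indicator[rotated]) simp

text \<open>The weight turns the Volterra operators below into contractions; the estimate is
  \<open>2 \<bar>q\<bar> e \<le> \<bar>q\<bar>\<^sup>2 / c + c e\<^sup>2\<close>.\<close>

lemma exponential_weight:
  obtains c where "c > 0"
    and "\<And>x. integrable lborel (\<lambda>r. indicator {..x} r * (norm (q r) * exp (- c * (x - r))))"
    and "\<And>x. (\<integral>r. indicator {..x} r * (norm (q r) * exp (- c * (x - r))) \<partial>lborel) \<le> 1 / 2"
proof -
  define N where "N = (\<integral>x. (norm (q x))\<^sup>2 \<partial>lborel)"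
  \<comment> \<open>Makes N/(2c) at most 1/4; the exponential part contributes another 1/4 for any
    \<open>c\<close>. The summand 1 keeps \<open>c\<close> positive when \<open>q\<close> vanishes
    almost everywhere.\<close>
  define c where "c = 2 * N + 1"
  have N: "N \<ge> 0" unfolding N_def by simp
  have c: "c > 0" using N by (simp add: c_def)
  have main: "integrable lborel (\<lambda>r. indicator {..x} r * (norm (q r) * exp (- c * (x - r)))) \<and>
    (\<integral>r. indicator {..x} r * (norm (q r) * exp (- c * (x - r))) \<partial>lborel) \<le> 1 / 2" for x
  proof (cases "x \<ge> 0")
    case True
    define E where "E = (\<lambda>r. indicator {0..x} r * exp (- 2 * c * (x - r)))"
    have E: "has_bochner_integral lborel E ((1 - exp (- 2 * c * x)) / (2 * c))"
    proof -
      have "has_bochner_integral lborel (\<lambda>r. exp (- 2 * c * (x - r)) * indicator {0..x} r) 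
          (exp (- 2 * c * (x - x)) / (2 * c) - exp (- 2 * c * (x - 0)) / (2 * c))"
        by (rule has_bochner_integral_FTC_Icc_real) (use True c in \<open>auto intro!: derivative_eq_intros\<close>)
      then show ?thesis by (simp add: E_def diff_divide_distrib mult.commute)
    qed
    have iE: "integrable lborel E" and vE: "integral\<^sup>L lborel E \<le> 1 / (2 * c)"
      using E c by (auto simp: has_bochner_integral_iff divide_right_mono)
    let ?g = "\<lambda>r. (norm (q r))\<^sup>2 / (2 * c) + c / 2 * E r"
    have ig: "integrable lborel ?g" using q_L2 iE by auto
    have le: "norm (indicator {..x} r * (norm (q r) * exp (- c * (x - r)))) \<le> ?g r" for r
    proof (cases "r \<in> {0..x}")
      case r: True
      define e where "e = exp (- c * (x - r))"
      have e2: "exp (- 2 * c * (x - r)) = e\<^sup>2"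
        by (simp add: e_def power2_eq_square exp_add[symmetric] algebra_simps)
      have "0 \<le> (norm (q r) / c - e)\<^sup>2 * (c / 2)" using c by simp
      also have "\<dots> = (norm (q r))\<^sup>2 / (2 * c) + c / 2 * e\<^sup>2 - norm (q r) * e"
        using c by (simp add: power2_eq_square field_simps)
      finally have "norm (q r) * e \<le> (norm (q r))\<^sup>2 / (2 * c) + c / 2 * e\<^sup>2" by simp
      moreover have "e \<ge> 0" by (simp add: e_def)
      ultimately show ?thesis using r unfolding E_def e2 e_def[symmetric] by simp
    next
      case False
      then have "indicator {..x} r * (norm (q r) * exp (- c * (x - r))) = 0"
        by (cases "r < 0") (auto simp: q_zero)
      moreover have "0 \<le> ?g r" using c by (simp add: E_def)
      ultimately show ?thesis by (simp only: norm_zero)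
    qed
    have int: "integrable lborel (\<lambda>r. indicator {..x} r * (norm (q r) * exp (- c * (x - r))))"
    proof (rule Bochner_Integration.integrable_bound[OF ig])
      show "AE r in lborel. norm (indicator {..x} r * (norm (q r) * exp (- c * (x - r)))) \<le> norm (?g r)"
        using order_trans[OF le abs_ge_self] by (intro AE_I2) (simp only: real_norm_def)
    qed measurable
    have "(\<integral>r. indicator {..x} r * (norm (q r) * exp (- c * (x - r))) \<partial>lborel) \<le> integral\<^sup>L lborel ?g"
      by (rule integral_mono[OF int ig]) (use order_trans[OF abs_ge_self le[unfolded real_norm_def]] in blast)
    also have "\<dots> = N / (2 * c) + c / 2 * integral\<^sup>L lborel E"
      using q_L2 iE by (simp add: N_def)
    also have "\<dots> \<le> 1 / 4 + c / 2 * (1 / (2 * c))"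
      using N c vE by (intro add_mono mult_left_mono) (auto simp: c_def field_simps)
    also have "\<dots> = 1 / 2" using c by simp
    finally show ?thesis using int by blast
  next
    case False
    then have "(\<lambda>r. indicator {..x} r * (norm (q r) * exp (- c * (x - r)))) = (\<lambda>r. 0)"
      by (auto simp: indicator_def q_zero)
    then show ?thesis by simp
  qed
  show ?thesis using that[of c] c main by blast
qed

text \<open>At a maximum point of the weighted modulus e^{-cx} |D(x)|, the integral equation and the
  weight bound that maximum by half of itself.\<close>

lemma gronwall_zero:
  assumes D: "ac_on 0 l D (\<lambda>x. q x * D x)" and D0: "D 0 = 0" and x: "x \<in> {0..l}"
  shows "D x = 0"
proof -
  obtain c where c: "c > 0"
    and i: "\<And>x. integrable lborel (\<lambda>r. indicator {..x} r * (norm (q r) * exp (- c * (x - r))))"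
    and le: "\<And>x. (\<integral>r. indicator {..x} r * (norm (q r) * exp (- c * (x - r))) \<partial>lborel) \<le> 1 / 2"
    using exponential_weight by blast
  define h where "h = (\<lambda>x. exp (- c * x) * norm (D x))"
  have ch: "continuous_on {0..l} h"
    unfolding h_def using ac_on_continuous[OF D] by (intro continuous_intros)
  obtain x0 where x0: "x0 \<in> {0..l}" and mx: "\<And>y. y \<in> {0..l} \<Longrightarrow> h y \<le> h x0"
    using continuous_attains_sup[OF _ _ ch] l_pos by auto
  have iD: "set_integrable lborel {0..x0} (\<lambda>x. q x * D x)"
    by (rule set_integrable_subset[OF ac_on_integrable[OF D]]) (use x0 in auto)
  have "h x0 = exp (- c * x0) * norm (LINT r:{0..x0}|lborel. q r * D r)"
    using ac_on_integral_eq[OF D x0] D0 by (simp add: h_def)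
  also have "\<dots> = norm (\<integral>r. exp (- c * x0) *\<^sub>R (indicator {0..x0} r *\<^sub>R (q r * D r)) \<partial>lborel)"
    unfolding integral_scaleR_right norm_scaleR by (simp add: set_lebesgue_integral_def)
  also have "\<dots> \<le> (\<integral>r. h x0 * (indicator {..x0} r * (norm (q r) * exp (- c * (x0 - r)))) \<partial>lborel)"
  proof (rule Bochner_Integration.integral_norm_bound_integral)
    show "integrable lborel (\<lambda>r. exp (- c * x0) *\<^sub>R (indicator {0..x0} r *\<^sub>R (q r * D r)))"
      using iD unfolding set_integrable_def by (rule integrable_scaleR_right)
    show "integrable lborel (\<lambda>r. h x0 * (indicator {..x0} r * (norm (q r) * exp (- c * (x0 - r)))))"
      using i by (rule integrable_mult_right)
    fix r
    show "norm (exp (- c * x0) *\<^sub>R (indicator {0..x0} r *\<^sub>R (q r * D r))) \<le> 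
      h x0 * (indicator {..x0} r * (norm (q r) * exp (- c * (x0 - r))))"
    proof (cases "r \<in> {0..x0}")
      case True
      have "exp (- c * x0) * norm (D r) = exp (- c * (x0 - r)) * h r"
        by (simp add: h_def exp_add[symmetric] algebra_simps flip: mult.assoc)
      also have "\<dots> \<le> exp (- c * (x0 - r)) * h x0"
        using mx[of r] True x0 by (intro mult_left_mono) auto
      finally have "norm (q r) * (exp (- c * x0) * norm (D r)) \<le> norm (q r) * (exp (- c * (x0 - r)) * h x0)"
        by (rule mult_left_mono) simp
      then show ?thesis using True by (simp add: norm_mult mult_ac)
    next
      case False
      then show ?thesis by (auto simp: h_def)
    qed
  qed
  also have "\<dots> = h x0 * (\<integral>r. indicator {..x0} r * (norm (q r) * exp (- c * (x0 - r))) \<partial>lborel)"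
    by (rule integral_mult_right_zero)
  also have "\<dots> \<le> h x0 * (1 / 2)"
    by (intro mult_left_mono le) (auto simp: h_def)
  finally have "h x0 \<le> 0" by simp
  then have "h x \<le> 0" using mx[OF x] by simp
  then show ?thesis by (simp add: h_def mult_le_0_iff)
qed

text \<open>Instead of a chain rule for the reciprocal, the expected primitive \<open>G\<close> of
  -q/f is formed; then D = f G - 1 satisfies D' = q D with D(0) = 0 and must vanish.\<close>

lemma ac_on_inverse:
  assumes f: "ac_on 0 l f (\<lambda>x. q x * f x)" and nz: "\<And>x. x \<in> {0..l} \<Longrightarrow> f x \<noteq> 0"
  shows "ac_on 0 l (\<lambda>x. 1 / f x) (\<lambda>x. - q x * (1 / f x))"
proof -
  have cf: "continuous_on {0..l} (\<lambda>x. - 1 / f x)"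
    using ac_on_continuous[OF f] nz by (intro continuous_intros) auto
  have i: "set_integrable lborel {0..l} (\<lambda>x. - 1 / f x * q x)"
    by (rule set_integrable_mult_continuous[OF q_set_integrable cf]) simp
  define G where "G = (\<lambda>x. 1 / f 0 + (LINT s:{0..x}|lborel. - 1 / f s * q s))"
  have G: "ac_on 0 l G (\<lambda>x. - 1 / f x * q x)"
    unfolding G_def by (rule ac_on_integral[OF i])
  have G0: "G 0 = 1 / f 0"
    using ac_on_integral_eq[OF G, of 0] l_pos by (simp add: G_def)
  define D where "D = (\<lambda>x. f x * G x + - 1)"
  have "ac_on 0 l D (\<lambda>x. (q x * f x * G x + f x * (- 1 / f x * q x)) + 0)"
    unfolding D_def by (rule ac_on_add[OF ac_on_mult[OF f G] ac_on_const])
  then have "ac_on 0 l D (\<lambda>x. q x * D x)"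
    by (rule ac_on_cong) (use nz in \<open>auto simp: D_def field_simps\<close>)
  then have "D x = 0" if "x \<in> {0..l}" for x
    by (rule gronwall_zero) (use that nz[of 0] l_pos in \<open>auto simp: D_def G0\<close>)
  then have "G x = 1 / f x" if "x \<in> {0..l}" for x
    using that nz[OF that] by (simp add: D_def field_simps)
  with G show ?thesis by (rule ac_on_cong[OF _ _]) auto
qed

end

section \<open>A smooth step function\<close>

lemma frechet_derivative_real:
  fixes \<phi> :: "real \<Rightarrow> real"
  assumes "(\<phi> has_real_derivative d) (at x)"
  shows "frechet_derivative \<phi> (at x) 1 = d"
  using frechet_derivative_at[OF assms[unfolded has_field_derivative_def]] by (metis mult.right_neutral)

text \<open>Replaces \<open>frechet_derivative\<close> by an explicitly named derivative, so that
  smoothness can be proved by ordinary calculus and induction on \<open>k\<close>.\<close>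

lemma C_k_SucI:
  fixes \<phi> :: "real \<Rightarrow> real"
  assumes d: "\<And>x. (\<phi> has_real_derivative \<psi> x) (at x)" and "C_k k \<psi>"
  shows "C_k (Suc k) \<phi>"
proof -
  have "(\<lambda>x. frechet_derivative \<phi> (at x) 1) = \<psi>"
    using frechet_derivative_real[OF d] by auto
  then show ?thesis using assms d by (auto simp: real_differentiable_def)
qed

lemma C_k_SucD:
  fixes \<phi> :: "real \<Rightarrow> real"
  assumes "C_k (Suc k) \<phi>"
  obtains \<psi> where "\<And>x. (\<phi> has_real_derivative \<psi> x) (at x)" "C_k k \<psi>"
proof -
  have "(\<phi> has_real_derivative frechet_derivative \<phi> (at x) 1) (at x)" for x
  proof -
    obtain d where d: "(\<phi> has_real_derivative d) (at x)"
      using assms by (auto simp: real_differentiable_def)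
    then show ?thesis using frechet_derivative_real by metis
  qed
  moreover have "C_k k (\<lambda>x. frechet_derivative \<phi> (at x) 1)" using assms by simp
  ultimately show ?thesis by (rule that)
qed

lemma C_k_add:
  fixes \<phi> \<psi> :: "real \<Rightarrow> real"
  shows "C_k k \<phi> \<Longrightarrow> C_k k \<psi> \<Longrightarrow> C_k k (\<lambda>x. \<phi> x + \<psi> x)"
proof (induction k arbitrary: \<phi> \<psi>)
  case 0
  then show ?case by (auto intro: continuous_intros)
next
  case (Suc k)
  obtain d e where "\<And>x. (\<phi> has_real_derivative d x) (at x)" "C_k k d"
    "\<And>x. (\<psi> has_real_derivative e x) (at x)" "C_k k e"
    using C_k_SucD[OF Suc.prems(1)] C_k_SucD[OF Suc.prems(2)] by metis
  then show ?case by (intro C_k_SucI[where \<psi>="\<lambda>x. d x + e x"] Suc.IH) (auto intro!: derivative_eq_intros)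
qed

lemma C_k_imp_pred:
  fixes \<phi> :: "real \<Rightarrow> real"
  shows "C_k (Suc k) \<phi> \<Longrightarrow> C_k k \<phi>"
proof (induction k arbitrary: \<phi>)
  case 0
  obtain d where "\<And>x. (\<phi> has_real_derivative d x) (at x)" 
    using C_k_SucD[OF 0] by metis
  then show ?case using DERIV_continuous_on[of UNIV \<phi> d] by simp
next
  case (Suc k)
  obtain d where d: "\<And>x. (\<phi> has_real_derivative d x) (at x)" "C_k (Suc k) d"
    using C_k_SucD[OF Suc.prems] by metis
  show ?case by (rule C_k_SucI[OF d(1) Suc.IH[OF d(2)]])
qed

lemma C_k_mult:
  fixes \<phi> \<psi> :: "real \<Rightarrow> real"
  shows "C_k k \<phi> \<Longrightarrow> C_k k \<psi> \<Longrightarrow> C_k k (\<lambda>x. \<phi> x * \<psi> x)"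
proof (induction k arbitrary: \<phi> \<psi>)
  case 0
  then show ?case by (auto intro: continuous_intros)
next
  case (Suc k)
  obtain d e where "\<And>x. (\<phi> has_real_derivative d x) (at x)" "C_k k d"
    "\<And>x. (\<psi> has_real_derivative e x) (at x)" "C_k k e"
    using C_k_SucD[OF Suc.prems(1)] C_k_SucD[OF Suc.prems(2)] by metis
  moreover have "C_k k \<phi>" "C_k k \<psi>" using Suc.prems by (auto intro!: C_k_imp_pred simp del: C_k.simps)
  ultimately show ?case 
    by (intro C_k_SucI[where \<psi>="\<lambda>x. d x * \<psi> x + e x * \<phi> x"] C_k_add Suc.IH) (auto intro!: derivative_eq_intros)
qed

lemma C_k_const: "C_k k (\<lambda>x::real. c)"
proof (induction k arbitrary: c)
  case (Suc k)
  show ?case by (rule C_k_SucI[where \<psi>="\<lambda>x. 0"]) (auto intro: Suc)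
qed auto

lemma C_k_affine:
  fixes \<phi> :: "real \<Rightarrow> real"
  shows "C_k k \<phi> \<Longrightarrow> C_k k (\<lambda>x. \<phi> (a + b * x))"
proof (induction k arbitrary: \<phi>)
  case 0
  then show ?case by (auto intro!: continuous_on_compose2[of UNIV \<phi>] continuous_intros)
next
  case (Suc k)
  obtain d where d: "\<And>x. (\<phi> has_real_derivative d x) (at x)" "C_k k d"
    using C_k_SucD[OF Suc.prems] by metis
  have "((\<lambda>x. \<phi> (a + b * x)) has_real_derivative d (a + b * x) * b) (at x)" for x
    by (rule DERIV_chain2[OF d(1)]) (auto intro!: derivative_eq_intros)
  then show ?case by (rule C_k_SucI[OF _ C_k_mult[OF Suc.IH[OF d(2)] C_k_const]])
qed

text \<open>The powers in the denominator make the family closed under differentiation up to linear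
  combinations; this is what lets one induction prove smoothness of every member.\<close>

definition flat :: "nat \<Rightarrow> real \<Rightarrow> real" where
  "flat n x = (if x \<le> 0 then 0 else exp (- 1 / x) / x ^ n)"

lemma flat_tendsto_0: "((\<lambda>x. exp (- 1 / x) / x ^ n) \<longlongrightarrow> 0) (at_right (0::real))"
proof -
  have "((\<lambda>x. inverse x ^ n / exp (inverse x)) \<longlongrightarrow> 0) (at_right (0::real))"
    by (rule filterlim_compose[OF tendsto_power_div_exp_0 filterlim_inverse_at_top_right])
  moreover have "inverse x ^ n / exp (inverse x) = exp (- 1 / x) / x ^ n" for x :: real
    by (simp add: exp_minus inverse_eq_divide field_simps)
  ultimately show ?thesis by simp
qed

text \<open>Only the origin needs an argument: the right-hand difference quotient there is
  \<open>flat (Suc n)\<close>, and the exponential beats every power.\<close>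

lemma has_derivative_flat:
  "(flat n has_real_derivative flat (n + 2) x - real n * flat (n + 1) x) (at x)"
proof (cases "x = 0")
  case True
  have "((\<lambda>h. flat n h / h) \<longlongrightarrow> 0) (at_right 0)"
    using flat_tendsto_0[of "Suc n"]
    by (rule Lim_transform_eventually) (auto simp: flat_def eventually_at_filter)
  moreover have "((\<lambda>h. flat n h / h) \<longlongrightarrow> 0) (at_left 0)"
    by (rule tendsto_eventually) (auto simp: flat_def eventually_at_filter)
  ultimately have "((\<lambda>h. flat n h / h) \<longlongrightarrow> 0) (at 0)"
    by (simp add: filterlim_at_split)
  then show ?thesis using True by (simp add: DERIV_def flat_def)
next
  case False
  show ?thesis
  proof (cases "x < 0")
    case True
    have "((\<lambda>x. 0) has_real_derivative 0) (at x)" by simp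
    then have "(flat n has_real_derivative 0) (at x)"
      by (rule has_field_derivative_transform_within_open[where S="{..<0}"]) (use True in \<open>auto simp: flat_def\<close>)
    then show ?thesis using True by (simp add: flat_def)
  next
    case x: False
    with False have x: "x > 0" by simp
    have "((\<lambda>x. exp (- 1 / x) / x ^ n) has_real_derivative flat (n + 2) x - real n * flat (n + 1) x) (at x)"
    \<comment> \<open>The derivative of \<open>x ^ n\<close> carries the exponent
      \<open>n - Suc 0\<close>, so \<open>n = 0\<close> is treated apart.\<close>
    proof (cases n)
      case 0
      then show ?thesis using x by (auto intro!: derivative_eq_intros simp: flat_def power2_eq_square)
    next
      case (Suc m)
      have "exp (- 1 / x) * (1 / (x * x)) * x ^ n - exp (- 1 / x) * (real n * x ^ (n - Suc 0)) = 
         (flat (n + 2) x - real n * flat (n + 1) x) * (x ^ n * x ^ n)"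
        using x Suc by (simp add: flat_def field_simps)
      then have "(exp (- 1 / x) * (1 / (x * x)) * x ^ n - exp (- 1 / x) * (real n * x ^ (n - Suc 0))) / (x ^ n * x ^ n) = 
         flat (n + 2) x - real n * flat (n + 1) x"
        using x by (simp add: field_simps)
      moreover have "((\<lambda>x. exp (- 1 / x)) has_real_derivative exp (- 1 / x) * (1 / (x * x))) (at x)"
        using x by (auto intro!: derivative_eq_intros)
      ultimately show ?thesis 
        using x DERIV_divide[OF _ DERIV_pow[of n x UNIV], of "\<lambda>x. exp (- 1 / x)" "exp (- 1 / x) * (1 / (x * x))"]
        by (auto simp del: minus_divide_left)
    qed
    then show ?thesis
      by (rule has_field_derivative_transform_within_open[where S="{0<..}"]) (use x in \<open>auto simp: flat_def\<close>)
  qed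
qed

lemma C_k_flat: "C_k k (flat n)"
proof (induction k arbitrary: n)
  case 0
  then show ?case using DERIV_continuous_on[of UNIV "flat n", OF has_derivative_flat] by simp
next
  case (Suc k)
  have "C_k k (\<lambda>x. flat (n + 2) x + (- real n) * flat (n + 1) x)"
    by (intro C_k_add C_k_mult C_k_const Suc)
  then show ?case
    by (intro C_k_SucI[OF has_derivative_flat]) simp
qed

text \<open>The normalised primitive of a bump on (0,1). Rescaled, \<beta> is an approximate
  identity, and differences of rescaled copies of \<sigma> are compactly supported test
  functions.\<close>

lemma smooth_step:
  obtains \<sigma> \<beta> :: "real \<Rightarrow> real" where "\<And>k. C_k k \<sigma>" "\<And>x. (\<sigma> has_real_derivative \<beta> x) (at x)"
    "\<And>x. \<beta> x \<ge> 0" "continuous_on UNIV \<beta>"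
    "\<And>x. x \<le> 0 \<Longrightarrow> \<sigma> x = 0" "\<And>x. x \<ge> 1 \<Longrightarrow> \<sigma> x = 1" "\<And>x. x \<notin> {0<..<1} \<Longrightarrow> \<beta> x = 0"
proof -
  define b where "b = (\<lambda>x. flat 0 (0 + 1 * x) * flat 0 (1 + - 1 * x))"
  have Cb: "C_k k b" for k unfolding b_def by (intro C_k_mult C_k_affine C_k_flat)
  have cb: "continuous_on UNIV b" using Cb[of 0] by simp
  have b0: "b x \<ge> 0" for x by (simp add: b_def flat_def)
  have bz: "b x = 0" if "x \<notin> {0<..<1}" for x using that by (auto simp: b_def flat_def)
  have bp: "b x > 0" if "x \<in> {0<..<1}" for x using that by (auto simp: b_def flat_def)
  have int: "b integrable_on {u..v}" for u v
    by (rule integrable_continuous_real) (rule continuous_on_subset[OF cb], simp)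
  \<comment> \<open>Starting at -1 makes the interval a two-sided neighbourhood of every point of
    [0,1]; further left, \<open>s\<close> is constantly zero.\<close>
  define s where "s = (\<lambda>x. integral {-1..x} b)"
  have ds: "(s has_real_derivative b x) (at x)" if x: "x > -1" for x
  proof -
    have "(s has_real_derivative b x) (at x within {-1..x+1})"
      unfolding s_def by (rule integral_has_real_derivative) (use x in \<open>auto intro: continuous_on_subset[OF cb]\<close>)
    then have "(s has_real_derivative b x) (at x within {-1<..<x+1})"
      by (rule DERIV_subset) auto
    then show ?thesis using x by (simp add: at_within_open[of x "{-1<..<x+1}"])
  qed
  have s0: "s x = 0" if "x \<le> 0" for x
    unfolding s_def using that by (subst integral_cong[of _ b "\<lambda>x. 0"]) (auto simp: bz)
  have s1: "s x = s 1" if "x \<ge> 1" for x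
  proof -
    have "s x = s 1 + integral {1..x} b"
      unfolding s_def using that int by (subst Henstock_Kurzweil_Integration.integral_combine) auto
    also have "integral {1..x} b = integral {1..x} (\<lambda>x. 0)" by (rule integral_cong) (auto simp: bz)
    finally show ?thesis by simp
  qed
  \<comment> \<open>By the mean value theorem \<open>s 1\<close> is a value of \<open>b\<close> at
    an interior point, where \<open>b\<close> is positive.\<close>
  have s1p: "s 1 > 0"
  proof -
    have "\<exists>z. z > 0 \<and> z < 1 \<and> s 1 - s 0 = (1 - 0) * b z"
      by (rule MVT2) (auto intro!: ds)
    then show ?thesis using s0[of 0] bp by auto
  qed
  have ds': "(s has_real_derivative b x) (at x)" for x
  proof (cases "x > -1")
    case False
    have "((\<lambda>x. 0) has_real_derivative 0) (at x)" by simp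
    then have "(s has_real_derivative 0) (at x)"
      by (rule has_field_derivative_transform_within_open[where S="{..<0}"]) (use False s0 in \<open>auto\<close>)
    then show ?thesis using False by (simp add: bz)
  qed (rule ds)
  define \<sigma> where "\<sigma> = (\<lambda>x. (1 / s 1) * s x)"
  define \<beta> where "\<beta> = (\<lambda>x. (1 / s 1) * b x)"
  have d: "(\<sigma> has_real_derivative \<beta> x) (at x)" for x
    unfolding \<sigma>_def \<beta>_def by (rule DERIV_cmult[OF ds'])
  have C\<beta>: "C_k k \<beta>" for k unfolding \<beta>_def by (intro C_k_mult C_k_const Cb)
  have "C_k k \<sigma>" for k
    by (rule C_k_imp_pred, rule C_k_SucI[OF d C\<beta>])
  then show ?thesis
  proof (rule that[OF _ d])
    show "continuous_on UNIV \<beta>" using C\<beta>[of 0] by simp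
    show "\<beta> x \<ge> 0" for x using b0[of x] s1p by (simp add: \<beta>_def)
    show "\<sigma> x = 0" if "x \<le> 0" for x using s0[OF that] by (simp add: \<sigma>_def)
    show "\<sigma> x = 1" if "x \<ge> 1" for x using s1[OF that] s1p by (simp add: \<sigma>_def)
    show "\<beta> x = 0" if "x \<notin> {0<..<1}" for x using bz[OF that] by (simp add: \<beta>_def)
  qed
qed

section \<open>Weak derivatives on an interval\<close>

text \<open>Weak derivatives are defined with \<open>lebesgue\<close>, while all computations with
  Fubini take place in \<open>lborel\<close>; this is the passage for Borel integrands.\<close>

lemma set_integral_lebesgue_eq_lborel:
  fixes u :: "'a::euclidean_space \<Rightarrow> 'b::euclidean_space"
  assumes "(\<lambda>x. indicator S x *\<^sub>R u x) \<in> borel_measurable borel"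
  shows "(LINT x:S|lebesgue. u x) = (LINT x:S|lborel. u x)"
    and "set_integrable lebesgue S u \<longleftrightarrow> set_integrable lborel S u"
  using assms unfolding set_lebesgue_integral_def set_integrable_def
  by (auto intro!: integral_completion integrable_completion)

lemma set_borel_measurable_of_integrable:
  "set_integrable lborel S u \<Longrightarrow> (\<lambda>x. indicator S x *\<^sub>R u x) \<in> borel_measurable borel"
  by (auto simp: set_integrable_def dest!: borel_measurable_integrable)

lemma set_integral_open_closed:
  fixes u :: "real \<Rightarrow> 'b::{banach, second_countable_topology}"
  shows "(LINT x:{a<..<b}|lborel. u x) = (LINT x:{a..b}|lborel. u x)"
    and "set_integrable lborel {a<..<b} u \<longleftrightarrow> set_integrable lborel {a..b} u"
proof -
  have 1: "indicator {a<..<b} x *\<^sub>R u x = indicator {a..b} x *\<^sub>R u x" if "x \<notin> {a, b}" for x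
    using that by (auto simp: indicator_def)
  have 2: "countable {a, b}" "\<And>x. {x} \<in> sets lborel" "\<And>x. emeasure lborel {x} = 0" by auto
  show "(LINT x:{a<..<b}|lborel. u x) = (LINT x:{a..b}|lborel. u x)"
    unfolding set_lebesgue_integral_def
    by (rule integral_discrete_difference[where X="{a, b}"]) (use 1 in auto)
  show "set_integrable lborel {a<..<b} u \<longleftrightarrow> set_integrable lborel {a..b} u"
    unfolding set_integrable_def
    by (rule integrable_discrete_difference[where X="{a, b}"]) (use 1 in auto)
qed

lemma test_function_eq_0: "test_function \<Omega> \<phi> \<Longrightarrow> x \<notin> \<Omega> \<Longrightarrow> \<phi> x = 0"
  unfolding test_function_def using closure_subset[of "{x. \<phi> x \<noteq> 0}"] by auto

lemma test_function_real_derivative: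
  fixes \<phi> :: "real \<Rightarrow> real"
  assumes "test_function \<Omega> \<phi>"
  defines "\<phi>' \<equiv> \<lambda>x. frechet_derivative \<phi> (at x) 1"
  shows "(\<phi> has_real_derivative \<phi>' x) (at x)" "continuous_on UNIV \<phi>'"
proof -
  have "C_k (Suc 0) \<phi>" using assms(1) unfolding test_function_def by blast
  then obtain \<psi> where \<psi>: "\<And>x. (\<phi> has_real_derivative \<psi> x) (at x)" "C_k 0 \<psi>"
    using C_k_SucD by metis
  then have "\<phi>' = \<psi>" unfolding \<phi>'_def using frechet_derivative_real by blast
  then show "(\<phi> has_real_derivative \<phi>' x) (at x)" "continuous_on UNIV \<phi>'" using \<psi> by auto
qed

text \<open>Integrate the derivative of \<phi> F. Asking only for a C^1 function with zeros at both
  ends makes the formula applicable also to the slices of a test function on the triangle.\<close>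

lemma ac_on_weak_formula:
  fixes \<phi> \<phi>' :: "real \<Rightarrow> real"
  assumes F: "ac_on a b F F'" and ab: "a \<le> b"
    and d: "\<And>x. (\<phi> has_real_derivative \<phi>' x) (at x)" and c: "continuous_on UNIV \<phi>'"
    and z: "\<phi> a = 0" "\<phi> b = 0"
  shows "(LINT x:{a..b}|lborel. \<phi>' x *\<^sub>R F x) = - (LINT x:{a..b}|lborel. \<phi> x *\<^sub>R F' x)"
    and "set_integrable lborel {a..b} (\<lambda>x. \<phi>' x *\<^sub>R F x)"
    and "set_integrable lborel {a..b} (\<lambda>x. \<phi> x *\<^sub>R F' x)"
proof -
  have c': "continuous_on {a..b} (\<lambda>x. complex_of_real (\<phi>' x))"
    using c by (auto intro!: continuous_intros intro: continuous_on_subset)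
  have P: "ac_on a b (\<lambda>x. of_real (\<phi> x)) (\<lambda>x. of_real (\<phi>' x))"
  proof (rule ac_on_C1[OF _ c'])
    fix x 
    have "((\<lambda>x. complex_of_real (\<phi> x)) has_vector_derivative of_real (\<phi>' x)) (at x)"
      using d[of x] by (rule has_vector_derivative_of_real)
    then show "((\<lambda>x. complex_of_real (\<phi> x)) has_vector_derivative of_real (\<phi>' x)) (at x within {a..b})"
      by (rule has_vector_derivative_at_within)
  qed
  have cP: "continuous_on {a..b} (\<lambda>x. complex_of_real (\<phi> x))" by (rule ac_on_continuous[OF P])
  have cF: "continuous_on {a..b} F" by (rule ac_on_continuous[OF F])
  have i1: "set_integrable lborel {a..b} (\<lambda>x. F x * of_real (\<phi>' x))"
    by (rule set_integrable_mult_continuous[OF ac_on_integrable[OF P] cF])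
  have i2: "set_integrable lborel {a..b} (\<lambda>x. of_real (\<phi> x) * F' x)"
    by (rule set_integrable_mult_continuous[OF ac_on_integrable[OF F] cP])
  show "set_integrable lborel {a..b} (\<lambda>x. \<phi>' x *\<^sub>R F x)"
    using i1 by (simp add: scaleR_conv_of_real mult.commute)
  show "set_integrable lborel {a..b} (\<lambda>x. \<phi> x *\<^sub>R F' x)"
    using i2 by (simp add: scaleR_conv_of_real)
  have "(LINT x:{a..b}|lborel. F x * of_real (\<phi>' x) + of_real (\<phi> x) * F' x) = 0"
    using ac_on_integral_eq[OF ac_on_mult[OF P F], of b] ab z by (simp add: mult.commute)
  then have "(LINT x:{a..b}|lborel. F x * of_real (\<phi>' x)) + (LINT x:{a..b}|lborel. of_real (\<phi> x) * F' x) = 0"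
    by (simp add: set_integral_add(2)[OF i1 i2])
  then show "(LINT x:{a..b}|lborel. \<phi>' x *\<^sub>R F x) = - (LINT x:{a..b}|lborel. \<phi> x *\<^sub>R F' x)"
    by (simp add: scaleR_conv_of_real mult.commute eq_neg_iff_add_eq_0)
qed

lemma ac_on_has_weak_partial:
  assumes F: "ac_on a b F F'" and ab: "a \<le> b"
  shows "has_weak_partial {a<..<b} 1 F F'"
proof -
  have cF: "continuous_on {a..b} F" by (rule ac_on_continuous[OF F])
  have iF: "set_integrable lborel {a..b} F"
    unfolding set_integrable_def by (rule borel_integrable_compact) (use cF in auto)
  have loc: "locally_integrable {a<..<b} u" if u: "set_integrable lborel {a..b} u" for u :: "real \<Rightarrow> complex"
    unfolding locally_integrable_def
  proof (intro allI impI)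
    fix C :: "real set" assume C: "compact C \<and> C \<subseteq> {a<..<b}"
    have "{a<..<b} \<subseteq> {a..b}" by (rule subsetI) simp
    then have "C \<subseteq> {a..b}" using C by blast
    then have "set_integrable lborel C u"
      using u C by (intro set_integrable_subset[OF u]) (auto simp: compact_imp_closed borel_closed)
    then show "u absolutely_integrable_on C"
      using set_integral_lebesgue_eq_lborel(2)[OF set_borel_measurable_of_integrable] by blast
  qed
  show ?thesis unfolding has_weak_partial_def
  proof (intro conjI allI impI)
    show "locally_integrable {a<..<b} F" "locally_integrable {a<..<b} F'"
      by (rule loc[OF iF], rule loc[OF ac_on_integrable[OF F]])
    fix \<phi> :: "real \<Rightarrow> real" assume t: "test_function {a<..<b} \<phi>"
    let ?\<phi>' = "\<lambda>x. frechet_derivative \<phi> (at x) 1"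
    have z: "\<phi> a = 0" "\<phi> b = 0" using test_function_eq_0[OF t] by auto
    note w = ac_on_weak_formula[OF F ab test_function_real_derivative[OF t] z]
    have "(LINT x:{a<..<b}|lebesgue. ?\<phi>' x *\<^sub>R F x) = (LINT x:{a<..<b}|lborel. ?\<phi>' x *\<^sub>R F x)"
      using w(2) by (intro set_integral_lebesgue_eq_lborel set_borel_measurable_of_integrable) 
        (simp add: set_integral_open_closed)
    moreover have "(LINT x:{a<..<b}|lebesgue. \<phi> x *\<^sub>R F' x) = (LINT x:{a<..<b}|lborel. \<phi> x *\<^sub>R F' x)"
      using w(3) by (intro set_integral_lebesgue_eq_lborel set_borel_measurable_of_integrable) 
        (simp add: set_integral_open_closed)
    ultimately show "(LINT x:{a<..<b}|lebesgue. ?\<phi>' x *\<^sub>R F x) = - (LINT x:{a<..<b}|lebesgue. \<phi> x *\<^sub>R F' x)"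
      using w(1) by (simp add: set_integral_open_closed)
  qed
qed

text \<open>Real and imaginary parts are replaced separately by Borel functions; the final cut-off
  makes the representative vanish everywhere off \<open>S\<close>, not just almost
  everywhere.\<close>

lemma lebesgue_borel_version:
  fixes g :: "real \<Rightarrow> complex"
  assumes "set_borel_measurable lebesgue S g" "S \<in> sets borel"
  obtains g' where "g' \<in> borel_measurable borel" "AE x in lebesgue. indicator S x *\<^sub>R g x = g' x"
    "\<And>x. x \<notin> S \<Longrightarrow> g' x = 0"
proof -
  let ?g = "\<lambda>x. indicator S x *\<^sub>R g x"
  have m: "?g \<in> borel_measurable (completion lborel)" using assms by (simp add: set_borel_measurable_def)
  have "(\<lambda>x. Re (?g x)) \<in> borel_measurable (completion lborel)" "(\<lambda>x. Im (?g x)) \<in> borel_measurable (completion lborel)"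
    using borel_measurable_Re[THEN measurable_compose_rev, OF m] borel_measurable_Im[THEN measurable_compose_rev, OF m] by auto
  then obtain r i where ri: "r \<in> borel_measurable lborel" "AE x in lborel. Re (?g x) = r x"
     "i \<in> borel_measurable lborel" "AE x in lborel. Im (?g x) = i x"
    using completion_ex_borel_measurable_real[of "\<lambda>x. Re (?g x)" lborel] 
      completion_ex_borel_measurable_real[of "\<lambda>x. Im (?g x)" lborel] by blast
  define g' where "g' = (\<lambda>x. indicator S x *\<^sub>R Complex (r x) (i x))"
  have "AE x in lborel. ?g x = g' x"
    using ri(2,4) by eventually_elim (auto simp: g'_def indicator_def complex_eq_iff)
  moreover have "g' \<in> borel_measurable borel"
    unfolding g'_def Complex_eq using ri assms(2) by (auto intro!: borel_measurable_scaleR borel_measurable_indicator borel_measurable_add borel_measurable_times)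
  ultimately show ?thesis using that[of g'] AE_completion by (auto simp: g'_def)
qed

text \<open>The kernel n \<beta>(n(x - a)) is the derivative of \<sigma>(n(x - a)), hence has mass
  1, and it lives on (a, a + 1/n), where continuity of \<open>D\<close> controls the error.\<close>

lemma mollifier_tendsto:
  fixes D :: "real \<Rightarrow> complex" and \<sigma> \<beta> :: "real \<Rightarrow> real"
  assumes D: "continuous_on {0..l} D" and a: "0 < a" "a < l"
    and d: "\<And>x. (\<sigma> has_real_derivative \<beta> x) (at x)" and \<beta>: "\<And>x. \<beta> x \<ge> 0" "continuous_on UNIV \<beta>"
    and \<sigma>: "\<And>x. x \<le> 0 \<Longrightarrow> \<sigma> x = 0" "\<And>x. x \<ge> 1 \<Longrightarrow> \<sigma> x = 1" "\<And>x. x \<notin> {0<..<1} \<Longrightarrow> \<beta> x = 0"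
  shows "(\<lambda>n. integral {0..l} (\<lambda>x. (real n * \<beta> (real n * (x - a))) *\<^sub>R D x)) \<longlonglongrightarrow> D a"
proof (rule LIMSEQ_I)
  fix r :: real assume r: "r > 0"
  have "\<exists>\<delta>>0. \<forall>x\<in>{0..l}. dist x a < \<delta> \<longrightarrow> dist (D x) (D a) < r/2"
    using D a r unfolding continuous_on_iff by (metis atLeastAtMost_iff half_gt_zero less_eq_real_def)
  then obtain \<delta> where \<delta>: "\<delta> > 0" "\<And>x. x \<in> {0..l} \<Longrightarrow> dist x a < \<delta> \<Longrightarrow> dist (D x) (D a) < r/2" by blast
  \<comment> \<open>Beyond \<open>N\<close> the support (a, a + 1/n) lies within \<delta> of
    \<open>a\<close> and inside the interval.\<close>
  obtain N where N: "real N > 1 / min \<delta> (l - a)" using reals_Archimedean2 by blast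
  show "\<exists>no. \<forall>n\<ge>no. norm (integral {0..l} (\<lambda>x. (real n * \<beta> (real n * (x - a))) *\<^sub>R D x) - D a) < r"
  proof (intro exI allI impI)
    fix n assume "n \<ge> N"
    then have n: "real n > 1 / min \<delta> (l - a)" using N by (meson less_le_trans of_nat_le_iff)
    have m0: "0 < min \<delta> (l - a)" using \<delta> a by simp
    have n0: "real n > 0" using n m0 by (meson less_trans zero_less_divide_1_iff)
    have nd: "real n * \<delta> > 1" "real n * (l - a) > 1"
    proof -
      have "real n * min \<delta> (l - a) > 1" using n m0 by (simp add: field_simps)
      then show "real n * \<delta> > 1" "real n * (l - a) > 1" 
        using n0 by (meson less_le_trans min.cobounded1 min.cobounded2 mult_left_mono less_imp_le)+
    qed
    let ?k = "\<lambda>x. real n * \<beta> (real n * (x - a))"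
    have ck: "continuous_on {0..l} ?k"
      by (intro continuous_intros continuous_on_compose2[OF \<beta>(2)]) auto
    have hk: "(?k has_integral 1) {0..l}"
    proof -
      have "((\<lambda>x. \<sigma> (real n * (x - a))) has_vector_derivative ?k x) (at x within {0..l})" for x
      proof -
        have "((\<lambda>x. \<sigma> (real n * (x - a))) has_real_derivative \<beta> (real n * (x - a)) * real n) (at x)"
          by (rule DERIV_chain2[OF d]) (auto intro!: derivative_eq_intros)
        then show ?thesis 
          by (simp add: has_real_derivative_iff_has_vector_derivative mult.commute has_vector_derivative_at_within)
      qed
      then have "(?k has_integral (\<sigma> (real n * (l - a)) - \<sigma> (real n * (0 - a)))) {0..l}"
        using a by (intro fundamental_theorem_of_calculus) auto
      moreover have "\<sigma> (real n * (l - a)) = 1" using nd by (intro \<sigma>) simp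
      moreover have "\<sigma> (real n * (0 - a)) = 0" using a by (intro \<sigma>) (simp add: mult_nonneg_nonpos)
      ultimately show ?thesis by simp
    qed
    have c: "((\<lambda>x. ?k x *\<^sub>R D a) has_integral 1 *\<^sub>R D a) {0..l}"
      using has_integral_scaleR_left[OF hk, of "D a"] .
    have i: "(\<lambda>x. ?k x *\<^sub>R D x) integrable_on {0..l}"
      by (intro integrable_continuous_real continuous_intros ck D)
    have "integral {0..l} (\<lambda>x. ?k x *\<^sub>R D x) - D a = integral {0..l} (\<lambda>x. ?k x *\<^sub>R D x - ?k x *\<^sub>R D a)"
      using Henstock_Kurzweil_Integration.integral_diff[OF i has_integral_integrable[OF c]] integral_unique[OF c] by simp
    also have "norm \<dots> \<le> integral {0..l} (\<lambda>x. ?k x * (r / 2))"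
    proof (rule integral_norm_bound_integral)
      show "(\<lambda>x. ?k x *\<^sub>R D x - ?k x *\<^sub>R D a) integrable_on {0..l}"
        by (intro integrable_continuous_real continuous_intros ck D)
      show "(\<lambda>x. ?k x * (r / 2)) integrable_on {0..l}"
        by (intro integrable_continuous_real continuous_intros ck)
      fix x assume x: "x \<in> {0..l}"
      have "norm (?k x *\<^sub>R D x - ?k x *\<^sub>R D a) = ?k x * norm (D x - D a)"
        using \<beta>(1) by (simp flip: scaleR_diff_right)
      also have "\<dots> \<le> ?k x * (r / 2)"
      proof (cases "real n * (x - a) \<in> {0<..<1}")
        case True
        then have "real n * 0 < real n * (x - a)" "real n * (x - a) < real n * \<delta>" using nd by auto
        then have "x - a > 0" "x - a < \<delta>" unfolding mult_less_cancel_left_pos[OF n0] .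
        then have "norm (D x - D a) \<le> r / 2" using \<delta>(2)[OF x] by (simp add: dist_norm)
        then show ?thesis using \<beta>(1) by (intro mult_left_mono) auto
      next
        case False
        then show ?thesis using \<sigma>(3) by simp
      qed
      finally show "norm (?k x *\<^sub>R D x - ?k x *\<^sub>R D a) \<le> ?k x * (r / 2)" .
    qed
    also have "\<dots> = r / 2" using integral_unique[OF has_integral_mult_left[OF hk, of "r / 2"]] by simp
    finally show "norm (integral {0..l} (\<lambda>x. ?k x *\<^sub>R D x) - D a) < r" using r by simp
  qed
qed

text \<open>The du Bois-Reymond argument: a smooth plateau over [a,b] has as derivative a mollifier
  at \<open>a\<close> minus a mollifier at \<open>b\<close>, so in the limit the hypothesis says
  D(a) = D(b). Continuity then covers the end points.\<close>

lemma weak_derivative_zero_imp_constant: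
  fixes D :: "real \<Rightarrow> complex"
  assumes D: "continuous_on {0..l} D" and l: "l > 0"
    and w: "\<And>\<phi>. test_function {0<..<l} \<phi> \<Longrightarrow> integral {0..l} (\<lambda>x. frechet_derivative \<phi> (at x) 1 *\<^sub>R D x) = 0"
    and x: "x \<in> {0..l}"
  shows "D x = D 0"
proof -
  obtain \<sigma> \<beta> :: "real \<Rightarrow> real" where C: "\<And>k. C_k k \<sigma>" and d: "\<And>x. (\<sigma> has_real_derivative \<beta> x) (at x)"
    and \<beta>: "\<And>x. \<beta> x \<ge> 0" "continuous_on UNIV \<beta>"
    and \<sigma>: "\<And>x. x \<le> 0 \<Longrightarrow> \<sigma> x = 0" "\<And>x. x \<ge> 1 \<Longrightarrow> \<sigma> x = 1" "\<And>x. x \<notin> {0<..<1} \<Longrightarrow> \<beta> x = 0"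
    using smooth_step by metis
  have eq: "D a = D b" if ab: "0 < a" "a < b" "b < l" for a b
  proof -
    let ?J = "\<lambda>a n. integral {0..l} (\<lambda>x. (real n * \<beta> (real n * (x - a))) *\<^sub>R D x)"
    have "?J a \<longlonglongrightarrow> D a" "?J b \<longlonglongrightarrow> D b"
      using ab by (auto intro!: mollifier_tendsto[OF D _ _ d \<beta> \<sigma>])
    then have lim: "(\<lambda>n. ?J a n - ?J b n) \<longlonglongrightarrow> D a - D b" by (rule tendsto_diff)
    obtain N where N: "real N > 1 / (l - b)" using reals_Archimedean2 by blast
    have "?J a n - ?J b n = 0" if "n \<ge> N" for n
    proof -
      have n: "real n > 1 / (l - b)" using N that by (meson less_le_trans of_nat_le_iff)
      then have n0: "real n > 0" using ab by (meson diff_gt_0_iff_gt less_trans zero_less_divide_1_iff)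
      have nb: "b + 1 / real n < l" using n n0 ab by (simp add: field_simps)
      \<comment> \<open>The plateau: one step up just after \<open>a\<close>, one step down just
        after \<open>b\<close>, each of width 1/n. Its support lies in [a, b + 1/n], which is inside
        (0,l) because n exceeds 1/(l - b).\<close>
      define \<phi> where "\<phi> = (\<lambda>x. \<sigma> (- real n * a + real n * x) + (- 1) * \<sigma> (- real n * b + real n * x))"
      have C\<phi>: "C_k k \<phi>" for k
        unfolding \<phi>_def by (intro C_k_add C_k_mult[OF C_k_const] C_k_affine C)
      have z: "x \<in> {a..b + 1 / real n}" if "\<phi> x \<noteq> 0" for x
      proof (rule ccontr)
        assume x: "x \<notin> {a..b + 1 / real n}"
        consider "x < a" | "x > b + 1 / real n" using x by fastforce
        then show False
        proof cases
          case 1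
          then have "real n * x \<le> real n * a" "real n * x \<le> real n * b" using ab by (auto intro!: mult_left_mono)
          then show False using that by (simp add: \<phi>_def \<sigma>(1))
        next
          case 2
          then have "real n * (b + 1 / real n) \<le> real n * x" by (intro mult_left_mono) auto
          moreover have "real n * (b + 1 / real n) = real n * b + 1" using n0 by (simp add: distrib_left)
          ultimately have "real n * x \<ge> real n * b + 1" by simp
          moreover have "real n * a \<le> real n * b" using ab by (auto intro!: mult_left_mono)
          ultimately show False using that by (simp add: \<phi>_def \<sigma>(2))
        qed
      qed
      then have cl: "closure {x. \<phi> x \<noteq> 0} \<subseteq> {a..b + 1 / real n}"
        by (intro closure_minimal) auto
      have "test_function {0<..<l} \<phi>"
        unfolding test_function_def
      proof (intro conjI allI C\<phi>)
        show "compact (closure {x. \<phi> x \<noteq> 0})"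
          using cl by (metis bounded_subset bounded_closed_interval closed_closure compact_eq_bounded_closed)
        show "closure {x. \<phi> x \<noteq> 0} \<subseteq> {0<..<l}" using cl ab nb by fastforce
      qed
      from w[OF this] have 0: "integral {0..l} (\<lambda>x. frechet_derivative \<phi> (at x) 1 *\<^sub>R D x) = 0" .
      have "(\<phi> has_real_derivative real n * \<beta> (real n * (x - a)) - real n * \<beta> (real n * (x - b))) (at x)" for x
      proof -
        have 1: "((\<lambda>x. \<sigma> (- real n * c + real n * x)) has_real_derivative \<beta> (- real n * c + real n * x) * real n) (at x)" for c
          by (rule DERIV_chain2[OF d]) (auto intro!: derivative_eq_intros)
        show ?thesis
          using DERIV_add[OF 1[of a] DERIV_cmult[OF 1[of b], of "-1"]] 
          by (simp add: \<phi>_def algebra_simps)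
      qed
      then have "frechet_derivative \<phi> (at x) 1 = real n * \<beta> (real n * (x - a)) - real n * \<beta> (real n * (x - b))" for x
        by (rule frechet_derivative_real)
      with 0 have "integral {0..l} (\<lambda>x. (real n * \<beta> (real n * (x - a))) *\<^sub>R D x - (real n * \<beta> (real n * (x - b))) *\<^sub>R D x) = 0"
        by (simp add: scaleR_left_diff_distrib)
      then show ?thesis
        by (subst (asm) Henstock_Kurzweil_Integration.integral_diff) 
          (auto intro!: integrable_continuous_real continuous_intros continuous_on_compose2[OF \<beta>(2)] D)
    qed
    then have "(\<lambda>n. ?J a n - ?J b n) \<longlonglongrightarrow> 0"
      by (intro tendsto_eventually eventually_sequentiallyI[of N]) auto
    with lim have "D a - D b = 0" by (rule LIMSEQ_unique)
    then show ?thesis by simp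
  qed
  have "D y = D (l / 2)" if "y \<in> {0<..<l}" for y
    using eq[of y "l/2"] eq[of "l/2" y, symmetric] that l by (cases y "l/2" rule: linorder_cases) auto
  note const = this
  have cl: "closure {0<..<l} = {0..l}" using l by (rule closure_greaterThanLessThan)
  have "D y = D (l / 2)" if "y \<in> {0..l}" for y
    by (rule continuous_constant_on_closure[of "{0<..<l}" D, unfolded cl, OF D const that])
  then show ?thesis using x l by (metis atLeastAtMost_iff less_eq_real_def)
qed


text \<open>Subtracting from \<open>f\<close> the primitive of a Borel version of its weak
  derivative leaves a continuous function with weak derivative zero.\<close>

lemma weak_partial_imp_ac_on:
  fixes f :: "real \<Rightarrow> complex"
  assumes l: "l > 0" and f: "continuous_on {0..l} f"
    and w: "has_weak_partial {0<..<l} 1 f g" and g: "L2_on {0<..<l} g"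
  obtains g' where "g' \<in> borel_measurable borel" "\<And>x. x \<notin> {0<..<l} \<Longrightarrow> g' x = 0"
    "integrable lborel (\<lambda>x. (norm (g' x))\<^sup>2)" "ac_on 0 l f g'"
proof -
  let ?I = "{0<..<l}"
  obtain g' where g'[measurable]: "g' \<in> borel_measurable borel" 
    and ae: "AE x in lebesgue. indicator ?I x *\<^sub>R g x = g' x" and z: "\<And>x. x \<notin> ?I \<Longrightarrow> g' x = 0"
    using lebesgue_borel_version[of ?I g] g by (auto simp: L2_on_def)
  have ig2: "integrable lebesgue (\<lambda>x. indicator ?I x *\<^sub>R (norm (g x))\<^sup>2)"
    using g by (simp add: L2_on_def set_integrable_def)
  have ae2: "AE x in lebesgue. indicator ?I x *\<^sub>R (norm (g x))\<^sup>2 = (norm (g' x))\<^sup>2"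
    using ae by eventually_elim (auto simp: indicator_def split: if_splits)
  have "integrable lebesgue (\<lambda>x. (norm (g' x))\<^sup>2)"
    by (rule integrable_cong_AE_imp[OF ig2 _ ae2]) (intro measurable_completion, simp)
  then have L2: "integrable lborel (\<lambda>x. (norm (g' x))\<^sup>2)"
    by (subst (asm) integrable_completion) auto
  \<comment> \<open>Borrows from the locale that a square-integrable function on a bounded interval
    is integrable.\<close>
  have "potential l g'"
    by unfold_locales (use l L2 z in auto)
  then have ig: "set_integrable lborel A g'" if "A \<in> sets borel" for A
    using that by (rule potential.q_set_integrable)
  define F where "F = (\<lambda>x. 0 + (LINT s:{0..x}|lborel. g' s))"
  have F: "ac_on 0 l F g'" unfolding F_def by (rule ac_on_integral) (simp add: ig)
  have cF: "continuous_on {0..l} F" by (rule ac_on_continuous[OF F])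
  define D where "D = (\<lambda>x. f x - F x)"
  have D: "continuous_on {0..l} D" unfolding D_def by (intro continuous_intros f cF)
  have "D x = D 0" if "x \<in> {0..l}" for x
  proof (rule weak_derivative_zero_imp_constant[OF D l _ that])
    fix \<phi> :: "real \<Rightarrow> real" assume t: "test_function ?I \<phi>"
    let ?d = "\<lambda>x. frechet_derivative \<phi> (at x) 1"
    have z0: "\<phi> 0 = 0" "\<phi> l = 0" using test_function_eq_0[OF t] by auto
    have cd: "continuous_on {0..l} ?d"
      using test_function_real_derivative(2)[OF t] by (rule continuous_on_subset) simp
    have c\<phi>: "continuous_on UNIV \<phi>"
      using DERIV_continuous_on[of UNIV \<phi> ?d] test_function_real_derivative(1)[OF t] by simp
    note wF = ac_on_weak_formula[OF F less_imp_le[OF l] test_function_real_derivative[OF t] z0]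
    have iff: "set_integrable lborel {0..l} (\<lambda>x. ?d x *\<^sub>R f x)"
      unfolding set_integrable_def by (rule borel_integrable_compact) (auto intro!: continuous_intros cd f)
    have "(LINT x:?I|lebesgue. ?d x *\<^sub>R f x) = (LINT x:?I|lborel. ?d x *\<^sub>R f x)"
      using iff by (intro set_integral_lebesgue_eq_lborel set_borel_measurable_of_integrable)
        (simp add: set_integral_open_closed)
    then have 1: "(LINT x:?I|lebesgue. ?d x *\<^sub>R f x) = (LINT x:{0..l}|lborel. ?d x *\<^sub>R f x)"
      by (simp add: set_integral_open_closed)
    have "(LINT x:?I|lebesgue. \<phi> x *\<^sub>R g x) = (\<integral>x. \<phi> x *\<^sub>R (indicator ?I x *\<^sub>R g x) \<partial>lebesgue)"
      by (simp add: set_lebesgue_integral_def mult.commute)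
    also have "\<dots> = (\<integral>x. \<phi> x *\<^sub>R g' x \<partial>lebesgue)"
    proof (rule integral_cong_AE)
      have m: "\<phi> \<in> borel_measurable borel" using c\<phi> by (rule borel_measurable_continuous_onI)
      have m': "(\<lambda>x. indicator ?I x *\<^sub>R g x) \<in> borel_measurable lebesgue" 
        using g by (simp add: L2_on_def set_borel_measurable_def)
      have ml: "\<phi> \<in> borel_measurable lebesgue" using m by (simp add: measurable_completion)
      show "(\<lambda>x. \<phi> x *\<^sub>R (indicator ?I x *\<^sub>R g x)) \<in> borel_measurable lebesgue"
        by (rule borel_measurable_scaleR[OF ml m'])
      show "(\<lambda>x. \<phi> x *\<^sub>R g' x) \<in> borel_measurable lebesgue"
        using m by (intro measurable_completion) simp
      show "AE x in lebesgue. \<phi> x *\<^sub>R (indicator ?I x *\<^sub>R g x) = \<phi> x *\<^sub>R g' x"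
        using ae by eventually_elim simp
    qed
    also have "\<dots> = (\<integral>x. \<phi> x *\<^sub>R g' x \<partial>lborel)"
      using borel_measurable_scaleR[OF borel_measurable_continuous_onI[OF c\<phi>] g'] 
      by (intro integral_completion) simp
    also have "\<dots> = (LINT x:{0..l}|lborel. \<phi> x *\<^sub>R g' x)"
      unfolding set_lebesgue_integral_def
    proof (rule Bochner_Integration.integral_cong)
      fix x show "\<phi> x *\<^sub>R g' x = indicator {0..l} x *\<^sub>R (\<phi> x *\<^sub>R g' x)"
        by (cases "x \<in> ?I") (simp_all add: z)
    qed simp
    finally have 2: "(LINT x:?I|lebesgue. \<phi> x *\<^sub>R g x) = (LINT x:{0..l}|lborel. \<phi> x *\<^sub>R g' x)" .
    have "(LINT x:?I|lebesgue. ?d x *\<^sub>R f x) = - (LINT x:?I|lebesgue. \<phi> x *\<^sub>R g x)"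
      using w t by (simp add: has_weak_partial_def)
    then have "(LINT x:{0..l}|lborel. ?d x *\<^sub>R f x) = (LINT x:{0..l}|lborel. ?d x *\<^sub>R F x)"
      using 1 2 wF(1) by simp
    then have "(LINT x:{0..l}|lborel. ?d x *\<^sub>R f x - ?d x *\<^sub>R F x) = 0"
      by (simp add: set_integral_diff(2)[OF iff wF(2)])
    moreover have "(LINT x:{0..l}|lborel. ?d x *\<^sub>R f x - ?d x *\<^sub>R F x) = integral {0..l} (\<lambda>x. ?d x *\<^sub>R f x - ?d x *\<^sub>R F x)"
      by (rule set_borel_integral_eq_integral(2)[OF set_integral_diff(1)[OF iff wF(2)]])
    ultimately show "integral {0..l} (\<lambda>x. ?d x *\<^sub>R D x) = 0"
      by (simp add: D_def scaleR_right_diff_distrib)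
  qed
  then have "F x + D 0 = f x" if "x \<in> {0..l}" for x
    using that by (metis D_def add_diff_cancel_left' add_diff_eq)
  then have "ac_on 0 l f g'"
    using ac_on_cong[OF ac_on_add[OF F ac_on_const[of 0 l "D 0"]], of f g'] by simp
  then show ?thesis using that[of g'] g' z L2 by blast
qed

section \<open>The Goursat problem\<close>

text \<open>Dominated convergence. Continuity is asked at the given parameter for almost every
  \<open>r\<close> only, because moving limits of integration destroy it at the end points.\<close>

lemma isCont_parametric_integral:
  fixes F :: "'a::metric_space \<Rightarrow> real \<Rightarrow> complex"
  assumes m: "\<And>p. F p \<in> borel_measurable borel"
    and w: "integrable lborel w" "\<And>p r. norm (F p r) \<le> w r"
    and c: "AE r in lborel. isCont (\<lambda>p. F p r) p"
  shows "isCont (\<lambda>p. \<integral>r. F p r \<partial>lborel) p"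
  unfolding continuous_at_sequentially
proof (intro allI impI)
  fix X assume X: "X \<longlonglongrightarrow> p"
  show "((\<lambda>p. \<integral>r. F p r \<partial>lborel) \<circ> X) \<longlonglongrightarrow> (\<integral>r. F p r \<partial>lborel)"
    unfolding comp_def
  proof (rule integral_dominated_convergence[where w=w])
    show "AE r in lborel. (\<lambda>n. F (X n) r) \<longlonglongrightarrow> F p r"
      using c by eventually_elim (rule isCont_tendsto_compose[OF _ X])
  qed (use m w in auto)
qed

text \<open>Off the end points the indicator is constant for all nearby parameters.\<close>

lemma isCont_indicator_interval:
  fixes a b :: "'a::t2_space \<Rightarrow> real"
  assumes "isCont a p" "isCont b p" "r \<noteq> a p" "r \<noteq> b p"
  shows "isCont (\<lambda>p. indicator {a p..b p} r :: real) p"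
proof -
  have A: "(a \<longlongrightarrow> a p) (at p)" "(b \<longlongrightarrow> b p) (at p)" using assms by (auto simp: isCont_def)
  consider "r < a p" | "r > b p" | "a p < r" "r < b p" using assms by linarith
  then have "\<forall>\<^sub>F p' in at p. (indicator {a p'..b p'} r :: real) = indicator {a p..b p} r"
  proof cases
    case 1
    show ?thesis using order_tendstoD(1)[OF A(1) 1] by eventually_elim (use 1 in auto)
  next
    case 2
    show ?thesis using order_tendstoD(2)[OF A(2) 2] by eventually_elim (use 2 in auto)
  next
    case 3
    show ?thesis using order_tendstoD(2)[OF A(1) 3(1)] order_tendstoD(1)[OF A(2) 3(2)]
      by eventually_elim (use 3 in auto)
  qed
  then show ?thesis unfolding isCont_def by (rule tendsto_eventually)
qed

lemma weighted_AM_GM: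
  fixes a b e :: real
  assumes "e > 0"
  shows "a * b \<le> (e * a\<^sup>2 + b\<^sup>2 / e) / 2"
proof -
  have "0 \<le> (e * a - b)\<^sup>2 / (2 * e)" using assms by simp
  also have "\<dots> = (e * a\<^sup>2 + b\<^sup>2 / e) / 2 - a * b"
    using assms by (simp add: power2_eq_square field_simps)
  finally show ?thesis by simp
qed

text \<open>An additive Cauchy-Schwarz inequality; the free parameter \<open>e\<close> lets the
  product be made small when only one of the two norms is small.\<close>

lemma
  fixes u v :: "real \<Rightarrow> complex"
  assumes [measurable]: "u \<in> borel_measurable borel" "v \<in> borel_measurable borel"
    and u: "integrable lborel (\<lambda>x. (norm (u x))\<^sup>2)" and v: "integrable lborel (\<lambda>x. (norm (v x))\<^sup>2)"
  shows integrable_mult_shift: "integrable lborel (\<lambda>r. u r * v (r - a))"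
    and norm_integral_mult_shift: "e > 0 \<Longrightarrow> (\<integral>r. norm (u r * v (r - a)) \<partial>lborel) \<le>
      (e * (\<integral>x. (norm (u x))\<^sup>2 \<partial>lborel) + (\<integral>x. (norm (v x))\<^sup>2 \<partial>lborel) / e) / 2"
proof -
  have va: "integrable lborel (\<lambda>r. (norm (v (r - a)))\<^sup>2)"
    using lborel_integrable_real_affine[OF v, of 1 "- a"] by simp
  have eva: "(\<integral>r. (norm (v (r - a)))\<^sup>2 \<partial>lborel) = (\<integral>x. (norm (v x))\<^sup>2 \<partial>lborel)"
    using lborel_integral_real_affine[of 1 "\<lambda>x. (norm (v x))\<^sup>2" "- a"] by simp
  let ?g = "\<lambda>e r. (e * (norm (u r))\<^sup>2 + (norm (v (r - a)))\<^sup>2 / e) / 2"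
  have ig: "integrable lborel (?g e)" for e using u va by auto
  have le: "norm (u r * v (r - a)) \<le> ?g e r" if "e > 0" for e r
    using weighted_AM_GM[OF that] by (simp add: norm_mult)
  show i: "integrable lborel (\<lambda>r. u r * v (r - a))"
  proof (rule Bochner_Integration.integrable_bound[OF ig[of 1]])
    show "AE r in lborel. norm (u r * v (r - a)) \<le> norm (?g 1 r)"
      using order_trans[OF le[OF zero_less_one] abs_ge_self] by (intro AE_I2) (simp only: real_norm_def)
  qed measurable
  assume e: "e > 0"
  have "(\<integral>r. norm (u r * v (r - a)) \<partial>lborel) \<le> integral\<^sup>L lborel (?g e)"
    by (rule integral_mono[OF integrable_norm[OF i] ig le[OF e]])
  also have "\<dots> = (e * (\<integral>x. (norm (u x))\<^sup>2 \<partial>lborel) + (\<integral>r. (norm (v (r - a)))\<^sup>2 \<partial>lborel) / e) / 2"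
    using u va by simp
  finally show "(\<integral>r. norm (u r * v (r - a)) \<partial>lborel) \<le>
      (e * (\<integral>x. (norm (u x))\<^sup>2 \<partial>lborel) + (\<integral>x. (norm (v x))\<^sup>2 \<partial>lborel) / e) / 2"
    unfolding eva .
qed

text \<open>Clamping to the quadrant \<open>\<xi>, \<eta> \<ge> 0\<close> makes the integral operators act on bounded
  continuous functions on the whole plane.\<close>

abbreviation pos_fst :: "real \<times> real \<Rightarrow> real" where "pos_fst p \<equiv> max 0 (fst p)"
abbreviation pos_snd :: "real \<times> real \<Rightarrow> real" where "pos_snd p \<equiv> max 0 (snd p)"

section \<open>Continuity of the inhomogeneous term of the Goursat equations\<close>

context potential
begin

text \<open>For \<open>v = q\<close> this is the part of \<open>R\<close> that the split-off term
  q(\<xi>) of \<open>S\<close> produces. A general \<open>v\<close> is allowed so that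
  \<open>q\<close> can be approximated.\<close>

definition corr :: "(real \<Rightarrow> complex) \<Rightarrow> real \<times> real \<Rightarrow> complex" where
  "corr v p = (\<integral>r. indicator {pos_snd p..pos_fst p + pos_snd p} r *\<^sub>R (q r * v (r - pos_snd p)) \<partial>lborel)"

lemma corr_integrable:
  assumes [measurable]: "v \<in> borel_measurable borel" and v: "integrable lborel (\<lambda>x. (norm (v x))\<^sup>2)"
  shows "integrable lborel (\<lambda>r. indicator {a..b} r *\<^sub>R (q r * v (r - c)))"
  using integrable_mult_shift[OF q_borel assms(1) q_L2 v] by (rule integrable_mult_indicator[rotated]) simp

lemma corr_bound:
  assumes [measurable]: "v \<in> borel_measurable borel" and v: "integrable lborel (\<lambda>x. (norm (v x))\<^sup>2)"
    and e: "e > 0"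
  shows "norm (corr v p) \<le> (e * (\<integral>x. (norm (q x))\<^sup>2 \<partial>lborel) + (\<integral>x. (norm (v x))\<^sup>2 \<partial>lborel) / e) / 2"
proof -
  have "norm (corr v p) \<le> (\<integral>r. norm (q r * v (r - pos_snd p)) \<partial>lborel)"
    unfolding corr_def
    by (rule Bochner_Integration.integral_norm_bound_integral[OF corr_integrable[OF assms(1) v] 
          integrable_norm[OF integrable_mult_shift[OF q_borel assms(1) q_L2 v]]])
      (auto simp: indicator_def)
  also have "\<dots> \<le> (e * (\<integral>x. (norm (q x))\<^sup>2 \<partial>lborel) + (\<integral>x. (norm (v x))\<^sup>2 \<partial>lborel) / e) / 2"
    by (rule norm_integral_mult_shift[OF q_borel assms(1) q_L2 v e])
  finally show ?thesis .
qed

text \<open>The correlation is linear in \<open>v\<close> and bounded uniformly in the point by the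
  L^2 norms, so L^2 convergence of \<open>V\<close> gives uniform convergence of the
  correlations.\<close>

lemma corr_limit:
  fixes V :: "nat \<Rightarrow> real \<Rightarrow> complex"
  assumes [measurable]: "\<And>n. V n \<in> borel_measurable borel" "v \<in> borel_measurable borel"
    and V: "\<And>n. integrable lborel (\<lambda>x. (norm (V n x))\<^sup>2)" and v: "integrable lborel (\<lambda>x. (norm (v x))\<^sup>2)"
    and d: "\<And>n. integrable lborel (\<lambda>x. (norm (V n x - v x))\<^sup>2)"
    and lim: "(\<lambda>n. \<integral>x. (norm (V n x - v x))\<^sup>2 \<partial>lborel) \<longlonglongrightarrow> 0"
    and c: "\<And>n. continuous_on UNIV (corr (V n))"
  shows "continuous_on UNIV (corr v)"
proof (rule uniform_limit_theorem[where F=sequentially and f="\<lambda>n. corr (V n)"])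
  define Q where "Q = (\<integral>x. (norm (q x))\<^sup>2 \<partial>lborel)"
  have Q: "Q \<ge> 0" by (simp add: Q_def)
  have diff: "corr (V n) p - corr v p = corr (\<lambda>x. V n x - v x) p" for n p
    unfolding corr_def
    by (subst Bochner_Integration.integral_diff[symmetric]) (auto intro!: corr_integrable V v simp: algebra_simps)
  show "uniform_limit UNIV (\<lambda>n. corr (V n)) (corr v) sequentially"
  proof (rule uniform_limitI)
    fix \<delta> :: real assume \<delta>: "\<delta> > 0"
    \<comment> \<open>With this \<open>e\<close>, both e Q and, once the L^2 error is below \<delta>
      e, the error divided by \<open>e\<close> are less than \<delta>.\<close>
    define e where "e = \<delta> / (Q + 1)"
    have e: "e > 0" using \<delta> Q by (simp add: e_def)
    have eQ: "e * Q < \<delta>" using \<delta> Q by (simp add: e_def field_simps)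
    have "\<forall>\<^sub>F n in sequentially. (\<integral>x. (norm (V n x - v x))\<^sup>2 \<partial>lborel) < \<delta> * e"
      using order_tendstoD(2)[OF lim, of "\<delta> * e"] \<delta> e by simp
    then show "\<forall>\<^sub>F n in sequentially. \<forall>p\<in>UNIV. dist (corr (V n) p) (corr v p) < \<delta>"
    proof eventually_elim
      case (elim n)
      show ?case
      proof
        fix p
        have "norm (corr (\<lambda>x. V n x - v x) p) \<le> (e * Q + (\<integral>x. (norm (V n x - v x))\<^sup>2 \<partial>lborel) / e) / 2"
          unfolding Q_def by (rule corr_bound[OF _ d e]) simp
        also have "\<dots> < (\<delta> + \<delta>) / 2"
          using eQ elim e by (intro divide_strict_right_mono add_strict_mono) (auto simp: field_simps)
        finally show "dist (corr (V n) p) (corr v p) < \<delta>" by (simp add: dist_norm diff)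
      qed
    qed
  qed
qed (use c in auto)

lemma integrable_indicator_Icc: "integrable lborel (\<lambda>x::real. c * indicator {a..b} x :: real)"
  by (intro integrable_mult_right integrable_real_indicator) (auto simp: emeasure_lborel_Icc_eq)

text \<open>First of three approximation stages. A merely measurable factor q(r - \<eta>) is not
  continuous in \<eta> for fixed \<open>r\<close>, so dominated convergence works directly only for
  cut-off continuous functions.\<close>

lemma corr_continuous_cutoff:
  fixes h :: "real \<Rightarrow> complex"
  assumes h: "continuous_on UNIV h" and N: "\<And>x. norm (h x) \<le> N"
  shows "continuous_on UNIV (corr (\<lambda>x. indicator {0..l} x *\<^sub>R h x))"
  unfolding continuous_on_eq_continuous_at[OF open_UNIV]
proof
  fix p :: "real \<times> real"
  have [measurable]: "h \<in> borel_measurable borel" using h by (rule borel_measurable_continuous_onI)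
  let ?a = "pos_snd p" and ?b = "pos_fst p + pos_snd p"
  show "isCont (corr (\<lambda>x. indicator {0..l} x *\<^sub>R h x)) p"
    unfolding corr_def
  proof (rule isCont_parametric_integral)
    show "integrable lborel (\<lambda>r. norm (q r) * N)" using q_integrable by simp
    have N0: "N \<ge> 0" using norm_ge_zero N order_trans by blast
    show "norm (indicator {pos_snd p..pos_fst p + pos_snd p} r *\<^sub>R
      (q r * (indicator {0..l} (r - pos_snd p) *\<^sub>R h (r - pos_snd p)))) \<le> norm (q r) * N" for p :: "real \<times> real" and r
      using N[of "r - pos_snd p"] N0 by (auto simp: indicator_def norm_mult intro!: mult_left_mono)
    show "AE r in lborel. isCont (\<lambda>p. indicator {pos_snd p..pos_fst p + pos_snd p} r *\<^sub>R
      (q r * (indicator {0..l} (r - pos_snd p) *\<^sub>R h (r - pos_snd p)))) p"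
      \<comment> \<open>Excluded are the two limits of integration and the upper jump of the
        cut-off; its lower jump coincides with the lower limit.\<close>
      using AE_lborel_singleton[of "?a"] AE_lborel_singleton[of "?b"] AE_lborel_singleton[of "?a + l"]
    proof eventually_elim
      case (elim r)
      have 1: "isCont (\<lambda>p. indicator {pos_snd p..pos_fst p + pos_snd p} r :: real) p"
        using elim by (intro isCont_indicator_interval continuous_intros) auto
      have "isCont (\<lambda>p. indicator {pos_snd p..pos_snd p + l} r :: real) p"
        using elim by (intro isCont_indicator_interval continuous_intros) auto
      moreover have "indicator {pos_snd p..pos_snd p + l} r = (indicator {0..l} (r - pos_snd p) :: real)" for p :: "real \<times> real"
        by (auto simp: indicator_def)
      ultimately have 2: "isCont (\<lambda>p. indicator {0..l} (r - pos_snd p) :: real) p" by simp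
      have 3: "isCont (\<lambda>p. h (r - pos_snd p)) p"
      proof (rule continuous_at_compose[unfolded o_def, where g=h])
        show "isCont (\<lambda>p. r - pos_snd p) p" by (intro continuous_intros)
        show "isCont h (r - pos_snd p)" using h by (simp add: continuous_on_eq_continuous_at)
      qed
      show ?case by (intro continuous_intros 1 2 3)
    qed
  qed measurable
qed

text \<open>Second stage: a measurable function is an almost everywhere limit of continuous ones,
  and boundedness turns this into L^2 convergence.\<close>

lemma corr_continuous_bounded:
  fixes v :: "real \<Rightarrow> complex"
  assumes [measurable]: "v \<in> borel_measurable borel" and N: "\<And>x. norm (v x) \<le> N" "N > 0"
    and z: "\<And>x. x \<notin> {0..l} \<Longrightarrow> v x = 0"
  shows "continuous_on UNIV (corr v)"
proof -
  have "v measurable_on UNIV"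
    by (rule lebesgue_measurable_imp_measurable_on) (auto intro: measurable_completion)
  then obtain Z g where Z: "negligible Z" and g: "\<And>n. continuous_on UNIV (g n)" 
    and gl: "\<And>x. x \<notin> Z \<Longrightarrow> (\<lambda>n. g n x) \<longlonglongrightarrow> v x"
    unfolding measurable_on_def by auto
  have AEZ: "AE x in lborel. x \<notin> Z"
    using Z AE_not_in[of Z lebesgue] by (simp add: negligible_iff_null_sets AE_completion_iff)
  \<comment> \<open>The radial retraction onto the ball of radius \<open>N\<close>: it keeps the
    approximants continuous, bounds them by \<open>N\<close>, and fixes the values of
    \<open>v\<close>.\<close>
  define cut where "cut = (\<lambda>z::complex. (N / max N (norm z)) *\<^sub>R z)"
  have cut: "isCont cut z" "norm (cut z) \<le> N" "norm z \<le> N \<Longrightarrow> cut z = z" for z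
  proof -
    have m: "max N (norm z) > 0" using N(2) by simp
    show "isCont cut z" unfolding cut_def using m by (intro continuous_intros) auto
    show "norm (cut z) \<le> N" unfolding cut_def using m N(2) by (auto simp: field_simps)
    show "cut z = z" if "norm z \<le> N" using that N(2) by (simp add: cut_def max_def)
  qed
  define V where "V = (\<lambda>n x. indicator {0..l} x *\<^sub>R cut (g n x))"
  have cc: "continuous_on UNIV (\<lambda>x. cut (g n x))" for n
    using continuous_on_compose[OF g[of n], of cut] cut(1) 
    by (auto simp: o_def continuous_on_eq_continuous_at intro!: continuous_at_imp_continuous_on)
  have [measurable]: "(\<lambda>x. cut (g n x)) \<in> borel_measurable borel" for n
    using cc by (rule borel_measurable_continuous_onI)
  have [measurable]: "V n \<in> borel_measurable borel" for n unfolding V_def by simp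
  have sq: "(norm x)\<^sup>2 \<le> N\<^sup>2" if "norm x \<le> N" for x :: complex
    using that by (simp add: power_mono)
  have iV: "integrable lborel (\<lambda>x. (norm (V n x))\<^sup>2)" for n
    by (rule Bochner_Integration.integrable_bound[OF integrable_indicator_Icc[of "N\<^sup>2" 0 l]])
      (auto simp: V_def indicator_def intro!: sq cut)
  have iv: "integrable lborel (\<lambda>x. (norm (v x))\<^sup>2)"
    by (rule Bochner_Integration.integrable_bound[OF integrable_indicator_Icc[of "N\<^sup>2" 0 l]])
      (use z in \<open>auto simp: indicator_def intro!: AE_I2 sq N\<close>)
  have b: "(norm (V n x - v x))\<^sup>2 \<le> (2 * N)\<^sup>2 * indicator {0..l} x" for n x
  proof (cases "x \<in> {0..l}")
    case True
    have "norm (V n x - v x) \<le> norm (V n x) + norm (v x)" by (rule norm_triangle_ineq4)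
    also have "\<dots> \<le> 2 * N" using True cut(2)[of "g n x"] N(1)[of x] by (simp add: V_def)
    finally have "(norm (V n x - v x))\<^sup>2 \<le> (2 * N)\<^sup>2" by (intro power_mono) auto
    then show ?thesis using True by simp
  qed (use z in \<open>auto simp: V_def\<close>)
  show ?thesis
  proof (rule corr_limit[of V v])
    show "continuous_on UNIV (corr (V n))" for n
      unfolding V_def by (rule corr_continuous_cutoff[OF cc cut(2)])
    show "integrable lborel (\<lambda>x. (norm (V n x - v x))\<^sup>2)" for n
      by (rule Bochner_Integration.integrable_bound[OF integrable_indicator_Icc[of "(2*N)\<^sup>2" 0 l]])
        (use b in \<open>auto intro!: AE_I2\<close>)
    have "(\<lambda>n. \<integral>x. (norm (V n x - v x))\<^sup>2 \<partial>lborel) \<longlonglongrightarrow> integral\<^sup>L (lborel::real measure) (\<lambda>x. 0)"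
    proof (rule integral_dominated_convergence)
      show "integrable lborel (\<lambda>x::real. (2 * N)\<^sup>2 * indicator {0..l} x)" by (rule integrable_indicator_Icc)
      show "AE x in lborel. (\<lambda>n. (norm (V n x - v x))\<^sup>2) \<longlonglongrightarrow> 0"
        using AEZ
      proof eventually_elim
        case (elim x)
        have "(\<lambda>n. cut (g n x)) \<longlonglongrightarrow> cut (v x)"
          using cut(1) gl[OF elim] by (rule isCont_tendsto_compose)
        then have "(\<lambda>n. V n x) \<longlonglongrightarrow> indicator {0..l} x *\<^sub>R v x"
          unfolding V_def using cut(3)[OF N(1)] by (auto intro!: tendsto_intros)
        moreover have "indicator {0..l} x *\<^sub>R v x = v x" using z by (auto simp: indicator_def)
        ultimately have "(\<lambda>n. V n x - v x) \<longlonglongrightarrow> 0" by (simp add: LIM_zero_iff)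
        from tendsto_power[OF tendsto_norm[OF this], of 2] show ?case by simp
      qed
      show "AE x in lborel. norm ((norm (V n x - v x))\<^sup>2) \<le> (2 * N)\<^sup>2 * indicator {0..l} x" for n
        using b by auto
    qed measurable
    then show "(\<lambda>n. \<integral>x. (norm (V n x - v x))\<^sup>2 \<partial>lborel) \<longlonglongrightarrow> 0" by simp
  qed (use iV iv in auto)
qed

text \<open>Last stage: truncation of \<open>q\<close> at height n + 1, dominated in L^2 by
  \<open>q\<close> itself. The summand 1 makes the bound positive for n = 0 as well.\<close>

lemma corr_q_continuous: "continuous_on UNIV (corr q)"
proof -
  define V where "V = (\<lambda>(n::nat) x. indicator {x. norm (q x) \<le> real n + 1} x *\<^sub>R q x)"
  have [measurable]: "V n \<in> borel_measurable borel" for n unfolding V_def by measurable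
  have b: "(norm (V n x - q x))\<^sup>2 \<le> (norm (q x))\<^sup>2" and bV: "norm (V n x) \<le> norm (q x)" for n x
    by (auto simp: V_def indicator_def)
  show ?thesis
  proof (rule corr_limit[of V q])
    show "continuous_on UNIV (corr (V n))" for n
      by (rule corr_continuous_bounded[where N="real n + 1"]) (auto simp: V_def indicator_def q_zero)
    show "integrable lborel (\<lambda>x. (norm (V n x))\<^sup>2)" for n
      by (rule Bochner_Integration.integrable_bound[OF q_L2]) (auto intro!: power_mono bV)
    show "integrable lborel (\<lambda>x. (norm (V n x - q x))\<^sup>2)" for n
      by (rule Bochner_Integration.integrable_bound[OF q_L2]) (use b in \<open>auto intro!: AE_I2 simp del: power2_le_iff_abs_le power_mono_iff\<close>)
    have "(\<lambda>n. \<integral>x. (norm (V n x - q x))\<^sup>2 \<partial>lborel) \<longlonglongrightarrow> integral\<^sup>L (lborel::real measure) (\<lambda>x. 0)"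
    proof (rule integral_dominated_convergence[OF _ _ q_L2])
      show "AE x in lborel. (\<lambda>n. (norm (V n x - q x))\<^sup>2) \<longlonglongrightarrow> 0"
      proof (rule AE_I2)
        fix x
        obtain N where N: "norm (q x) \<le> real N" using real_arch_simple by blast
        show "(\<lambda>n. (norm (V n x - q x))\<^sup>2) \<longlonglongrightarrow> 0"
        proof (rule tendsto_eventually, rule eventually_sequentiallyI[of N])
          fix n assume "n \<ge> N"
          then have "norm (q x) \<le> real n + 1" using N by (meson add_increasing2 of_nat_le_iff order_trans zero_le_one)
          then show "(norm (V n x - q x))\<^sup>2 = 0" by (simp add: V_def)
        qed
      qed
    qed (use b in auto)
    then show "(\<lambda>n. \<integral>x. (norm (V n x - q x))\<^sup>2 \<partial>lborel) \<longlonglongrightarrow> 0" by simp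
  qed (use q_L2 in auto)
qed

end

section \<open>The weighted Volterra operator and its fixed point\<close>

context potential
begin

text \<open>Reading \<open>g\<close> at (\<eta>, r - \<eta>), with the roles of the coordinates
  exchanged, lets one operator serve both Goursat equations: applied to the weighted
  \<open>R\<close> it gives the weighted \<open>T\<close> with flipped arguments, applied again it
  gives the share of \<open>T\<close> in \<open>R\<close>. The exponent is the difference of the
  coordinate sums, x = \<xi> + \<eta> at the evaluation point and \<open>r\<close> where
  \<open>g\<close> is read.\<close>

definition volterra_integrand :: "real \<Rightarrow> (real \<times> real \<Rightarrow> complex) \<Rightarrow> real \<times> real \<Rightarrow> real \<Rightarrow> complex" where
  "volterra_integrand c g p r = indicator {pos_snd p..pos_fst p + pos_snd p} r *\<^sub>R
     (q r * (exp (- c * (pos_fst p + pos_snd p - r)) *\<^sub>R g (pos_snd p, r - pos_snd p)))"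

definition volterra :: "real \<Rightarrow> (real \<times> real \<Rightarrow> complex) \<Rightarrow> real \<times> real \<Rightarrow> complex" where
  "volterra c g p = (\<integral>r. volterra_integrand c g p r \<partial>lborel)"

lemma volterra_integrand_bound:
  assumes "\<And>p. norm (g p) \<le> B"
  shows "norm (volterra_integrand c g p r) \<le>
    B * (indicator {..pos_fst p + pos_snd p} r * (norm (q r) * exp (- c * (pos_fst p + pos_snd p - r))))"
proof -
  have B: "B \<ge> 0" using assms norm_ge_zero order_trans by blast
  show ?thesis
    using mult_left_mono[OF assms[of "(pos_snd p, r - pos_snd p)"], of "norm (q r) * exp (- c * (pos_fst p + pos_snd p - r))"] B
    by (auto simp: volterra_integrand_def indicator_def norm_mult mult_ac)
qed

text \<open>A majorant independent of the point, as dominated convergence demands; the sharper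
  preceding bound is the one that yields the contraction.\<close>

lemma volterra_integrand_le:
  assumes "\<And>p. norm (g p) \<le> B" "c \<ge> 0"
  shows "norm (volterra_integrand c g p r) \<le> B * norm (q r)"
proof -
  have "B \<ge> 0" using assms norm_ge_zero order_trans by blast
  then have "B * (indicator {..pos_fst p + pos_snd p} r * (norm (q r) * exp (- c * (pos_fst p + pos_snd p - r)))) \<le> B * norm (q r)"
    using assms(2) by (intro mult_left_mono) (auto simp: indicator_def intro!: mult_left_le)
  then show ?thesis using volterra_integrand_bound[of g B c p r, OF assms(1)] by linarith
qed

lemma volterra_measurable:
  fixes g :: "real \<times> real \<Rightarrow> complex"
  assumes g: "continuous_on UNIV g"
  shows "volterra_integrand c g p \<in> borel_measurable borel"
proof -
  have "(\<lambda>r. g (pos_snd p, r - pos_snd p)) \<in> borel_measurable borel"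
    by (intro borel_measurable_continuous_onI continuous_on_compose2[OF g] continuous_intros) auto
  then show ?thesis unfolding volterra_integrand_def by measurable
qed

lemma volterra_integrable:
  fixes g :: "real \<times> real \<Rightarrow> complex"
  assumes g: "continuous_on UNIV g" and B: "\<And>p. norm (g p) \<le> B" and c: "c \<ge> 0"
  shows "integrable lborel (volterra_integrand c g p)"
proof (rule Bochner_Integration.integrable_bound)
  show "integrable lborel (\<lambda>r. B * norm (q r))" using q_integrable by simp
  show "AE r in lborel. norm (volterra_integrand c g p r) \<le> norm (B * norm (q r))"
    using order_trans[OF volterra_integrand_le[OF B c] abs_ge_self] by (intro AE_I2) (simp only: real_norm_def)
qed (use volterra_measurable[OF g] in simp)

lemma volterra_continuous:
  fixes g :: "real \<times> real \<Rightarrow> complex"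
  assumes g: "continuous_on UNIV g" and B: "\<And>p. norm (g p) \<le> B" and c: "c \<ge> 0"
  shows "continuous_on UNIV (volterra c g)"
  unfolding continuous_on_eq_continuous_at[OF open_UNIV]
proof
  fix p :: "real \<times> real"
  let ?a = "pos_snd p" and ?b = "pos_fst p + pos_snd p"
  show "isCont (volterra c g) p"
    unfolding volterra_def
  proof (rule isCont_parametric_integral[where w="\<lambda>r. B * norm (q r)"])
    show "integrable lborel (\<lambda>r. B * norm (q r))" using q_integrable by simp
    show "norm (volterra_integrand c g p r) \<le> B * norm (q r)" for p r
      by (rule volterra_integrand_le[OF B c])
    show "AE r in lborel. isCont (\<lambda>p. volterra_integrand c g p r) p"
      using AE_lborel_singleton[of "?a"] AE_lborel_singleton[of "?b"]
    proof eventually_elim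
      case (elim r)
      have 1: "isCont (\<lambda>p. indicator {pos_snd p..pos_fst p + pos_snd p} r :: real) p"
        using elim by (intro isCont_indicator_interval continuous_intros) auto
      have 3: "isCont (\<lambda>p. g (pos_snd p, r - pos_snd p)) p"
      proof (rule continuous_at_compose[unfolded o_def, where g=g])
        show "isCont (\<lambda>p. (pos_snd p, r - pos_snd p)) p" by (intro continuous_intros)
        show "isCont g (pos_snd p, r - pos_snd p)" using g by (simp add: continuous_on_eq_continuous_at)
      qed
      show ?case unfolding volterra_integrand_def by (intro continuous_intros 1 3)
    qed
  qed (rule volterra_measurable[OF g])
qed

text \<open>Inserting the equation for \<open>T\<close> into that for \<open>R\<close> leaves one
  fixed-point equation for the weighted \<open>R\<close>. The weight makes \<open>volterra\<close>
  halve the sup norm, so its square contracts by 1/4 on bounded continuous functions.\<close>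

theorem goursat_bounded_solution:
  obtains c g where "c > 0" "continuous_on UNIV g" "bounded (range g)"
    "\<And>p. g p = exp (- c * (pos_fst p + pos_snd p)) *\<^sub>R corr q p + volterra c (volterra c g) p"
    "continuous_on UNIV (volterra c g)" "bounded (range (volterra c g))"
proof -
  obtain c where c: "c > 0"
    and i: "\<And>x. integrable lborel (\<lambda>r. indicator {..x} r * (norm (q r) * exp (- c * (x - r))))"
    and le: "\<And>x. (\<integral>r. indicator {..x} r * (norm (q r) * exp (- c * (x - r))) \<partial>lborel) \<le> 1 / 2"
    using exponential_weight by blast
  have half: "norm (volterra c g p) \<le> B / 2" if g: "continuous_on UNIV g" and B: "\<And>p. norm (g p) \<le> B" for g B p
  proof -
    have B0: "B \<ge> 0" using B norm_ge_zero order_trans by blast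
    have "norm (volterra c g p) \<le> (\<integral>r. B * (indicator {..pos_fst p + pos_snd p} r * (norm (q r) * exp (- c * (pos_fst p + pos_snd p - r)))) \<partial>lborel)"
      unfolding volterra_def
      by (rule Bochner_Integration.integral_norm_bound_integral[OF volterra_integrable[OF g B less_imp_le[OF c]] 
            integrable_mult_right[OF i] volterra_integrand_bound[of g B c p, OF B]])
    also have "\<dots> \<le> B * (1 / 2)"
      unfolding integral_mult_right_zero by (intro mult_left_mono le B0)
    finally show ?thesis by simp
  qed
  define Cb where "Cb = (\<lambda>g :: (real \<times> real) \<Rightarrow>\<^sub>C complex. Bcontfun (volterra c (apply_bcontfun g)))"
  have bd: "norm (apply_bcontfun g p) \<le> norm g" for g :: "(real \<times> real) \<Rightarrow>\<^sub>C complex" and p by (rule norm_bounded)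
  have cg: "continuous_on UNIV (apply_bcontfun g)" for g :: "(real \<times> real) \<Rightarrow>\<^sub>C complex" by simp
  have Cb: "apply_bcontfun (Cb g) = volterra c (apply_bcontfun g)" for g
    unfolding Cb_def
    by (rule Bcontfun_inverse, rule bcontfun_normI[OF volterra_continuous[OF cg bd less_imp_le[OF c]] half[OF cg bd]])
  have Cb_diff: "Cb g - Cb h = Cb (g - h)" for g h
  proof (rule bcontfun_eqI)
    fix p
    show "apply_bcontfun (Cb g - Cb h) p = apply_bcontfun (Cb (g - h)) p"
      unfolding Cb minus_bcontfun.rep_eq volterra_def
      by (subst Bochner_Integration.integral_diff[OF volterra_integrable[OF cg bd less_imp_le[OF c]] 
            volterra_integrable[OF cg bd less_imp_le[OF c]], symmetric])
        (rule Bochner_Integration.integral_cong, simp_all add: volterra_integrand_def algebra_simps)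
  qed
  have Cb_norm: "norm (Cb g) \<le> norm g / 2" for g
    by (rule norm_bound) (simp only: Cb half[OF cg bd])
  define r1 where "r1 = (\<lambda>p :: real \<times> real. exp (- c * (pos_fst p + pos_snd p)) *\<^sub>R corr q p)"
  have "r1 \<in> bcontfun"
  proof (rule bcontfun_normI)
    show "continuous_on UNIV r1" unfolding r1_def by (intro continuous_intros corr_q_continuous)
    fix p :: "real \<times> real"
    have "norm (r1 p) \<le> 1 * norm (corr q p)"
      unfolding r1_def norm_scaleR using c by (intro mult_right_mono) auto
    also have "\<dots> \<le> (1 * (\<integral>x. (norm (q x))\<^sup>2 \<partial>lborel) + (\<integral>x. (norm (q x))\<^sup>2 \<partial>lborel) / 1) / 2"
      unfolding mult_1 by (rule corr_bound[OF q_borel q_L2, of 1, unfolded mult_1]) simp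
    finally show "norm (r1 p) \<le> (1 * (\<integral>x. (norm (q x))\<^sup>2 \<partial>lborel) + (\<integral>x. (norm (q x))\<^sup>2 \<partial>lborel) / 1) / 2" .
  qed
  then have r1: "apply_bcontfun (Bcontfun r1) = r1" by (rule Bcontfun_inverse)
  have "\<exists>!g. Bcontfun r1 + Cb (Cb g) = g"
  proof (rule banach_fix_type[where c="1/4"])
    show "\<forall>g h. dist (Bcontfun r1 + Cb (Cb g)) (Bcontfun r1 + Cb (Cb h)) \<le> 1 / 4 * dist g h"
    proof (intro allI)
      fix g h
      have "dist (Bcontfun r1 + Cb (Cb g)) (Bcontfun r1 + Cb (Cb h)) = norm (Cb (Cb (g - h)))"
        by (simp add: dist_norm Cb_diff)
      also have "\<dots> \<le> norm (Cb (g - h)) / 2" by (rule Cb_norm)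
      also have "\<dots> \<le> (norm (g - h) / 2) / 2" by (intro divide_right_mono Cb_norm) simp
      finally show "dist (Bcontfun r1 + Cb (Cb g)) (Bcontfun r1 + Cb (Cb h)) \<le> 1 / 4 * dist g h"
        by (simp add: dist_norm)
    qed
  qed auto
  then obtain g where g: "g = Bcontfun r1 + Cb (Cb g)" by metis
  show ?thesis
  proof (rule that[of c "apply_bcontfun g"])
    show "apply_bcontfun g p = exp (- c * (pos_fst p + pos_snd p)) *\<^sub>R corr q p + volterra c (volterra c (apply_bcontfun g)) p" for p
      using arg_cong[OF g, of "\<lambda>g. apply_bcontfun g p"] by (simp add: plus_bcontfun.rep_eq Cb r1) (simp add: r1_def)
    show "continuous_on UNIV (volterra c (apply_bcontfun g))"
      by (rule volterra_continuous[OF cg bd less_imp_le[OF c]])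
    show "bounded (range (apply_bcontfun g))" "bounded (range (volterra c (apply_bcontfun g)))"
      using bd[of g] half[OF cg bd, of g] unfolding bounded_iff by blast+
  qed (use c in auto)
qed

text \<open>Goursat problem in the characteristic coordinates \<open>\<xi> = (x + t) / 2\<close>, \<open>\<eta> = (x - t) / 2\<close>:
  \<open>R\<close> and \<open>S = q(\<xi>) + T\<close> solve \<open>\<partial>\<^sub>\<xi> R = q S\<close>, \<open>\<partial>\<^sub>\<eta> S = q R\<close>, where \<open>q\<close> is evaluated at \<open>x = \<xi> + \<eta>\<close>.
  Splitting off \<open>q(\<xi>)\<close> leaves continuous unknowns.\<close>

theorem goursat:
  "\<exists>R T :: real \<times> real \<Rightarrow> complex. continuous_on UNIV R \<and> continuous_on UNIV T \<and>
    (\<forall>\<xi>\<ge>0. \<forall>\<eta>\<ge>0. R (\<xi>, \<eta>) = (LINT r:{\<eta>..\<xi> + \<eta>}|lborel. q r * (q (r - \<eta>) + T (r - \<eta>, \<eta>)))) \<and>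
    (\<forall>\<xi>\<ge>0. \<forall>\<eta>\<ge>0. T (\<xi>, \<eta>) = (LINT r:{\<xi>..\<xi> + \<eta>}|lborel. q r * R (\<xi>, r - \<xi>)))"
proof -
  obtain c g where c: "c > 0" and g: "continuous_on UNIV g" "bounded (range g)"
    and fix_g: "\<And>p. g p = exp (- c * (pos_fst p + pos_snd p)) *\<^sub>R corr q p + volterra c (volterra c g) p"
    and h: "continuous_on UNIV (volterra c g)" "bounded (range (volterra c g))"
    using goursat_bounded_solution by metis
  define R where "R = (\<lambda>p. exp (c * (pos_fst p + pos_snd p)) *\<^sub>R g p)"
  \<comment> \<open>The flipped pair undoes the exchange of coordinates built into
    \<open>volterra_integrand\<close>.\<close>
  define T where "T = (\<lambda>p. exp (c * (pos_fst p + pos_snd p)) *\<^sub>R volterra c g (snd p, fst p))"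
  have vol: "exp (c * (\<xi> + \<eta>)) *\<^sub>R volterra c u (\<xi>, \<eta>) = (LINT r:{\<eta>..\<xi> + \<eta>}|lborel. q r * (exp (c * r) *\<^sub>R u (\<eta>, r - \<eta>)))"
    if "\<xi> \<ge> 0" "\<eta> \<ge> 0" for \<xi> \<eta> u
    unfolding volterra_def volterra_integrand_def integral_scaleR_right[symmetric] set_lebesgue_integral_def
  proof (rule Bochner_Integration.integral_cong)
    fix r
    \<comment> \<open>Removing the weight at (\<xi>, \<eta>) leaves exactly the factor that removes
      it at the point read by the operator, whose coordinates add up to \<open>r\<close>.\<close>
    have e: "exp (c * (\<xi> + \<eta>)) * exp (- c * (\<xi> + \<eta> - r)) = exp (c * r)"
      by (simp add: exp_add[symmetric] algebra_simps)
    have "exp (c * (\<xi> + \<eta>)) *\<^sub>R (indicator {\<eta>..\<xi> + \<eta>} r *\<^sub>R (q r * (exp (- c * (\<xi> + \<eta> - r)) *\<^sub>R u (\<eta>, r - \<eta>))))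
      = indicator {\<eta>..\<xi> + \<eta>} r *\<^sub>R (q r * ((exp (c * (\<xi> + \<eta>)) * exp (- c * (\<xi> + \<eta> - r))) *\<^sub>R u (\<eta>, r - \<eta>)))"
      by (simp add: mult_ac)
    then show "exp (c * (\<xi> + \<eta>)) *\<^sub>R (indicator {pos_snd (\<xi>, \<eta>)..pos_fst (\<xi>, \<eta>) + pos_snd (\<xi>, \<eta>)} r *\<^sub>R
      (q r * (exp (- c * (pos_fst (\<xi>, \<eta>) + pos_snd (\<xi>, \<eta>) - r)) *\<^sub>R u (pos_snd (\<xi>, \<eta>), r - pos_snd (\<xi>, \<eta>)))))
      = indicator {\<eta>..\<xi> + \<eta>} r *\<^sub>R (q r * (exp (c * r) *\<^sub>R u (\<eta>, r - \<eta>)))"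
      using that by (simp only: e fst_conv snd_conv max_absorb2)
  qed simp
  show ?thesis
  proof (rule exI[of _ R], rule exI[of _ T], intro conjI allI impI)
    show "continuous_on UNIV R" unfolding R_def by (intro continuous_intros g)
    show "continuous_on UNIV T" unfolding T_def
      by (intro continuous_intros continuous_on_compose2[OF h(1)]) auto
    fix \<xi> \<eta> :: real assume nn: "\<xi> \<ge> 0" "\<eta> \<ge> 0"
    have T: "exp (c * r) *\<^sub>R volterra c g (\<eta>, r - \<eta>) = T (r - \<eta>, \<eta>)" if "r \<in> {\<eta>..\<xi> + \<eta>}" for r
      using that nn by (simp add: T_def)
    have R: "exp (c * r) *\<^sub>R g (\<xi>, r - \<xi>) = R (\<xi>, r - \<xi>)" if "r \<in> {\<xi>..\<xi> + \<eta>}" for r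
      using that nn by (simp add: R_def)
    have cT: "continuous_on UNIV (\<lambda>r. T (r - \<eta>, \<eta>))"
      unfolding T_def by (intro continuous_intros continuous_on_compose2[OF h(1)]) auto
    have i: "set_integrable lborel {\<eta>..\<xi> + \<eta>} (\<lambda>r. q r * q (r - \<eta>))"
      unfolding set_integrable_def by (rule corr_integrable[OF q_borel q_L2])
    have i2: "set_integrable lborel {\<eta>..\<xi> + \<eta>} (\<lambda>r. q r * T (r - \<eta>, \<eta>))"
      unfolding mult.commute[of "q _"]
      by (rule set_integrable_mult_continuous[OF q_set_integrable continuous_on_subset[OF cT]]) auto
    have "R (\<xi>, \<eta>) = exp (c * (\<xi> + \<eta>)) *\<^sub>R (exp (- c * (\<xi> + \<eta>)) *\<^sub>R corr q (\<xi>, \<eta>) + volterra c (volterra c g) (\<xi>, \<eta>))"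
      using nn by (simp add: R_def) (subst fix_g, simp)
    also have "\<dots> = (exp (c * (\<xi> + \<eta>)) * exp (- c * (\<xi> + \<eta>))) *\<^sub>R corr q (\<xi>, \<eta>) + exp (c * (\<xi> + \<eta>)) *\<^sub>R volterra c (volterra c g) (\<xi>, \<eta>)"
      by (simp only: scaleR_add_right scaleR_scaleR)
    also have "exp (c * (\<xi> + \<eta>)) * exp (- c * (\<xi> + \<eta>)) = 1" by (simp add: exp_minus)
    also have "1 *\<^sub>R corr q (\<xi>, \<eta>) = (LINT r:{\<eta>..\<xi> + \<eta>}|lborel. q r * q (r - \<eta>))"
      using nn by (simp add: corr_def set_lebesgue_integral_def)
    also have "exp (c * (\<xi> + \<eta>)) *\<^sub>R volterra c (volterra c g) (\<xi>, \<eta>) = (LINT r:{\<eta>..\<xi> + \<eta>}|lborel. q r * T (r - \<eta>, \<eta>))"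
      unfolding vol[OF nn] by (rule set_lebesgue_integral_cong) (auto simp: T)
    finally show "R (\<xi>, \<eta>) = (LINT r:{\<eta>..\<xi> + \<eta>}|lborel. q r * (q (r - \<eta>) + T (r - \<eta>, \<eta>)))"
      by (simp add: distrib_left set_integral_add(2)[OF i i2])
    have "T (\<xi>, \<eta>) = exp (c * (\<eta> + \<xi>)) *\<^sub>R volterra c g (\<eta>, \<xi>)"
      using nn by (simp add: T_def add.commute)
    also have "\<dots> = (LINT r:{\<xi>..\<eta> + \<xi>}|lborel. q r * (exp (c * r) *\<^sub>R g (\<xi>, r - \<xi>)))"
      by (rule vol[OF nn(2,1)])
    also have "\<dots> = (LINT r:{\<xi>..\<xi> + \<eta>}|lborel. q r * R (\<xi>, r - \<xi>))"
      unfolding add.commute[of \<eta> \<xi>] by (rule set_lebesgue_integral_cong) (auto simp: R)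
    finally show "T (\<xi>, \<eta>) = (LINT r:{\<xi>..\<xi> + \<eta>}|lborel. q r * R (\<xi>, r - \<xi>))" .
  qed
qed

end

section \<open>Transmutation kernels of the Dirac system\<close>

lemma norm_exp_bound:
  assumes "\<bar>t\<bar> \<le> l"
  shows "norm (exp (\<i> * \<rho> * of_real t)) \<le> exp (norm \<rho> * l)"
proof -
  have "Re (\<i> * \<rho> * of_real t) \<le> norm (\<i> * \<rho> * of_real t)" by (rule complex_Re_le_cmod)
  also have "\<dots> \<le> norm \<rho> * l" using assms by (simp add: norm_mult mult_left_mono)
  finally show ?thesis by simp
qed

lemma set_integrable_mult_exp:
  assumes "set_integrable lborel {a..b} g"
  shows "set_integrable lborel {a..b} (\<lambda>t. g t * exp (\<i> * \<rho> * of_real t))"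
  unfolding mult.commute[of "g _"] by (intro set_integrable_mult_continuous assms continuous_intros)

text \<open>Dominated convergence again, after the integrand has been modified outside the relevant
  rectangle so that one bound serves all points of the plane.\<close>

lemma primitive_continuous_on_T_set:
  fixes N :: "real \<times> real \<Rightarrow> complex"
  assumes N: "continuous_on UNIV N" and l: "l > 0"
  shows "continuous_on (T_set l) (\<lambda>p. LINT \<tau>:{- fst p..snd p}|lborel. N (fst p, \<tau>))"
proof -
  \<comment> \<open>Clamping both arguments makes \<open>N\<close> bounded and changes nothing for
    points of the triangle.\<close>
  define M where "M = (\<lambda>(p :: real \<times> real) \<tau>. N (max 0 (min l (fst p)), max (- l) (min l \<tau>)))"
  obtain B where "\<And>p. p \<in> {0..l} \<times> {-l..l} \<Longrightarrow> norm (N p) \<le> B"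
    using continuous_on_compact_bound[OF compact_Times[OF compact_Icc compact_Icc] continuous_on_subset[OF N subset_UNIV]] by metis
  then have B: "norm (M p \<tau>) \<le> B" for p :: "real \<times> real" and \<tau>
    unfolding M_def using l by auto
  have B0: "B \<ge> 0" using B norm_ge_zero order_trans by blast
  define J where "J = (\<lambda>p :: real \<times> real. \<integral>\<tau>. indicator {max (- l) (- fst p)..min l (snd p)} \<tau> *\<^sub>R M p \<tau> \<partial>lborel)"
  have "isCont J p" for p
    unfolding J_def
  proof (rule isCont_parametric_integral[where w="\<lambda>\<tau>. B * indicator {-l..l} \<tau>"])
    show "integrable lborel (\<lambda>\<tau>. B * indicator {-l..l} \<tau>)"
      by (intro integrable_mult_right integrable_real_indicator) (auto simp: emeasure_lborel_Icc_eq)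
    show "norm (indicator {max (- l) (- fst p)..min l (snd p)} \<tau> *\<^sub>R M p \<tau>) \<le> B * indicator {-l..l} \<tau>" for p :: "real \<times> real" and \<tau>
      using B[of p \<tau>] B0 by (auto simp: indicator_def)
    show "AE \<tau> in lborel. isCont (\<lambda>p. indicator {max (- l) (- fst p)..min l (snd p)} \<tau> *\<^sub>R M p \<tau>) p"
      using AE_lborel_singleton[of "max (- l) (- fst p)"] AE_lborel_singleton[of "min l (snd p)"]
    proof eventually_elim
      case (elim \<tau>)
      have 1: "isCont (\<lambda>p. indicator {max (- l) (- fst p)..min l (snd p)} \<tau> :: real) p"
        using elim by (intro isCont_indicator_interval continuous_intros) auto
      have 2: "isCont (\<lambda>p. M p \<tau>) p" unfolding M_def
      proof (rule continuous_at_compose[unfolded o_def, where g=N])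
        show "isCont (\<lambda>p. (max 0 (min l (fst p)), max (- l) (min l \<tau>))) p" by (intro continuous_intros)
        show "isCont N (max 0 (min l (fst p)), max (- l) (min l \<tau>))" using N by (simp add: continuous_on_eq_continuous_at)
      qed
      show ?case by (intro continuous_intros 1 2)
    qed
    have "continuous_on UNIV (M p)" for p unfolding M_def
      by (intro continuous_on_compose2[OF N] continuous_intros) auto
    then have [measurable]: "M p \<in> borel_measurable borel" for p by (rule borel_measurable_continuous_onI)
    show "(\<lambda>\<tau>. indicator {max (- l) (- fst p)..min l (snd p)} \<tau> *\<^sub>R M p \<tau>) \<in> borel_measurable borel" for p :: "real \<times> real"
      by measurable
  qed
  then have "continuous_on (T_set l) J" by (auto intro: continuous_at_imp_continuous_on)
  moreover have "J p = (LINT \<tau>:{- fst p..snd p}|lborel. N (fst p, \<tau>))" if p: "p \<in> T_set l" for p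
    unfolding J_def set_lebesgue_integral_def
  proof (rule Bochner_Integration.integral_cong)
    fix \<tau>
    obtain x t where xt: "p = (x, t)" "0 \<le> x" "x \<le> l" "\<bar>t\<bar> \<le> x" using p by (auto simp: T_set_def)
    then have "max (- l) (- x) = - x" "min l t = t" by auto
    then show "indicator {max (- l) (- fst p)..min l (snd p)} \<tau> *\<^sub>R M p \<tau> = indicator {- fst p..snd p} \<tau> *\<^sub>R N (fst p, \<tau>)"
      using xt by (auto simp: M_def indicator_def)
  qed simp
  ultimately show ?thesis by (metis (no_types, lifting) continuous_on_cong)
qed

context potential
begin

text \<open>The shift t = x - r + \<tau> maps the region (x - t)/2 \<le> r \<le> x, |t| \<le> x onto
  |\<tau>| \<le> r \<le> x and splits the exponential as E(x - r) E(\<tau>). Transforming a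
  characteristic integral of a kernel thus gives a variation-of-constants integral of the
  transform.\<close>

lemma convolution_Fubini:
  fixes N :: "real \<times> real \<Rightarrow> complex"
  assumes [measurable]: "N \<in> borel_measurable borel"
    and i: "\<And>r. r \<in> {0..l} \<Longrightarrow> set_integrable lborel {-r..r} (\<lambda>\<tau>. N (r, \<tau>))"
    and B: "\<And>r. r \<in> {0..l} \<Longrightarrow> (LINT \<tau>:{-r..r}|lborel. norm (N (r, \<tau>))) \<le> B"
    and x: "x \<in> {0..l}" and E_def: "E = (\<lambda>t. exp (\<i> * \<rho> * complex_of_real t))"
  shows "(LINT t:{-x..x}|lborel. (LINT r:{(x - t) / 2..x}|lborel. q r * N (r, r - x + t)) * E t) =
     (LINT r:{0..x}|lborel. E (x - r) * (q r * (LINT \<tau>:{-r..r}|lborel. N (r, \<tau>) * E \<tau>)))" (is ?eq)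
    and "set_integrable lborel {0..x} (\<lambda>r. E (x - r) * (q r * (LINT \<tau>:{-r..r}|lborel. N (r, \<tau>) * E \<tau>)))" (is ?int)
    and "set_integrable lborel {-x..x} (\<lambda>t. (LINT r:{(x - t) / 2..x}|lborel. q r * N (r, r - x + t)) * E t)" (is ?int2)
proof -
  have E_add: "E (s + t) = E s * E t" for s t
    by (simp add: E_def exp_add[symmetric] algebra_simps)
  have Ec: "continuous_on A E" for A unfolding E_def by (intro continuous_intros)
  have [measurable]: "E \<in> borel_measurable borel" by (rule borel_measurable_continuous_onI[OF Ec])
  \<comment> \<open>The integrand on the triangle, cut off so that the order of integration is free:
    x - 2r \<le> t is the same as (x - t)/2 \<le> r.\<close>
  define G where "G = (\<lambda>r t. (indicator {0..x} r * indicator {x - 2 * r..x} t) *\<^sub>R (E t * (q r * N (r, r - x + t))))"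
  have [measurable]: "(\<lambda>(r, t). N (r, r - x + t)) \<in> borel_measurable borel"
  proof -
    have "(\<lambda>p::real\<times>real. (fst p, fst p - x + snd p)) \<in> borel_measurable borel"
      by (intro borel_measurable_continuous_onI continuous_intros)
    then show ?thesis using measurable_compose[OF _ assms(1)] by (simp add: case_prod_beta')
  qed
  have Gm: "case_prod G \<in> borel_measurable (lborel \<Otimes>\<^sub>M lborel)"
  proof -
    have 1: "Measurable.pred (borel \<Otimes>\<^sub>M borel) (\<lambda>p. fst p \<in> {0..x} \<and> snd p \<in> {x - 2 * fst p..x})"
      unfolding atLeastAtMost_iff by measurable
    have "case_prod G = (\<lambda>p. if fst p \<in> {0..x} \<and> snd p \<in> {x - 2 * fst p..x} then E (snd p) * (q (fst p) * (case p of (r, t) \<Rightarrow> N (r, r - x + t))) else 0)"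
      by (auto simp: G_def indicator_def fun_eq_iff)
    also have "\<dots> \<in> borel_measurable (borel \<Otimes>\<^sub>M borel)"
    proof (rule measurable_If)
      have "(\<lambda>p. case p of (r, t) \<Rightarrow> N (r, r - x + t)) \<in> borel_measurable (borel \<Otimes>\<^sub>M borel)"
        by (simp add: borel_prod)
      then show "(\<lambda>p. E (snd p) * (q (fst p) * (case p of (r, t) \<Rightarrow> N (r, r - x + t)))) \<in> borel_measurable (borel \<Otimes>\<^sub>M borel)"
        by measurable
    qed (use 1 in \<open>auto simp: pred_def space_pair_measure\<close>)
    finally show ?thesis by (simp add: measurable_lborel1 cong: measurable_cong_sets)
  qed
  \<comment> \<open>Stated for an arbitrary \<open>u\<close> since it is needed for the norm, in the
    integrability bound, and for the identity, in the evaluation.\<close>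
  have inner: "(\<integral>t. u (G r t) \<partial>lborel) = (\<integral>\<tau>. u ((indicator {0..x} r * indicator {-r..r} \<tau>) *\<^sub>R (E (x - r) * (q r * (N (r, \<tau>) * E \<tau>)))) \<partial>lborel)"
    for r and u :: "complex \<Rightarrow> 'b::{banach, second_countable_topology}"
  proof -
    have "(\<integral>t. u (G r t) \<partial>lborel) = (\<integral>\<tau>. u (G r (x - r + \<tau>)) \<partial>lborel)"
      using lborel_integral_real_affine[of 1 "\<lambda>t. u (G r t)" "x - r"] by simp
    also have "\<dots> = (\<integral>\<tau>. u ((indicator {0..x} r * indicator {-r..r} \<tau>) *\<^sub>R (E (x - r) * (q r * (N (r, \<tau>) * E \<tau>)))) \<partial>lborel)"
    proof (rule Bochner_Integration.integral_cong)
      fix \<tau>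
      have "indicator {x - 2 * r..x} (x - r + \<tau>) = (indicator {-r..r} \<tau> :: real)"
        by (auto simp: indicator_def)
      then have "G r (x - r + \<tau>) = (indicator {0..x} r * indicator {-r..r} \<tau>) *\<^sub>R (E (x - r) * (q r * (N (r, \<tau>) * E \<tau>)))"
        unfolding G_def E_add by (simp add: mult_ac)
      then show "u (G r (x - r + \<tau>)) = u ((indicator {0..x} r * indicator {-r..r} \<tau>) *\<^sub>R (E (x - r) * (q r * (N (r, \<tau>) * E \<tau>))))"
        by simp
    qed simp
    finally show ?thesis .
  qed
  have iN: "integrable lborel (\<lambda>\<tau>. (indicator {0..x} r * indicator {-r..r} \<tau>) *\<^sub>R (E (x - r) * (q r * (N (r, \<tau>) * E \<tau>))))" for r
  proof (cases "r \<in> {0..x}")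
    case True
    then have "set_integrable lborel {-r..r} (\<lambda>\<tau>. N (r, \<tau>) * E \<tau>)"
      unfolding E_def using x by (intro set_integrable_mult_exp i) auto
    then have "set_integrable lborel {-r..r} (\<lambda>\<tau>. E (x - r) * (q r * (N (r, \<tau>) * E \<tau>)))"
      by (intro set_integrable_mult_right impI)
    then show ?thesis using True by (simp add: set_integrable_def)
  qed simp
  have iG1: "integrable lborel (G r)" for r
  proof -
    have "integrable lborel (\<lambda>\<tau>. G r (x - r + 1 * \<tau>))"
    proof (rule Bochner_Integration.integrable_cong[THEN iffD1, OF refl _ iN[of r]])
      fix \<tau>
      have "indicator {x - 2 * r..x} (x - r + \<tau>) = (indicator {-r..r} \<tau> :: real)"
        by (auto simp: indicator_def)
      then show "(indicator {0..x} r * indicator {-r..r} \<tau>) *\<^sub>R (E (x - r) * (q r * (N (r, \<tau>) * E \<tau>))) = G r (x - r + 1 * \<tau>)"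
        by (simp add: G_def E_add mult_ac)
    qed
    then show ?thesis by (subst (asm) lborel_integrable_real_affine_iff) auto
  qed
  define C where "C = exp (norm \<rho> * l)"
  have C: "norm (E t) \<le> C" if "\<bar>t\<bar> \<le> l" for t using norm_exp_bound[OF that] by (simp add: C_def E_def)
  have C0: "C \<ge> 0" by (simp add: C_def)
  have iG: "integrable (lborel \<Otimes>\<^sub>M lborel) (case_prod G)"
  proof (rule integrable_pair_of_slices[OF Gm iG1])
    show "integrable lborel (\<lambda>r. C * C * B * norm (q r) * indicator {0..x} r)"
      using integrable_mult_indicator[OF _ integrable_mult_right[OF integrable_norm[OF q_integrable], of "C * C * B"], of "{0..x}"]
      by (simp add: mult_ac)
    fix r
    show "(\<integral>t. norm (G r t) \<partial>lborel) \<le> C * C * B * norm (q r) * indicator {0..x} r"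
    proof (cases "r \<in> {0..x}")
      case True
      have rl: "r \<in> {0..l}" using True x by auto
      have "(\<integral>t. norm (G r t) \<partial>lborel) = (\<integral>\<tau>. norm ((indicator {0..x} r * indicator {-r..r} \<tau>) *\<^sub>R (E (x - r) * (q r * (N (r, \<tau>) * E \<tau>)))) \<partial>lborel)"
        using inner[of norm r] by simp
      also have "\<dots> \<le> (\<integral>\<tau>. C * C * norm (q r) * (indicator {-r..r} \<tau> *\<^sub>R norm (N (r, \<tau>))) \<partial>lborel)"
      proof (rule integral_mono[OF integrable_norm[OF iN]])
        show "integrable lborel (\<lambda>\<tau>. C * C * norm (q r) * (indicator {-r..r} \<tau> *\<^sub>R norm (N (r, \<tau>))))"
          using set_integrable_norm[OF i[OF rl]] unfolding set_integrable_def by (rule integrable_mult_right)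
        fix \<tau>
        show "norm ((indicator {0..x} r * indicator {-r..r} \<tau>) *\<^sub>R (E (x - r) * (q r * (N (r, \<tau>) * E \<tau>))))
           \<le> C * C * norm (q r) * (indicator {-r..r} \<tau> *\<^sub>R norm (N (r, \<tau>)))"
        proof (cases "\<tau> \<in> {-r..r}")
          case tau: True
          have "norm (E (x - r)) * norm (E \<tau>) \<le> C * C"
            using True tau x C0 by (intro mult_mono C) auto
          then have "(norm (E (x - r)) * norm (E \<tau>)) * (norm (q r) * norm (N (r, \<tau>))) \<le> (C * C) * (norm (q r) * norm (N (r, \<tau>)))"
            by (rule mult_right_mono) simp
          then show ?thesis using True tau by (simp add: norm_mult mult_ac)
        qed simp
      qed
      also have "\<dots> = C * C * norm (q r) * (LINT \<tau>:{-r..r}|lborel. norm (N (r, \<tau>)))"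
        unfolding set_lebesgue_integral_def by (rule integral_mult_right_zero)
      also have "\<dots> \<le> C * C * norm (q r) * B"
        using B[OF rl] C0 by (intro mult_left_mono) auto
      finally show ?thesis using True by (simp add: mult_ac)
    next
      case False
      then show ?thesis by (simp add: G_def)
    qed
  qed
  have o1: "(\<integral>t. G r t \<partial>lborel) = indicator {0..x} r *\<^sub>R (E (x - r) * (q r * (LINT \<tau>:{-r..r}|lborel. N (r, \<tau>) * E \<tau>)))" for r
  proof -
    have "(\<integral>t. G r t \<partial>lborel) = (\<integral>\<tau>. (of_real (indicator {0..x} r) * E (x - r) * q r) * (indicator {-r..r} \<tau> *\<^sub>R (N (r, \<tau>) * E \<tau>)) \<partial>lborel)"
      using inner[of "\<lambda>z. z" r] by (simp add: scaleR_conv_of_real mult_ac)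
    also have "\<dots> = (of_real (indicator {0..x} r) * E (x - r) * q r) * (LINT \<tau>:{-r..r}|lborel. N (r, \<tau>) * E \<tau>)"
      unfolding set_lebesgue_integral_def by (rule integral_mult_right_zero)
    finally show ?thesis by (simp add: scaleR_conv_of_real mult_ac)
  qed
  have o2: "(\<integral>r. G r t \<partial>lborel) = indicator {-x..x} t *\<^sub>R ((LINT r:{(x - t) / 2..x}|lborel. q r * N (r, r - x + t)) * E t)" for t
  proof -
    have "G r t = (indicator {(x - t) / 2..x} r *\<^sub>R (q r * N (r, r - x + t))) * (of_real (indicator {-x..x} t) * E t)" for r
      by (auto simp: G_def indicator_def field_simps)
    then have "(\<integral>r. G r t \<partial>lborel) = (LINT r:{(x - t) / 2..x}|lborel. q r * N (r, r - x + t)) * (of_real (indicator {-x..x} t) * E t)"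
      unfolding set_lebesgue_integral_def by (simp only: integral_mult_left_zero)
    then show ?thesis by (simp add: scaleR_conv_of_real mult_ac)
  qed
  show ?eq using lborel_pair.Fubini_integral[OF iG] unfolding o1 o2 
    by (simp add: set_lebesgue_integral_def)
  show ?int using lborel_pair.integrable_fst[OF iG] unfolding o1 by (simp add: set_integrable_def)
  show ?int2 using lborel_pair.integrable_snd[OF iG] unfolding o2 by (simp add: set_integrable_def)
qed

end

definition transform :: "(real \<times> real \<Rightarrow> complex) \<Rightarrow> complex \<Rightarrow> real \<Rightarrow> complex" where
  "transform k \<rho> x = exp (\<i> * \<rho> * of_real x) + (LINT t:{-x..x}|lborel. k (x, t) * exp (\<i> * \<rho> * of_real t))"

lemma compact_T_set: "compact (T_set l)"
proof -
  have "T_set l = {p. 0 \<le> fst p \<and> fst p \<le> l \<and> \<bar>snd p\<bar> \<le> fst p}"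
    by (auto simp: T_set_def)
  moreover have "closed \<dots>" by (intro closed_Collect_conj closed_Collect_le continuous_intros)
  moreover have "T_set l \<subseteq> {0..l} \<times> {-l..l}" by (auto simp: T_set_def)
  ultimately show ?thesis
    using bounded_subset[OF compact_imp_bounded[OF compact_Times[OF compact_Icc compact_Icc]]] 
    by (metis compact_eq_bounded_closed)
qed

lemma set_integral_symmetric_reflect:
  fixes u :: "real \<Rightarrow> complex"
  shows "(LINT t:{-a..a}|lborel. u (- t)) = (LINT t:{-a..a}|lborel. u t)"
proof -
  have "(LINT t:{-a..a}|lborel. u t) = (\<integral>t. indicator {-a..a} (0 + - 1 * t) *\<^sub>R u (0 + - 1 * t) \<partial>lborel)"
    unfolding set_lebesgue_integral_def
    using lborel_integral_real_affine[of "- 1" "\<lambda>t. indicator {-a..a} t *\<^sub>R u t" 0] by simp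
  also have "\<dots> = (LINT t:{-a..a}|lborel. u (- t))"
    unfolding set_lebesgue_integral_def
    by (rule Bochner_Integration.integral_cong) (auto simp: indicator_def)
  finally show ?thesis by simp
qed

text \<open>The substitution t = 2s - x, which turns q((x + t)/2) into q(s).\<close>

lemma
  fixes u :: "real \<Rightarrow> 'b::{banach, second_countable_topology}"
  shows set_integral_half_shift: "(LINT t:{-x..b}|lborel. u t) = 2 *\<^sub>R (LINT s:{0..(x + b) / 2}|lborel. u (2 * s - x))"
    and set_integrable_half_shift: "set_integrable lborel {-x..b} u \<longleftrightarrow> set_integrable lborel {0..(x + b) / 2} (\<lambda>s. u (2 * s - x))"
proof -
  have e: "(indicator {-x..b} (- x + 2 * s) :: real) *\<^sub>R u (- x + 2 * s) = indicator {0..(x + b) / 2} s *\<^sub>R u (2 * s - x)" for s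
    by (auto simp: indicator_def)
  show "(LINT t:{-x..b}|lborel. u t) = 2 *\<^sub>R (LINT s:{0..(x + b) / 2}|lborel. u (2 * s - x))"
    unfolding set_lebesgue_integral_def
    using lborel_integral_real_affine[of 2 "\<lambda>t. indicator {-x..b} t *\<^sub>R u t" "- x"] 
    by (simp only: e abs_numeral)
  show "set_integrable lborel {-x..b} u \<longleftrightarrow> set_integrable lborel {0..(x + b) / 2} (\<lambda>s. u (2 * s - x))"
    unfolding set_integrable_def
    using lborel_integrable_real_affine_iff[of 2 "\<lambda>t. indicator {-x..b} t *\<^sub>R u t" "- x"] 
    by (simp only: e)
qed

lemma set_integrable_continuous_Icc:
  fixes u :: "real \<Rightarrow> 'b::{banach, second_countable_topology}"
  assumes "continuous_on {a..b} u"
  shows "set_integrable lborel {a..b} u"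
  unfolding set_integrable_def by (rule borel_integrable_compact) (use assms in auto)

lemma ac_on_exp: "ac_on a b (\<lambda>x. exp (\<i> * \<rho> * of_real x)) (\<lambda>x. \<i> * \<rho> * exp (\<i> * \<rho> * of_real x))"
proof (rule ac_on_C1)
  fix x
  have "((\<lambda>z. exp (\<i> * \<rho> * z)) has_field_derivative \<i> * \<rho> * exp (\<i> * \<rho> * of_real x)) (at (of_real x))"
    by (auto intro!: derivative_eq_intros)
  then have "((\<lambda>x. exp (\<i> * \<rho> * of_real x)) has_vector_derivative \<i> * \<rho> * exp (\<i> * \<rho> * of_real x)) (at x)"
    by (rule has_vector_derivative_real_field)
  then show "((\<lambda>x. exp (\<i> * \<rho> * of_real x)) has_vector_derivative \<i> * \<rho> * exp (\<i> * \<rho> * of_real x)) (at x within {a..b})"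
    by (rule has_vector_derivative_at_within)
qed (intro continuous_intros)

context potential
begin

text \<open>Although q((x + t)/2) has no pointwise bound, its L^1 norm over a slice is at most twice
  that of \<open>q\<close>, uniformly in \<open>x\<close>. This is the hypothesis that Fubini needs
  for the kernels.\<close>

lemma kernel_slice_bound:
  fixes n :: "real \<Rightarrow> complex"
  assumes n: "n \<in> borel_measurable borel" and x: "x \<in> {0..l}" and B0: "0 \<le> B"
    and b: "\<And>t. t \<in> {-x..x} \<Longrightarrow> norm (n t) \<le> B + norm (q ((x + t) / 2))"
  shows "set_integrable lborel {-x..x} n"
    and "(LINT t:{-x..x}|lborel. norm (n t)) \<le> 2 * l * B + 2 * (\<integral>x. norm (q x) \<partial>lborel)"
proof -
  have iB: "set_integrable lborel {-x..x} (\<lambda>\<tau>. B)" by (intro set_integrable_continuous_Icc continuous_intros)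
  have "set_integrable lborel {-x..x} (\<lambda>t. q ((x + t) / 2))"
    by (subst set_integrable_half_shift) (simp add: q_set_integrable)
  then have iq: "set_integrable lborel {-x..x} (\<lambda>t. norm (q ((x + t) / 2)))" by (rule set_integrable_norm)
  show i: "set_integrable lborel {-x..x} n"
  proof (rule set_integrable_bound[OF set_integral_add(1)[OF iB iq]])
    show "set_borel_measurable lborel {-x..x} n" using n by (simp add: set_borel_measurable_def)
    show "AE t in lborel. t \<in> {-x..x} \<longrightarrow> norm (n t) \<le> norm (B + norm (q ((x + t) / 2)))"
      using order_trans[OF b abs_ge_self] by (intro AE_I2) auto
  qed
  have "(LINT t:{-x..x}|lborel. norm (n t)) \<le> (LINT \<tau>:{-x..x}|lborel. B + norm (q ((x + \<tau>) / 2)))"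
    by (rule set_integral_mono[OF set_integrable_norm[OF i] set_integral_add(1)[OF iB iq] b])
  also have "\<dots> = (LINT \<tau>:{-x..x}|lborel. B) + (LINT \<tau>:{-x..x}|lborel. norm (q ((x + \<tau>) / 2)))"
    by (rule set_integral_add(2)[OF iB iq])
  also have "(LINT \<tau>:{-x..x}|lborel. B) = 2 * x * B"
    using x by (simp add: set_lebesgue_integral_def)
  also have "(LINT \<tau>:{-x..x}|lborel. norm (q ((x + \<tau>) / 2))) = 2 * (LINT s:{0..x}|lborel. norm (q s))"
    by (subst set_integral_half_shift) simp
  also have "(LINT s:{0..x}|lborel. norm (q s)) \<le> (\<integral>x. norm (q x) \<partial>lborel)"
    unfolding set_lebesgue_integral_def
    by (rule integral_mono) (use q_set_integrable[of "{0..x}"] set_integrable_norm[of lborel "{0..x}" q] q_integrable in \<open>auto simp: set_integrable_def indicator_def\<close>)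
  also have "2 * x * B \<le> 2 * l * B" using x B0 by (intro mult_right_mono) auto
  finally show "(LINT t:{-x..x}|lborel. norm (n t)) \<le> 2 * l * B + 2 * (\<integral>x. norm (q x) \<partial>lborel)" by simp
qed

lemma measurable_slice:
  fixes n :: "real \<times> real \<Rightarrow> complex"
  assumes "n \<in> borel_measurable borel"
  shows "(\<lambda>t. n (x, t)) \<in> borel_measurable borel" "(\<lambda>x. n (x, t)) \<in> borel_measurable borel"
  by (rule measurable_compose[OF borel_measurable_continuous_onI assms]; intro continuous_intros)+

text \<open>The kernels are k = (R + S)/2 and h = (R - S)/2. No derivative of \<open>R\<close> or
  \<open>S\<close> is taken: transforming their integral equations gives the variation-of-constants
  formulas for the sum and the difference of the two Dirac components, and the product rule turns
  these into the system.\<close>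

theorem dirac_kernels:
  obtains k h :: "real \<times> real \<Rightarrow> complex" and B where
    "0 \<le> B" "k \<in> borel_measurable borel" "h \<in> borel_measurable borel"
    "\<And>x t. x \<in> {0..l} \<Longrightarrow> \<bar>t\<bar> \<le> x \<Longrightarrow> norm (k (x, t)) \<le> B + norm (q ((x + t) / 2))"
    "\<And>x t. x \<in> {0..l} \<Longrightarrow> \<bar>t\<bar> \<le> x \<Longrightarrow> norm (h (x, t)) \<le> B + norm (q ((x + t) / 2))"
    "continuous_on (T_set l) (\<lambda>p. LINT \<tau>:{- fst p..snd p}|lborel. k (fst p, \<tau>))"
    "continuous_on (T_set l) (\<lambda>p. LINT \<tau>:{- fst p..snd p}|lborel. h (fst p, \<tau>))"
    "\<And>\<rho>. ac_on 0 l (transform k \<rho>) (\<lambda>x. q x * transform k \<rho> x + \<i> * \<rho> * transform h \<rho> x)"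
    "\<And>\<rho>. ac_on 0 l (transform h \<rho>) (\<lambda>x. - q x * transform h \<rho> x + \<i> * \<rho> * transform k \<rho> x)"
proof -
  obtain R T :: "real \<times> real \<Rightarrow> complex" where cR: "continuous_on UNIV R" and cT: "continuous_on UNIV T"
    and R: "\<forall>\<xi>\<ge>0. \<forall>\<eta>\<ge>0. R (\<xi>, \<eta>) = (LINT r:{\<eta>..\<xi> + \<eta>}|lborel. q r * (q (r - \<eta>) + T (r - \<eta>, \<eta>)))"
    and T: "\<forall>\<xi>\<ge>0. \<forall>\<eta>\<ge>0. T (\<xi>, \<eta>) = (LINT r:{\<xi>..\<xi> + \<eta>}|lborel. q r * R (\<xi>, r - \<xi>))"
    using goursat by blast
  define Rk where "Rk = (\<lambda>p. R ((fst p + snd p) / 2, (fst p - snd p) / 2))"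
  define Tk where "Tk = (\<lambda>p. T ((fst p + snd p) / 2, (fst p - snd p) / 2))"
  define Qk where "Qk = (\<lambda>p. q ((fst p + snd p) / 2))"
  define S where "S = (\<lambda>p. Qk p + Tk p)"
  define k where "k = (\<lambda>p. (Rk p + S p) / 2)"
  define h where "h = (\<lambda>p. (Rk p - S p) / 2)"
  have cRk: "continuous_on A Rk" and cTk: "continuous_on A Tk" for A
    unfolding Rk_def Tk_def
    by (rule continuous_on_compose2[OF cR] continuous_on_compose2[OF cT]; (intro continuous_intros)?; simp)+
  have [measurable]: "Rk \<in> borel_measurable borel" "Tk \<in> borel_measurable borel"
    using cRk cTk by (auto intro: borel_measurable_continuous_onI)
  have [measurable]: "Qk \<in> borel_measurable borel"
    unfolding Qk_def 
    by (rule measurable_compose[OF borel_measurable_continuous_onI q_borel]) (intro continuous_intros, simp)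
  have [measurable]: "S \<in> borel_measurable borel" unfolding S_def by measurable
  have sl: "continuous_on A (\<lambda>t. Rk (x, t))" "continuous_on A (\<lambda>t. Tk (x, t))" 
     "continuous_on A (\<lambda>t. Rk (x, - t))" for A x
    by (auto intro!: continuous_on_compose2[OF cRk[of UNIV]] continuous_on_compose2[OF cTk[of UNIV]] continuous_intros)
  obtain B where B: "\<And>p. p \<in> T_set l \<Longrightarrow> norm (Rk p) \<le> B" "\<And>p. p \<in> T_set l \<Longrightarrow> norm (Tk p) \<le> B"
  proof -
    obtain B1 B2 where "\<And>p. p \<in> T_set l \<Longrightarrow> norm (Rk p) \<le> B1" "\<And>p. p \<in> T_set l \<Longrightarrow> norm (Tk p) \<le> B2"
      using continuous_on_compact_bound[OF compact_T_set cRk] continuous_on_compact_bound[OF compact_T_set cTk] by metis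
    then show ?thesis using that[of "max B1 B2"] by (meson max.coboundedI1 max.coboundedI2)
  qed
  have B0: "B \<ge> 0" by (rule order_trans[OF norm_ge_zero B(1)[of "(0, 0)"]]) (use l_pos in \<open>auto simp: T_set_def\<close>)
  have Tin: "(x, t) \<in> T_set l" if "x \<in> {0..l}" "\<bar>t\<bar> \<le> x" for x t using that by (auto simp: T_set_def)
  have Sb: "norm (S (x, t)) \<le> B + norm (q ((x + t) / 2))" if "x \<in> {0..l}" "\<bar>t\<bar> \<le> x" for x t
    using norm_triangle_ineq[of "Qk (x, t)" "Tk (x, t)"] B(2)[OF Tin[OF that]] by (simp add: S_def Qk_def)
  have iQ: "set_integrable lborel {-x..b} (\<lambda>t. Qk (x, t))" for x b
    by (subst set_integrable_half_shift) (simp add: Qk_def q_set_integrable)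
  have iS: "set_integrable lborel {-x..b} (\<lambda>t. S (x, t))" for x b
    unfolding S_def by (intro set_integral_add iQ set_integrable_continuous_Icc sl)
  have iR: "set_integrable lborel A (\<lambda>t. Rk (x, t))" if "A = {a..b}" for A a b x
    unfolding that by (intro set_integrable_continuous_Icc sl)
  have nS: "(LINT \<tau>:{-r..r}|lborel. norm (S (r, \<tau>))) \<le> 2 * l * B + 2 * (\<integral>x. norm (q x) \<partial>lborel)"
    if r: "r \<in> {0..l}" for r
    using r by (intro kernel_slice_bound(2) B0 Sb measurable_slice) (auto simp: abs_le_iff)
  have Rrep: "Rk (x, t) = (LINT r:{(x - t) / 2..x}|lborel. q r * S (r, r - x + t))" if "\<bar>t\<bar> \<le> x" for x t
  proof -
    have "Rk (x, t) = (LINT r:{(x - t) / 2..(x + t) / 2 + (x - t) / 2}|lborel. q r * (q (r - (x - t) / 2) + T (r - (x - t) / 2, (x - t) / 2)))"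
      unfolding Rk_def fst_conv snd_conv by (rule R[rule_format]) (use that in auto)
    moreover have "(x + t) / 2 + (x - t) / 2 = x" "\<And>r. r - (x - t) / 2 = (r + (r - x + t)) / 2" "\<And>r. (r - (r - x + t)) / 2 = (x - t) / 2"
      by (auto simp: field_simps)
    ultimately show ?thesis by (simp add: S_def Qk_def Tk_def)
  qed
  \<comment> \<open>The equation for \<open>T\<close> runs along the other family of
    characteristics; evaluating at -t gives it the same shape as the one for
    \<open>R\<close>.\<close>
  have Trep: "Tk (x, - t) = (LINT r:{(x - t) / 2..x}|lborel. q r * Rk (r, - (r - x + t)))" if "\<bar>t\<bar> \<le> x" for x t
  proof -
    have "Tk (x, - t) = (LINT r:{(x - t) / 2..(x - t) / 2 + (x + t) / 2}|lborel. q r * R ((x - t) / 2, r - (x - t) / 2))"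
      unfolding Tk_def fst_conv snd_conv using T[rule_format, of "(x - t) / 2" "(x + t) / 2"] that by simp
    moreover have "(x - t) / 2 + (x + t) / 2 = x" "\<And>r. r - (x - t) / 2 = (r + (r - x + t)) / 2" "\<And>r. (r - (r - x + t)) / 2 = (x - t) / 2"
      by (auto simp: field_simps)
    ultimately show ?thesis by (simp add: Rk_def)
  qed
  have ac: "ac_on 0 l (transform k \<rho>) (\<lambda>x. q x * transform k \<rho> x + \<i> * \<rho> * transform h \<rho> x) \<and>
    ac_on 0 l (transform h \<rho>) (\<lambda>x. - q x * transform h \<rho> x + \<i> * \<rho> * transform k \<rho> x)" for \<rho>
  proof -
    define E where "E = (\<lambda>t. exp (\<i> * \<rho> * complex_of_real t))"
    have E_add: "E (s + t) = E s * E t" for s t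
      by (simp add: E_def exp_add[symmetric] algebra_simps)
    have E0: "E 0 = 1" by (simp add: E_def)
    have E_inv: "E t * E (- t) = 1" for t using E_add[of t "- t"] E0 by simp
    have acE: "ac_on 0 l E (\<lambda>x. \<i> * \<rho> * E x)" unfolding E_def by (rule ac_on_exp)
    have acE': "ac_on 0 l (\<lambda>x. E (- x)) (\<lambda>x. - \<i> * \<rho> * E (- x))"
      using ac_on_exp[of 0 l "- \<rho>"] by (simp add: E_def)
    \<comment> \<open>Sum and difference of the two transforms: the free exponentials add up in
      \<open>p\<close> and cancel in \<open>m\<close>. The aim is p' = i\<rho> p + q m and m' = -
      i\<rho> m + q p, which decouple through the integrating factors E(-x) and E(x).\<close>
    define p where "p = (\<lambda>x. 2 * E x + (LINT t:{-x..x}|lborel. Rk (x, t) * E t))"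
    define m where "m = (\<lambda>x. LINT t:{-x..x}|lborel. S (x, t) * E t)"
    note convS = convolution_Fubini[OF _ iS nS _ E_def]
    have peq: "p x = 2 * E x + (LINT r:{0..x}|lborel. E (x - r) * (q r * m r))" if "x \<in> {0..l}" for x
    proof -
      have "(LINT t:{-x..x}|lborel. Rk (x, t) * E t) = (LINT t:{-x..x}|lborel. (LINT r:{(x - t) / 2..x}|lborel. q r * S (r, r - x + t)) * E t)"
        by (rule set_lebesgue_integral_cong) (auto simp: Rrep abs_le_iff)
      then show ?thesis using convS(1)[of x] that by (simp add: p_def m_def)
    qed
    have iP: "set_integrable lborel {0..l} (\<lambda>r. E (- r) * (q r * m r))"
    proof -
      have "set_integrable lborel {0..l} (\<lambda>r. E (l - r) * (q r * m r))"
        using convS(2)[of l] l_pos by (simp add: m_def)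
      then have "set_integrable lborel {0..l} (\<lambda>r. E (- l) * (E (l - r) * (q r * m r)))"
        by (intro set_integrable_mult_right impI)
      moreover have "E (- l) * E (l - r) = E (- r)" for r by (simp add: E_add[symmetric])
      ultimately show ?thesis by (simp flip: mult.assoc)
    qed
    have "ac_on 0 l (\<lambda>x. 2 + (LINT r:{0..x}|lborel. E (- r) * (q r * m r))) (\<lambda>r. E (- r) * (q r * m r))"
      by (rule ac_on_integral[OF iP])
    from ac_on_mult[OF acE this] have acp: "ac_on 0 l p (\<lambda>x. \<i> * \<rho> * p x + q x * m x)"
    proof (rule ac_on_cong)
      fix x assume x: "x \<in> {0..l}"
      have "E x * (LINT r:{0..x}|lborel. E (- r) * (q r * m r)) = (LINT r:{0..x}|lborel. E (x - r) * (q r * m r))"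
        using E_add[of x "- _"] by (simp flip: set_integral_mult_right mult.assoc)
      then show e: "E x * (2 + (LINT r:{0..x}|lborel. E (- r) * (q r * m r))) = p x"
        using peq[OF x] by (simp add: algebra_simps)
      have "\<i> * \<rho> * E x * (2 + (LINT r:{0..x}|lborel. E (- r) * (q r * m r))) = \<i> * \<rho> * p x"
        unfolding e[symmetric] by (simp only: mult.assoc)
      moreover have "E x * (E (- x) * (q x * m x)) = q x * m x" using E_inv[of x] by (simp flip: mult.assoc)
      ultimately show "\<i> * \<rho> * E x * (2 + (LINT r:{0..x}|lborel. E (- r) * (q r * m r))) + E x * (E (- x) * (q x * m x)) = \<i> * \<rho> * p x + q x * m x"
        by (rule arg_cong2[where f="(+)"])
    qed
    have iM: "set_integrable lborel {0..l} (\<lambda>r. E r * p r * q r)"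
      by (intro set_integrable_mult_continuous[OF q_set_integrable] continuous_on_mult ac_on_continuous[OF acE] ac_on_continuous[OF acp]) simp
    have meq: "m x = E (- x) * (0 + (LINT r:{0..x}|lborel. E r * p r * q r))" if x: "x \<in> {0..l}" for x
    proof -
      \<comment> \<open>Reflecting t amounts to replacing \<rho> by -\<rho>, so the same Fubini
        lemma handles the \<open>T\<close> part.\<close>
      have E': "(\<lambda>t. E (- t)) = (\<lambda>t. exp (\<i> * (- \<rho>) * complex_of_real t))" by (simp add: E_def)
      have nR: "(LINT \<tau>:{-r..r}|lborel. norm (Rk (r, - \<tau>))) \<le> 2 * l * B" if r: "r \<in> {0..l}" for r
      proof -
        have "(LINT \<tau>:{-r..r}|lborel. norm (Rk (r, - \<tau>))) \<le> (LINT \<tau>:{-r..r}|lborel. B)"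
        proof (rule set_integral_mono)
          show "set_integrable lborel {-r..r} (\<lambda>\<tau>. norm (Rk (r, - \<tau>)))"
            by (intro set_integrable_continuous_Icc continuous_intros sl)
          show "set_integrable lborel {-r..r} (\<lambda>\<tau>. B)" by (intro set_integrable_continuous_Icc continuous_intros)
          show "norm (Rk (r, - \<tau>)) \<le> B" if "\<tau> \<in> {-r..r}" for \<tau> 
            by (rule B(1)[OF Tin[OF r]]) (use that in auto)
        qed
        also have "\<dots> = 2 * r * B" using r by (simp add: set_lebesgue_integral_def)
        also have "\<dots> \<le> 2 * l * B" using r B0 by (intro mult_right_mono) auto
        finally show ?thesis .
      qed
      have mN: "(\<lambda>z. Rk (fst z, - snd z)) \<in> borel_measurable borel"
        by (intro borel_measurable_continuous_onI continuous_on_compose2[OF cRk[of UNIV]] continuous_intros) auto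
      note convR = convolution_Fubini[OF mN, unfolded fst_conv snd_conv, OF set_integrable_continuous_Icc[OF sl(3)] nR x E']
      have refl: "(LINT \<tau>:{-r..r}|lborel. Rk (r, - \<tau>) * E (- \<tau>)) = (LINT \<tau>:{-r..r}|lborel. Rk (r, \<tau>) * E \<tau>)" for r
        using set_integral_symmetric_reflect[of r "\<lambda>\<tau>. Rk (r, \<tau>) * E \<tau>"] by simp
      have "(LINT t:{-x..x}|lborel. Tk (x, t) * E t) = (LINT t:{-x..x}|lborel. Tk (x, - t) * E (- t))"
        using set_integral_symmetric_reflect[of x "\<lambda>t. Tk (x, t) * E t"] by simp
      also have "\<dots> = (LINT t:{-x..x}|lborel. (LINT r:{(x - t) / 2..x}|lborel. q r * Rk (r, - (r - x + t))) * E (- t))"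
        by (rule set_lebesgue_integral_cong) (auto simp: Trep abs_le_iff)
      also have "\<dots> = (LINT r:{0..x}|lborel. E (- (x - r)) * (q r * (LINT \<tau>:{-r..r}|lborel. Rk (r, \<tau>) * E \<tau>)))"
        using convR(1) by (simp only: refl)
      finally have mT: "(LINT t:{-x..x}|lborel. Tk (x, t) * E t) = (LINT r:{0..x}|lborel. E (- (x - r)) * (q r * (LINT \<tau>:{-r..r}|lborel. Rk (r, \<tau>) * E \<tau>)))" .
      have iT: "set_integrable lborel {0..x} (\<lambda>r. E (- (x - r)) * (q r * (LINT \<tau>:{-r..r}|lborel. Rk (r, \<tau>) * E \<tau>)))"
        using convR(2) by (simp only: refl)
      \<comment> \<open>The term split off in the Goursat problem: since E(2r - x) = E(-x) E(r)
        E(r), it supplies precisely the summand 2 E(r) of p(r) in the equation for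
        \<open>m\<close>.\<close>
      have mQ: "(LINT t:{-x..x}|lborel. Qk (x, t) * E t) = (LINT r:{0..x}|lborel. 2 * (q r * E (2 * r - x)))"
        by (subst set_integral_half_shift) (simp add: Qk_def scaleR_conv_of_real)
      have cE: "continuous_on A E" for A unfolding E_def by (intro continuous_intros)
      have iQ': "set_integrable lborel {0..x} (\<lambda>r. 2 * (q r * E (2 * r - x)))"
        unfolding mult.commute[of "q _"]
        by (intro set_integrable_mult_right impI set_integrable_mult_continuous q_set_integrable continuous_on_compose2[OF cE[of UNIV]] continuous_intros) auto
      have "m x = (LINT t:{-x..x}|lborel. Qk (x, t) * E t + Tk (x, t) * E t)"
        by (simp add: m_def S_def distrib_right)
      also have "\<dots> = (LINT t:{-x..x}|lborel. Qk (x, t) * E t) + (LINT t:{-x..x}|lborel. Tk (x, t) * E t)"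
        unfolding E_def by (intro set_integral_add set_integrable_mult_exp iQ set_integrable_continuous_Icc sl)
      also have "\<dots> = (LINT r:{0..x}|lborel. 2 * (q r * E (2 * r - x)) + E (- (x - r)) * (q r * (LINT \<tau>:{-r..r}|lborel. Rk (r, \<tau>) * E \<tau>)))"
        unfolding mT mQ by (rule set_integral_add(2)[OF iQ' iT, symmetric])
      also have "\<dots> = (LINT r:{0..x}|lborel. E (- x) * (E r * p r * q r))"
      proof (rule set_lebesgue_integral_cong)
        have "2 * (q r * E (2 * r - x)) + E (- (x - r)) * (q r * (LINT \<tau>:{-r..r}|lborel. Rk (r, \<tau>) * E \<tau>)) = E (- x) * (E r * p r * q r)" for r
          using E_add[of "- x" r] E_add[of "- x + r" r] by (simp add: p_def algebra_simps)
        then show "\<forall>r. r \<in> {0..x} \<longrightarrow> 2 * (q r * E (2 * r - x)) + E (- (x - r)) * (q r * (LINT \<tau>:{-r..r}|lborel. Rk (r, \<tau>) * E \<tau>)) = E (- x) * (E r * p r * q r)"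
          by blast
      qed simp
      finally show ?thesis by simp
    qed
    have "ac_on 0 l (\<lambda>x. 0 + (LINT r:{0..x}|lborel. E r * p r * q r)) (\<lambda>r. E r * p r * q r)"
      by (rule ac_on_integral[OF iM])
    from ac_on_mult[OF acE' this] have acm: "ac_on 0 l m (\<lambda>x. - \<i> * \<rho> * m x + q x * p x)"
    proof (rule ac_on_cong)
      fix x assume x: "x \<in> {0..l}"
      show e: "E (- x) * (0 + (LINT r:{0..x}|lborel. E r * p r * q r)) = m x"
        using meq[OF x] by simp
      have "- \<i> * \<rho> * E (- x) * (0 + (LINT r:{0..x}|lborel. E r * p r * q r)) = - \<i> * \<rho> * m x"
        unfolding e[symmetric] by (simp only: mult.assoc)
      moreover have "E (- x) * (E x * p x * q x) = (E x * E (- x)) * (q x * p x)" by (simp only: mult_ac)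
      then have "E (- x) * (E x * p x * q x) = q x * p x" by (simp only: E_inv mult_1)
      ultimately show "- \<i> * \<rho> * E (- x) * (0 + (LINT r:{0..x}|lborel. E r * p r * q r)) + E (- x) * (E x * p x * q x) = - \<i> * \<rho> * m x + q x * p x"
        by (rule arg_cong2[where f="(+)"])
    qed
    have Ev: "exp (\<i> * \<rho> * complex_of_real t) = E t" for t by (simp add: E_def)
    have tk: "transform k \<rho> x = 1/2 * p x + 1/2 * m x" and th: "transform h \<rho> x = 1/2 * p x + (- 1/2) * m x" for x
    proof -
      have i1: "set_integrable lborel {-x..x} (\<lambda>t. Rk (x, t) * E t)" and i2: "set_integrable lborel {-x..x} (\<lambda>t. S (x, t) * E t)"
        unfolding E_def by (intro set_integrable_mult_exp iR[OF refl] iS)+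
      have "k (x, t) * E t = 1/2 * (Rk (x, t) * E t + S (x, t) * E t)" "h (x, t) * E t = 1/2 * (Rk (x, t) * E t - S (x, t) * E t)" for t
        by (simp_all add: k_def h_def field_simps)
      then have "(LINT t:{-x..x}|lborel. k (x, t) * E t) = 1/2 * ((LINT t:{-x..x}|lborel. Rk (x, t) * E t) + m x)"
        "(LINT t:{-x..x}|lborel. h (x, t) * E t) = 1/2 * ((LINT t:{-x..x}|lborel. Rk (x, t) * E t) - m x)"
        unfolding m_def by (simp_all only: set_integral_mult_right set_integral_add(2)[OF i1 i2] set_integral_diff(2)[OF i1 i2])
      then show "transform k \<rho> x = 1/2 * p x + 1/2 * m x" "transform h \<rho> x = 1/2 * p x + (- 1/2) * m x"
        unfolding transform_def p_def Ev by (simp_all only:) (simp_all add: algebra_simps)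
    qed
    show ?thesis
    proof
      show "ac_on 0 l (transform k \<rho>) (\<lambda>x. q x * transform k \<rho> x + \<i> * \<rho> * transform h \<rho> x)"
        by (rule ac_on_cong[OF ac_on_add[OF ac_on_cmult[OF acp, of "1/2"] ac_on_cmult[OF acm, of "1/2"]]])
          (simp_all add: tk th field_simps)
      show "ac_on 0 l (transform h \<rho>) (\<lambda>x. - q x * transform h \<rho> x + \<i> * \<rho> * transform k \<rho> x)"
        by (rule ac_on_cong[OF ac_on_add[OF ac_on_cmult[OF acp, of "1/2"] ac_on_cmult[OF acm, of "- 1/2"]]])
          (simp_all add: tk th field_simps)
    qed
  qed
  \<comment> \<open>\<open>Qk\<close> itself need not be continuous, but its primitive is twice the
    primitive of \<open>q\<close> evaluated at (x + t)/2.\<close>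
  have cprim: "continuous_on (T_set l) (\<lambda>p. LINT \<tau>:{- fst p..snd p}|lborel. Qk (fst p, \<tau>))"
  proof -
    have "ac_on 0 l (\<lambda>x. 0 + (LINT s:{0..x}|lborel. q s)) q"
      by (rule ac_on_integral[OF q_set_integrable]) simp
    from ac_on_continuous[OF this] have "continuous_on {0..l} (\<lambda>x. (LINT s:{0..x}|lborel. q s))" by simp
    then have "continuous_on (T_set l) (\<lambda>p. 2 *\<^sub>R (LINT s:{0..(fst p + snd p) / 2}|lborel. q s))"
      by (intro continuous_intros, rule continuous_on_compose2) (auto intro!: continuous_intros simp: T_set_def)
    moreover have "(LINT \<tau>:{- fst p..snd p}|lborel. Qk (fst p, \<tau>)) = 2 *\<^sub>R (LINT s:{0..(fst p + snd p) / 2}|lborel. q s)" for p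
      by (subst set_integral_half_shift) (simp add: Qk_def)
    ultimately show ?thesis by simp
  qed
  have prim: "(LINT \<tau>:{-x..t}|lborel. k (x, \<tau>)) = ((LINT \<tau>:{-x..t}|lborel. Rk (x, \<tau>)) + ((LINT \<tau>:{-x..t}|lborel. Qk (x, \<tau>)) + (LINT \<tau>:{-x..t}|lborel. Tk (x, \<tau>)))) / 2"
    "(LINT \<tau>:{-x..t}|lborel. h (x, \<tau>)) = ((LINT \<tau>:{-x..t}|lborel. Rk (x, \<tau>)) - ((LINT \<tau>:{-x..t}|lborel. Qk (x, \<tau>)) + (LINT \<tau>:{-x..t}|lborel. Tk (x, \<tau>)))) / 2" for x t
  proof -
    have iT: "set_integrable lborel {-x..t} (\<lambda>\<tau>. Tk (x, \<tau>))" by (intro set_integrable_continuous_Icc sl)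
    note i = set_integral_add(1)[OF iQ iT]
    show "(LINT \<tau>:{-x..t}|lborel. k (x, \<tau>)) = ((LINT \<tau>:{-x..t}|lborel. Rk (x, \<tau>)) + ((LINT \<tau>:{-x..t}|lborel. Qk (x, \<tau>)) + (LINT \<tau>:{-x..t}|lborel. Tk (x, \<tau>)))) / 2"
      unfolding k_def S_def by (simp add: set_integral_add(2)[OF iR[OF refl] i] set_integral_add(2)[OF iQ iT])
    show "(LINT \<tau>:{-x..t}|lborel. h (x, \<tau>)) = ((LINT \<tau>:{-x..t}|lborel. Rk (x, \<tau>)) - ((LINT \<tau>:{-x..t}|lborel. Qk (x, \<tau>)) + (LINT \<tau>:{-x..t}|lborel. Tk (x, \<tau>)))) / 2"
      unfolding h_def S_def by (simp add: set_integral_diff(2)[OF iR[OF refl] i] set_integral_add(2)[OF iQ iT])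
  qed
  have bnd: "norm (k (x, t)) \<le> B + norm (q ((x + t) / 2))" "norm (h (x, t)) \<le> B + norm (q ((x + t) / 2))"
    if "x \<in> {0..l}" "\<bar>t\<bar> \<le> x" for x t
  proof -
    have *: "norm (Rk (x, t)) + norm (S (x, t)) \<le> 2 * (B + norm (q ((x + t) / 2)))"
      by (rule order_trans[OF add_mono[OF B(1)[OF Tin[OF that]] Sb[OF that]]]) simp
    show "norm (k (x, t)) \<le> B + norm (q ((x + t) / 2))" "norm (h (x, t)) \<le> B + norm (q ((x + t) / 2))"
      using order_trans[OF norm_triangle_ineq *] order_trans[OF norm_triangle_ineq4 *] by (simp_all add: k_def h_def norm_divide)
  qed
  show ?thesis
  proof (rule that[of B k h])
    show "k \<in> borel_measurable borel" "h \<in> borel_measurable borel" unfolding k_def h_def by measurable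
    show "continuous_on (T_set l) (\<lambda>p. LINT \<tau>:{- fst p..snd p}|lborel. k (fst p, \<tau>))"
      "continuous_on (T_set l) (\<lambda>p. LINT \<tau>:{- fst p..snd p}|lborel. h (fst p, \<tau>))"
      unfolding prim using primitive_continuous_on_T_set[OF cRk l_pos] primitive_continuous_on_T_set[OF cTk l_pos] cprim
      by (auto intro!: continuous_intros)
  qed (use bnd ac B0 in auto)
qed

end

section \<open>Uniqueness of the Fourier transform on an interval\<close>

lemma L2_on_imp_set_integrable:
  fixes u :: "'a::euclidean_space \<Rightarrow> complex"
  assumes u: "L2_on \<Omega> u" and O: "\<Omega> \<in> lmeasurable"
  shows "set_integrable lebesgue \<Omega> u"
  unfolding set_integrable_def
proof (rule Bochner_Integration.integrable_bound)
  have "integrable lebesgue (\<lambda>x. indicator \<Omega> x :: real)"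
    using O by (intro integrable_real_indicator) (auto simp: fmeasurable_def)
  moreover have "integrable lebesgue (\<lambda>x. indicator \<Omega> x *\<^sub>R (norm (u x))\<^sup>2)"
    using u by (simp add: L2_on_def set_integrable_def)
  ultimately show "integrable lebesgue (\<lambda>x. indicator \<Omega> x + indicator \<Omega> x *\<^sub>R (norm (u x))\<^sup>2)"
    by (rule Bochner_Integration.integrable_add)
  show "(\<lambda>x. indicator \<Omega> x *\<^sub>R u x) \<in> borel_measurable lebesgue"
    using u by (simp add: L2_on_def set_borel_measurable_def)
  show "AE x in lebesgue. norm (indicator \<Omega> x *\<^sub>R u x) \<le> norm (indicator \<Omega> x + indicator \<Omega> x *\<^sub>R (norm (u x))\<^sup>2)"
  proof (rule AE_I2)
    fix x
    have "2 * norm (u x) \<le> 1 + (norm (u x))\<^sup>2"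
      using zero_le_power2[of "norm (u x) - 1"] by (simp add: power2_eq_square algebra_simps)
    then have "norm (u x) \<le> 1 + (norm (u x))\<^sup>2" using norm_ge_zero[of "u x"] by linarith
    then show "norm (indicator \<Omega> x *\<^sub>R u x) \<le> norm (indicator \<Omega> x + indicator \<Omega> x *\<^sub>R (norm (u x))\<^sup>2)"
      by (simp add: indicator_def)
  qed
qed

lemma set_integrable_lebesgue_open_closed:
  fixes u :: "real \<Rightarrow> 'b::{banach, second_countable_topology}"
  shows "set_integrable lebesgue {a<..<b} u \<longleftrightarrow> set_integrable lebesgue {a..b} u"
proof -
  have 1: "indicator {a<..<b} x *\<^sub>R u x = indicator {a..b} x *\<^sub>R u x" if "x \<notin> {a, b}" for x
    using that by (auto simp: indicator_def)
  show ?thesis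
    unfolding set_integrable_def
    by (rule integrable_discrete_difference[where X="{a, b}"]) (use 1 in auto)
qed

text \<open>It suffices to test with the exponents \<open>\<rho> = - i n\<close>: the functions \<open>e\<^sup>t p(e\<^sup>t)\<close>,
  \<open>p\<close> a polynomial, are uniformly dense in the continuous functions on an interval.\<close>

lemma exponential_moments_zero_imp_integral_zero:
  fixes G :: "real \<Rightarrow> complex" and \<phi> :: "real \<Rightarrow> real"
  assumes G: "integrable lebesgue G" and z: "\<And>t. t \<notin> {-x..x} \<Longrightarrow> G t = 0"
    and mom: "\<And>\<rho>. \<rho> \<noteq> 0 \<Longrightarrow> (\<integral>t. G t * exp (\<i> * \<rho> * of_real t) \<partial>lebesgue) = 0"
    and \<phi>: "continuous_on UNIV \<phi>"
  shows "(\<integral>t. \<phi> t *\<^sub>R G t \<partial>lebesgue) = 0"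
proof -
  define C where "C = (\<integral>t. norm (G t) \<partial>lebesgue)"
  have C: "C \<ge> 0" by (simp add: C_def)
  have m: "u \<in> borel_measurable lebesgue" if "continuous_on UNIV u" for u :: "real \<Rightarrow> real"
    using borel_measurable_continuous_onI[OF that] by (intro measurable_completion) simp
  have int: "integrable lebesgue (\<lambda>t. u t *\<^sub>R G t)" if u: "continuous_on UNIV u" for u :: "real \<Rightarrow> real"
  proof -
    obtain B where B: "\<And>t. t \<in> {-x..x} \<Longrightarrow> norm (u t) \<le> B"
      using continuous_on_compact_bound[OF compact_Icc continuous_on_subset[OF u subset_UNIV]] by metis
    show ?thesis
    proof (rule Bochner_Integration.integrable_bound)
      show "integrable lebesgue (\<lambda>t. B * norm (G t))" using G by simp
      show "(\<lambda>t. u t *\<^sub>R G t) \<in> borel_measurable lebesgue"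
        using m[OF u] G by (intro borel_measurable_scaleR) auto
      show "AE t in lebesgue. norm (u t *\<^sub>R G t) \<le> norm (B * norm (G t))"
      proof (rule AE_I2)
        fix t show "norm (u t *\<^sub>R G t) \<le> norm (B * norm (G t))"
          using order_trans[OF B[of t] abs_ge_self] by (cases "t \<in> {-x..x}") (auto simp: z abs_mult intro!: mult_right_mono)
      qed
    qed
  qed
  have exp0: "(\<integral>t. exp (real (Suc n) * t) *\<^sub>R G t \<partial>lebesgue) = 0" for n
  proof -
    have "exp (\<i> * (- \<i> * of_nat (Suc n)) * of_real t) = complex_of_real (exp (real (Suc n) * t))" for t
      by (simp add: exp_of_real[symmetric] add.commute)
    then have "exp (real (Suc n) * t) *\<^sub>R G t = G t * exp (\<i> * (- \<i> * of_nat (Suc n)) * of_real t)" for t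
      by (simp only: scaleR_conv_of_real mult.commute[of "G t"])
    then show ?thesis using mom[of "- \<i> * of_nat (Suc n)"] by (simp del: of_nat_Suc)
  qed
  have small: "norm (\<integral>t. \<phi> t *\<^sub>R G t \<partial>lebesgue) \<le> e * C" if e: "e > 0" for e
  proof -
    \<comment> \<open>After s = e^t, approximating \<phi>(t) by e^t p(e^t) means approximating
      \<phi>(ln s)/s by p(s). The extra factor e^t keeps the exponent \<rho> = 0 out, where no
      moment is given.\<close>
    define \<psi> where "\<psi> = (\<lambda>s. \<phi> (ln s) / s)"
    have c\<psi>: "continuous_on {exp (- x)..exp x} \<psi>"
      unfolding \<psi>_def
      by (intro continuous_intros continuous_on_compose2[OF \<phi>]) (auto dest: less_le_trans[OF exp_gt_zero])
    \<comment> \<open>The tolerance allows for the factor e^t \<le> e^x when going back from \<psi>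
      to \<phi>.\<close>
    obtain p where p: "real_polynomial_function p" "\<And>s. s \<in> {exp (- x)..exp x} \<Longrightarrow> \<bar>\<psi> s - p s\<bar> < e / exp x"
      using Stone_Weierstrass_real_polynomial_function[OF compact_Icc c\<psi>, of "e / exp x"] e by auto
    obtain a n where pa: "p = (\<lambda>s. \<Sum>i\<le>n. a i * s ^ i)"
      using p(1) real_polynomial_function_iff_sum by auto
    define u where "u = (\<lambda>t. exp t * p (exp t))"
    have u_sum: "u t = (\<Sum>i\<le>n. a i * exp (real (Suc i) * t))" for t
      by (simp add: u_def pa sum_distrib_left exp_of_nat_mult[symmetric] exp_add ring_distribs mult_ac)
    have cu: "continuous_on UNIV u" unfolding u_def pa by (intro continuous_intros)
    have ce: "continuous_on UNIV (\<lambda>t. exp (real (Suc i) * t))" for i by (intro continuous_intros)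
    have "(\<integral>t. u t *\<^sub>R G t \<partial>lebesgue) = (\<integral>t. (\<Sum>i\<le>n. a i *\<^sub>R (exp (real (Suc i) * t) *\<^sub>R G t)) \<partial>lebesgue)"
      unfolding u_sum by (simp add: scaleR_sum_left)
    also have "\<dots> = (\<Sum>i\<le>n. a i *\<^sub>R (\<integral>t. exp (real (Suc i) * t) *\<^sub>R G t \<partial>lebesgue))"
      by (simp only: Bochner_Integration.integral_sum[OF integrable_scaleR_right[OF int[OF ce]]] integral_scaleR_right)
    also have "\<dots> = 0" by (simp only: exp0) simp
    finally have u0: "(\<integral>t. u t *\<^sub>R G t \<partial>lebesgue) = 0" .
    have "(\<integral>t. \<phi> t *\<^sub>R G t \<partial>lebesgue) = (\<integral>t. \<phi> t *\<^sub>R G t - u t *\<^sub>R G t \<partial>lebesgue)"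
      using u0 by (simp add: Bochner_Integration.integral_diff[OF int[OF \<phi>] int[OF cu]])
    also have "norm \<dots> \<le> (\<integral>t. e * norm (G t) \<partial>lebesgue)"
    proof (rule Bochner_Integration.integral_norm_bound_integral)
      show "integrable lebesgue (\<lambda>t. \<phi> t *\<^sub>R G t - u t *\<^sub>R G t)" by (intro Bochner_Integration.integrable_diff int \<phi> cu)
      show "integrable lebesgue (\<lambda>t. e * norm (G t))" using G by simp
      fix t
      show "norm (\<phi> t *\<^sub>R G t - u t *\<^sub>R G t) \<le> e * norm (G t)"
      proof (cases "t \<in> {-x..x}")
        case True
        have "\<bar>\<phi> t - u t\<bar> = exp t * \<bar>\<psi> (exp t) - p (exp t)\<bar>"
        proof -
          have "\<phi> t - u t = exp t * (\<psi> (exp t) - p (exp t))"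
            by (simp add: \<psi>_def u_def right_diff_distrib)
          then show ?thesis by (simp add: abs_mult)
        qed
        also have "\<dots> \<le> exp x * (e / exp x)"
          using True p(2)[of "exp t"] by (intro mult_mono) auto
        finally have "\<bar>\<phi> t - u t\<bar> \<le> e" by simp
        then show ?thesis by (simp add: mult_right_mono flip: scaleR_left_diff_distrib)
      qed (simp add: z)
    qed
    also have "\<dots> = e * C" by (simp add: C_def)
    finally show ?thesis .
  qed
  have "norm (\<integral>t. \<phi> t *\<^sub>R G t \<partial>lebesgue) \<le> 0"
  proof (rule field_le_epsilon)
    fix e :: real assume "e > 0"
    then have "norm (\<integral>t. \<phi> t *\<^sub>R G t \<partial>lebesgue) \<le> e / (C + 1) * C" using C by (intro small) auto
    also have "\<dots> \<le> e" using C \<open>e > 0\<close> by (simp add: field_simps)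
    finally show "norm (\<integral>t. \<phi> t *\<^sub>R G t \<partial>lebesgue) \<le> 0 + e" by simp
  qed
  then show ?thesis by simp
qed

text \<open>Indicators of measurable sets are almost everywhere limits of continuous functions.
  Clipping these to [0,1] gives the majorant |G|, so all integrals of \<open>G\<close> over
  measurable sets vanish.\<close>

lemma exponential_moments_zero_imp_AE_zero:
  fixes G :: "real \<Rightarrow> complex"
  assumes G: "integrable lebesgue G" and z: "\<And>t. t \<notin> {-x..x} \<Longrightarrow> G t = 0"
    and mom: "\<And>\<rho>. \<rho> \<noteq> 0 \<Longrightarrow> (\<integral>t. G t * exp (\<i> * \<rho> * of_real t) \<partial>lebesgue) = 0"
  shows "AE t in lebesgue. G t = 0"
proof (rule sigma_finite_measure.density_zero[OF _ G])
  show "sigma_finite_measure (lebesgue :: real measure)"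
  proof (unfold_locales, intro exI conjI)
    show "countable (range (\<lambda>n::nat. {- real n..real n}))" by simp
    show "range (\<lambda>n::nat. {- real n..real n}) \<subseteq> sets lebesgue" by auto
    have "\<exists>n::nat. - real n \<le> x \<and> x \<le> real n" for x :: real
      using real_arch_simple[of "\<bar>x\<bar>"] by (metis abs_le_iff minus_le_iff)
    then show "\<Union> (range (\<lambda>n::nat. {- real n..real n})) = space lebesgue" by auto
    show "\<forall>a\<in>range (\<lambda>n::nat. {- real n..real n}). emeasure lebesgue a \<noteq> \<infinity>"
      by (auto simp: emeasure_lborel_Icc_eq)
  qed
next
  fix A :: "real set" assume A: "A \<in> sets lebesgue"
  have "(indicator A :: real \<Rightarrow> real) measurable_on UNIV"
    by (rule lebesgue_measurable_imp_measurable_on) (use A in auto)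
  then obtain Z g where Z: "negligible Z" and g: "\<And>n. continuous_on UNIV (g n)" 
    and gl: "\<And>t. t \<notin> Z \<Longrightarrow> (\<lambda>n. g n t) \<longlonglongrightarrow> (indicator A t :: real)"
    unfolding measurable_on_def by auto
  have AEZ: "AE t in lebesgue. t \<notin> Z"
    using Z AE_not_in[of Z lebesgue] by (simp add: negligible_iff_null_sets)
  define c where "c = (\<lambda>n t. max 0 (min 1 (g n t)))"
  have cc: "continuous_on UNIV (c n)" for n unfolding c_def by (intro continuous_intros g)
  have "(\<lambda>n. \<integral>t. c n t *\<^sub>R G t \<partial>lebesgue) \<longlonglongrightarrow> (\<integral>t. indicator A t *\<^sub>R G t \<partial>lebesgue)"
  proof (rule integral_dominated_convergence)
    show "integrable lebesgue (\<lambda>t. norm (G t))" using G by simp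
    show "(\<lambda>t. indicator A t *\<^sub>R G t) \<in> borel_measurable lebesgue"
      using A G by (intro borel_measurable_scaleR) auto
    show "(\<lambda>t. c n t *\<^sub>R G t) \<in> borel_measurable lebesgue" for n
    proof (rule borel_measurable_scaleR)
      show "c n \<in> borel_measurable lebesgue"
        using borel_measurable_continuous_onI[OF cc[of n]] by (intro measurable_completion) simp
    qed (use G in simp)
    show "AE t in lebesgue. norm (c n t *\<^sub>R G t) \<le> norm (G t)" for n
      by (auto simp: c_def intro!: mult_left_le_one_le)
    show "AE t in lebesgue. (\<lambda>n. c n t *\<^sub>R G t) \<longlonglongrightarrow> indicator A t *\<^sub>R G t"
      using AEZ
    proof eventually_elim
      case (elim t)
      have "(\<lambda>n. c n t) \<longlonglongrightarrow> max 0 (min 1 (indicator A t))"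
        unfolding c_def by (intro tendsto_intros gl elim)
      moreover have "max 0 (min 1 (indicator A t)) = (indicator A t :: real)" by (auto simp: indicator_def)
      ultimately show ?case by (auto intro!: tendsto_intros)
    qed
  qed
  moreover have "(\<integral>t. c n t *\<^sub>R G t \<partial>lebesgue) = 0" for n
    by (rule exponential_moments_zero_imp_integral_zero[OF G z mom cc])
  ultimately have "(\<integral>t. indicator A t *\<^sub>R G t \<partial>lebesgue) = 0"
    by (simp add: LIMSEQ_const_iff)
  then show "(LINT t:A|lebesgue. G t) = 0" by (simp add: set_lebesgue_integral_def)
qed

section \<open>Solutions of the impedance equation\<close>

locale impedance = potential +
  fixes f :: "real \<Rightarrow> complex"
  assumes f_ac: "ac_on 0 l f (\<lambda>x. q x * f x)"
    and f_nz: "x \<in> {0..l} \<Longrightarrow> f x \<noteq> 0"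
    and f_0: "f 0 = 1"
begin

lemma inverse_ac: "ac_on 0 l (\<lambda>x. 1 / f x) (\<lambda>x. - q x * (1 / f x))"
  by (rule ac_on_inverse[OF f_ac f_nz])

lemma f_cont: "continuous_on {0..l} f" and inverse_cont: "continuous_on {0..l} (\<lambda>x. 1 / f x)"
  using ac_on_continuous[OF f_ac] ac_on_continuous[OF inverse_ac] by auto

text \<open>The second derivative of a solution has this form, linear in \<open>q\<close> with
  continuous coefficients; (a + b|q|)^2 is at most twice the sum of the squares.\<close>

lemma L2_on_affine:
  assumes A: "continuous_on {0..l} A" and B: "continuous_on {0..l} B"
  shows "L2_on {0<..<l} (\<lambda>x. A x + B x * q x)"
proof -
  have sub: "{0<..<l} \<subseteq> {0..l}" by (rule subsetI) simp
  have m: "(\<lambda>x. indicator {0<..<l} x *\<^sub>R u x) \<in> borel_measurable borel" if "continuous_on {0..l} u" for u :: "real \<Rightarrow> complex"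
    by (rule borel_measurable_continuous_on_indicator[OF _ continuous_on_subset[OF that sub]]) simp
  have "(\<lambda>x. indicator {0<..<l} x *\<^sub>R A x + (indicator {0<..<l} x *\<^sub>R B x) * q x) \<in> borel_measurable borel"
    using m[OF A] m[OF B] by measurable
  moreover have "(\<lambda>x. indicator {0<..<l} x *\<^sub>R A x + (indicator {0<..<l} x *\<^sub>R B x) * q x) = (\<lambda>x. indicator {0<..<l} x *\<^sub>R (A x + B x * q x))"
    by (auto simp: indicator_def)
  ultimately have M: "(\<lambda>x. indicator {0<..<l} x *\<^sub>R (A x + B x * q x)) \<in> borel_measurable borel" by simp
  obtain a where a: "\<And>x. x \<in> {0..l} \<Longrightarrow> norm (A x) \<le> a"
    using continuous_on_compact_bound[OF compact_Icc A] by metis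
  obtain b where b: "\<And>x. x \<in> {0..l} \<Longrightarrow> norm (B x) \<le> b"
    using continuous_on_compact_bound[OF compact_Icc B] by metis
  have "integrable lborel (\<lambda>x. indicator {0<..<l} x *\<^sub>R (norm (A x + B x * q x))\<^sup>2)"
  proof (rule Bochner_Integration.integrable_bound)
    show "integrable lborel (\<lambda>x. (2 * a\<^sup>2) * indicator {0..l} x + 2 * b\<^sup>2 * (norm (q x))\<^sup>2)"
      by (intro Bochner_Integration.integrable_add integrable_indicator_Icc integrable_mult_right q_L2)
    have "(\<lambda>x. indicator {0<..<l} x *\<^sub>R (norm (A x + B x * q x))\<^sup>2) = (\<lambda>x. (norm (indicator {0<..<l} x *\<^sub>R (A x + B x * q x)))\<^sup>2)"
      by (auto simp: indicator_def)
    also have "\<dots> \<in> borel_measurable lborel" using M by measurable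
    finally show "(\<lambda>x. indicator {0<..<l} x *\<^sub>R (norm (A x + B x * q x))\<^sup>2) \<in> borel_measurable lborel" .
    show "AE x in lborel. norm (indicator {0<..<l} x *\<^sub>R (norm (A x + B x * q x))\<^sup>2) \<le>
      norm ((2 * a\<^sup>2) * indicator {0..l} x + 2 * b\<^sup>2 * (norm (q x))\<^sup>2)"
    proof (rule AE_I2)
      fix x
      show "norm (indicator {0<..<l} x *\<^sub>R (norm (A x + B x * q x))\<^sup>2) \<le>
        norm ((2 * a\<^sup>2) * indicator {0..l} x + 2 * b\<^sup>2 * (norm (q x))\<^sup>2)"
      proof (cases "x \<in> {0<..<l}")
        case True
        then have x: "x \<in> {0..l}" by auto
        have "norm (A x + B x * q x) \<le> a + b * norm (q x)"
          using norm_triangle_ineq[of "A x" "B x * q x"] a[OF x] mult_right_mono[OF b[OF x] norm_ge_zero[of "q x"]]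
          by (simp add: norm_mult)
        then have "(norm (A x + B x * q x))\<^sup>2 \<le> (a + b * norm (q x))\<^sup>2" by (intro power_mono) auto
        also have "\<dots> \<le> 2 * a\<^sup>2 + 2 * b\<^sup>2 * (norm (q x))\<^sup>2"
          using zero_le_power2[of "a - b * norm (q x)"] by (simp add: power2_eq_square algebra_simps)
        finally show ?thesis using True by simp
      qed simp
    qed
  qed
  then show ?thesis unfolding L2_on_def set_borel_measurable_def set_integrable_def
    using M by (auto intro!: measurable_completion simp: integrable_completion)
qed

text \<open>\<open>w\<close> is the flux f^2 u' with its factor i\<rho> removed, so \<rho> = 0 needs
  no separate case. Then (f^2 u')' = i\<rho> w' = - \<rho>^2 f^2 u, and w(0) = 1 encodes u'(0) =
  i\<rho>.\<close>

lemma is_e_hatI: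
  assumes u: "ac_on 0 l u (\<lambda>x. \<i> * \<rho> * w x / (f x)\<^sup>2)" and w: "ac_on 0 l w (\<lambda>x. \<i> * \<rho> * (f x)\<^sup>2 * u x)"
    and u0: "u 0 = 1" and w0: "w 0 = 1"
  shows "is_e_hat l f \<rho> u"
proof -
  define v where "v = (\<lambda>x. \<i> * \<rho> * w x / (f x)\<^sup>2)"
  define g where "g = (\<lambda>x. \<i> * \<rho> * (\<i> * \<rho> * u x) + (- 2 * \<i> * \<rho> * w x / (f x)\<^sup>2) * q x)"
  have cu: "continuous_on {0..l} u" and cw: "continuous_on {0..l} w"
    using ac_on_continuous[OF u] ac_on_continuous[OF w] .
  have cv: "continuous_on {0..l} v" unfolding v_def
    using f_nz by (intro continuous_intros cw f_cont) auto
  have acv: "ac_on 0 l v g"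
    by (rule ac_on_cong[OF ac_on_cmult[OF ac_on_mult[OF w ac_on_mult[OF inverse_ac inverse_ac]], of "\<i> * \<rho>"]])
      (use f_nz in \<open>auto simp: v_def g_def field_simps power2_eq_square\<close>)
  have acv': "ac_on 0 l (\<lambda>x. (f x)\<^sup>2 * v x) (\<lambda>x. \<i> * \<rho> * (\<i> * \<rho> * (f x)\<^sup>2 * u x))"
    by (rule ac_on_cong[OF ac_on_cmult[OF w, of "\<i> * \<rho>"]]) (use f_nz in \<open>auto simp: v_def\<close>)
  have L2c: "L2_on {0<..<l} a" if "continuous_on {0..l} a" for a
    using L2_on_affine[OF that continuous_on_const[of _ 0]] by simp
  have L2g: "L2_on {0<..<l} g" unfolding g_def
    using f_nz by (intro L2_on_affine continuous_intros cu cw f_cont) auto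
  have wu: "has_weak_partial {0<..<l} 1 u v" 
    using ac_on_has_weak_partial[OF u] l_pos by (simp add: v_def)
  have wv: "has_weak_partial {0<..<l} 1 v g" 
    using ac_on_has_weak_partial[OF acv] l_pos by simp
  have sob: "sobolev 2 {0<..<l} u"
    using L2c[OF cu] L2c[OF cv] L2g wu wv by (auto simp: numeral_2_eq_2)
  have imp: "has_impedance l f u (\<lambda>x. \<rho>\<^sup>2 * u x)"
    unfolding has_impedance_def
  proof (intro exI conjI)
    show "has_weak_partial {0<..<l} 1 u v" by (rule wu)
    show "has_weak_partial {0<..<l} 1 (\<lambda>x. (f x)\<^sup>2 * v x) (\<lambda>x. \<i> * \<rho> * (\<i> * \<rho> * (f x)\<^sup>2 * u x))"
      using ac_on_has_weak_partial[OF acv'] l_pos by simp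
    show "AE x in lebesgue_on {0<..<l}. \<rho>\<^sup>2 * u x = - (1 / (f x)\<^sup>2) * (\<i> * \<rho> * (\<i> * \<rho> * (f x)\<^sup>2 * u x))"
      by (rule AE_I2) (use f_nz in \<open>auto simp: power2_eq_square algebra_simps\<close>)
  qed
  have "((\<lambda>x. integral {0..x} v) has_vector_derivative v 0) (at 0 within {0..l})"
    by (rule integral_has_vector_derivative[OF cv]) (use l_pos in auto)
  then have d: "((\<lambda>x. 1 + integral {0..x} v) has_vector_derivative v 0) (at 0 within {0..l})"
    by (auto intro!: derivative_eq_intros)
  have eq: "1 + integral {0..x} v = u x" if x: "x \<in> {0..l}" for x
  proof -
    have "set_integrable lborel {0..x} v"
      by (rule set_integrable_continuous_Icc[OF continuous_on_subset[OF cv]]) (use x in auto)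
    then have "integral {0..x} v = (LINT s:{0..x}|lborel. v s)"
      by (simp add: set_borel_integral_eq_integral(2))
    also have "\<dots> = u x - u 0" unfolding v_def by (rule ac_on_integral_eq[OF u x])
    finally show ?thesis by (simp add: u0)
  qed
  have "(u has_vector_derivative v 0) (at 0 within {0..l})"
    by (rule has_vector_derivative_transform[OF _ _ d]) (use eq l_pos in auto)
  then have "(u has_vector_derivative (\<i> * \<rho>)) (at 0 within {0..l})"
    by (simp add: v_def f_0 w0)
  then show ?thesis using sob cu imp u0 by (simp add: is_e_hat_def)
qed

end

lemma (in impedance) impedance_inverse: "impedance l (\<lambda>x. - q x) (\<lambda>x. 1 / f x)"
proof unfold_locales
  show "ac_on 0 l (\<lambda>x. 1 / f x) (\<lambda>x. - q x * (1 / f x))" by (rule inverse_ac)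
qed (use l_pos q_zero q_L2 f_nz f_0 in auto)

section \<open>The transmutation kernel as an indefinite integral\<close>

text \<open>In terms of the kernels \<open>K\<close>, \<open>H\<close> of the theorem, \<open>k = f K\<^sub>t\<close> and \<open>h = H\<^sub>t / f\<close>.\<close>

locale kernel_pair = impedance +
  fixes k h :: "real \<times> real \<Rightarrow> complex" and B :: real
  assumes k_borel [measurable]: "k \<in> borel_measurable borel"
    and h_borel [measurable]: "h \<in> borel_measurable borel"
    and B_nonneg: "0 \<le> B"
    and k_bound: "x \<in> {0..l} \<Longrightarrow> \<bar>t\<bar> \<le> x \<Longrightarrow> norm (k (x, t)) \<le> B + norm (q ((x + t) / 2))"
    and h_bound: "x \<in> {0..l} \<Longrightarrow> \<bar>t\<bar> \<le> x \<Longrightarrow> norm (h (x, t)) \<le> B + norm (q ((x + t) / 2))"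
    and k_primitive: "continuous_on (T_set l) (\<lambda>p. LINT \<tau>:{- fst p..snd p}|lborel. k (fst p, \<tau>))"
    and h_primitive: "continuous_on (T_set l) (\<lambda>p. LINT \<tau>:{- fst p..snd p}|lborel. h (fst p, \<tau>))"
    and transform_k: "ac_on 0 l (transform k \<rho>) (\<lambda>x. q x * transform k \<rho> x + \<i> * \<rho> * transform h \<rho> x)"
    and transform_h: "ac_on 0 l (transform h \<rho>) (\<lambda>x. - q x * transform h \<rho> x + \<i> * \<rho> * transform k \<rho> x)"
begin

text \<open>Changing the sign of \<open>q\<close> exchanges the two transform equations, while the
  bounds see only the norm of \<open>q\<close>. So one pair of kernels serves both
  impedances.\<close>

lemma kernel_pair_swap: "kernel_pair l (\<lambda>x. - q x) (\<lambda>x. 1 / f x) h k B"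
proof -
  interpret I: impedance l "\<lambda>x. - q x" "\<lambda>x. 1 / f x" by (rule impedance_inverse)
  show ?thesis
    by unfold_locales (use B_nonneg k_bound h_bound k_primitive h_primitive transform_k transform_h in auto)
qed

definition u :: "complex \<Rightarrow> real \<Rightarrow> complex" where "u \<rho> x = transform k \<rho> x * (1 / f x)"
definition w :: "complex \<Rightarrow> real \<Rightarrow> complex" where "w \<rho> x = transform h \<rho> x * f x"

lemma transform_0: "transform n \<rho> 0 = 1"
proof -
  have "(LINT t:{0..0}|lborel. n (0, t) * exp (\<i> * \<rho> * of_real t)) = 0"
    using AE_lborel_singleton[of 0] unfolding set_lebesgue_integral_def
    by (intro integral_eq_zero_AE) (auto elim: eventually_mono)
  then show ?thesis by (simp add: transform_def)
qed

lemma u_ac: "ac_on 0 l (u \<rho>) (\<lambda>x. \<i> * \<rho> * w \<rho> x / (f x)\<^sup>2)"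
  by (rule ac_on_cong[OF ac_on_mult[OF transform_k inverse_ac]])
    (use f_nz in \<open>auto simp: u_def w_def field_simps power2_eq_square\<close>)

lemma w_ac: "ac_on 0 l (w \<rho>) (\<lambda>x. \<i> * \<rho> * (f x)\<^sup>2 * u \<rho> x)"
  by (rule ac_on_cong[OF ac_on_mult[OF transform_h f_ac]])
    (use f_nz in \<open>auto simp: u_def w_def field_simps power2_eq_square\<close>)

lemma u_is_e_hat: "is_e_hat l f \<rho> (u \<rho>)"
  by (rule is_e_hatI[OF u_ac w_ac]) (simp_all add: u_def w_def transform_0 f_0)

text \<open>At \<rho> = 0 the right-hand side of the first equation vanishes. This is the
  information that fixes the value of the kernel on the diagonal.\<close>

lemma u_zero: "x \<in> {0..l} \<Longrightarrow> u 0 x = 1"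
  using ac_on_integral_eq[OF u_ac, of x 0] by (simp add: u_def transform_0 f_0)

lemma slice_integrable:
  assumes n: "n = k \<or> n = h" and x: "x \<in> {0..l}"
  shows "set_integrable lborel {-x..x} (\<lambda>t. n (x, t))"
    and "(LINT t:{-x..x}|lborel. norm (n (x, t))) \<le> 2 * l * B + 2 * (\<integral>x. norm (q x) \<partial>lborel)"
proof -
  have "n \<in> borel_measurable borel" using n by auto
  from measurable_slice(1)[OF this, of x]
  show "set_integrable lborel {-x..x} (\<lambda>t. n (x, t))"
    "(LINT t:{-x..x}|lborel. norm (n (x, t))) \<le> 2 * l * B + 2 * (\<integral>x. norm (q x) \<partial>lborel)"
    using n x k_bound[of x] h_bound[of x] B_nonneg by (auto intro!: kernel_slice_bound simp: abs_le_iff)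
qed

text \<open>1/f cut off to the interval, so that it is Borel and bounded on the whole line.\<close>

definition finv :: "real \<Rightarrow> complex" where "finv x = indicator {0..l} x *\<^sub>R (1 / f x)"

lemma finv_borel [measurable]: "finv \<in> borel_measurable borel"
  unfolding finv_def by (rule borel_measurable_continuous_on_indicator[OF _ inverse_cont]) simp

lemma finv_eq: "x \<in> {0..l} \<Longrightarrow> finv x = 1 / f x"
  by (simp add: finv_def)

lemma finv_bounded: obtains c where "c \<ge> 0" "\<And>x. norm (finv x) \<le> c"
proof -
  obtain c where "c \<ge> 0" "\<And>x. x \<in> {0..l} \<Longrightarrow> norm (1 / f x) \<le> c"
    using continuous_on_compact_bound[OF compact_Icc inverse_cont] by metis
  then show ?thesis by (intro that[of c]) (auto simp: finv_def indicator_def)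
qed

text \<open>Two representations of the transmutation kernel \<open>K\<close>: as an integral in \<open>t\<close> of its
  \<open>t\<close>-derivative \<open>k / f\<close> and, starting from the boundary value on \<open>x = \<bar>t\<bar>\<close>, as an integral
  in \<open>x\<close> of its \<open>x\<close>-derivative \<open>- h / f\<close>.\<close>

definition K_int_t :: "real \<times> real \<Rightarrow> complex" where
  "K_int_t p = (LINT \<tau>:{- fst p..snd p}|lborel. k (fst p, \<tau>)) * finv (fst p)"

text \<open>Boundary data along x = |t|: the value of \<open>K_int_t\<close> on the edge t = x for t
  \<ge> 0, and its value zero on the edge t = -x for t < 0.\<close>

definition K_bdry :: "real \<Rightarrow> complex" where
  "K_bdry t = indicator {0..l} t *\<^sub>R (1 - 1 / f t)"

definition K_int_x :: "real \<times> real \<Rightarrow> complex" where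
  "K_int_x p = K_bdry (snd p) + (LINT s:{\<bar>snd p\<bar>..fst p}|lborel. - (h (s, snd p) * finv s))"

lemma K_int_t_ac:
  assumes x: "x \<in> {0..l}"
  shows "ac_on (- x) x (\<lambda>t. K_int_t (x, t)) (\<lambda>t. k (x, t) * finv x)"
proof -
  have i: "set_integrable lborel {-x..x} (\<lambda>t. k (x, t))" by (rule slice_integrable(1)[OF _ x]) simp
  have "ac_on (- x) x (\<lambda>t. finv x * (0 + (LINT \<tau>:{-x..t}|lborel. k (x, \<tau>)))) (\<lambda>t. finv x * k (x, t))"
    by (rule ac_on_cmult[OF ac_on_integral[OF i]])
  then show ?thesis by (simp add: K_int_t_def mult.commute)
qed

text \<open>For \<rho> = 0 the transform of \<open>k\<close> equals \<open>f\<close>, so the full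
  integral of \<open>k\<close> over a slice is f(x) - 1.\<close>

lemma K_int_t_bdry:
  assumes x: "x \<in> {0..l}"
  shows "K_int_t (x, x) = 1 - 1 / f x" "K_int_t (x, - x) = 0"
proof -
  have "transform k 0 x = f x" using u_zero[OF x] f_nz[OF x] by (simp add: u_def field_simps)
  then have "(LINT t:{-x..x}|lborel. k (x, t)) = f x - 1" by (simp add: transform_def algebra_simps)
  then show "K_int_t (x, x) = 1 - 1 / f x" using x f_nz[OF x] by (simp add: K_int_t_def finv_eq field_simps)
  have "(LINT \<tau>:{- x..- x}|lborel. k (x, \<tau>)) = 0"
    using AE_lborel_singleton[of "- x"] unfolding set_lebesgue_integral_def
    by (intro integral_eq_zero_AE) (auto elim: eventually_mono)
  then show "K_int_t (x, - x) = 0" by (simp add: K_int_t_def)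
qed

text \<open>Integration by parts moves the factor i\<rho> onto the kernel. The boundary term (1 -
  1/f) e^{i\<rho>x} makes up for the free exponential being divided by \<open>f\<close> in u =
  y/f.\<close>

lemma K_int_t_transform:
  assumes x: "x \<in> {0..l}"
  shows "set_integrable lborel {-x..x} (\<lambda>t. K_int_t (x, t))"
    and "\<i> * \<rho> * (LINT t:{-x..x}|lborel. K_int_t (x, t) * exp (\<i> * \<rho> * of_real t)) = exp (\<i> * \<rho> * of_real x) - u \<rho> x"
proof -
  let ?E = "\<lambda>t. exp (\<i> * \<rho> * complex_of_real t)"
  note ac = K_int_t_ac[OF x]
  show i: "set_integrable lborel {-x..x} (\<lambda>t. K_int_t (x, t))"
    by (rule set_integrable_continuous_Icc[OF ac_on_continuous[OF ac]])
  have ik: "set_integrable lborel {-x..x} (\<lambda>t. k (x, t))" by (rule slice_integrable(1)[OF _ x]) simp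
  have i1: "set_integrable lborel {-x..x} (\<lambda>t. finv x * (k (x, t) * ?E t))"
    by (intro set_integrable_mult_right impI set_integrable_mult_exp ik)
  have i2: "set_integrable lborel {-x..x} (\<lambda>t. \<i> * \<rho> * (K_int_t (x, t) * ?E t))"
    by (intro set_integrable_mult_right impI set_integrable_mult_exp i)
  have "(LINT t:{-x..x}|lborel. k (x, t) * finv x * ?E t + K_int_t (x, t) * (\<i> * \<rho> * ?E t))
     = K_int_t (x, x) * ?E x - K_int_t (x, - x) * ?E (- x)"
    by (rule ac_on_integral_eq[OF ac_on_mult[OF ac ac_on_exp]]) (use x in auto)
  also have "(\<lambda>t. k (x, t) * finv x * ?E t + K_int_t (x, t) * (\<i> * \<rho> * ?E t)) = 
     (\<lambda>t. finv x * (k (x, t) * ?E t) + \<i> * \<rho> * (K_int_t (x, t) * ?E t))"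
    by (simp add: mult_ac)
  also have "(LINT t:{-x..x}|lborel. finv x * (k (x, t) * ?E t) + \<i> * \<rho> * (K_int_t (x, t) * ?E t)) =
    finv x * (LINT t:{-x..x}|lborel. k (x, t) * ?E t) + \<i> * \<rho> * (LINT t:{-x..x}|lborel. K_int_t (x, t) * ?E t)"
    by (simp only: set_integral_add(2)[OF i1 i2] set_integral_mult_right)
  finally have F1: "finv x * (LINT t:{-x..x}|lborel. k (x, t) * ?E t) + \<i> * \<rho> * (LINT t:{-x..x}|lborel. K_int_t (x, t) * ?E t) =
    (1 - 1 / f x) * ?E x" by (simp add: K_int_t_bdry[OF x])
  have F2: "finv x * (LINT t:{-x..x}|lborel. k (x, t) * ?E t) = u \<rho> x - ?E x * (1 / f x)"
    using x by (simp add: u_def transform_def finv_eq algebra_simps add_divide_distrib)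
  have "\<i> * \<rho> * (LINT t:{-x..x}|lborel. K_int_t (x, t) * ?E t) = (1 - 1 / f x) * ?E x - (u \<rho> x - ?E x * (1 / f x))"
    unfolding F2[symmetric] by (rule add_implies_diff[OF trans[OF add.commute F1]])
  also have "\<dots> = ?E x - u \<rho> x" by (simp add: left_diff_distrib)
  finally show "\<i> * \<rho> * (LINT t:{-x..x}|lborel. K_int_t (x, t) * ?E t) = ?E x - u \<rho> x" .
qed

text \<open>Integrating first over |t| \<le> s turns the kernel part into the integral of
  e^{i\<rho>s}/f - w/f^2, and the boundary part adds (1 - 1/f) e^{i\<rho>s}. What remains,
  e^{i\<rho>s} - w/f^2, integrates after multiplication by i\<rho> because u' = i\<rho> w/f^2. The
  last claim is the Fubini by-product that makes the primitive in x meaningful for almost every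
  t.\<close>

lemma K_int_x_transform:
  assumes x: "x \<in> {0..l}"
  shows "set_integrable lborel {-x..x} (\<lambda>t. K_int_x (x, t))"
    and "\<i> * \<rho> * (LINT t:{-x..x}|lborel. K_int_x (x, t) * exp (\<i> * \<rho> * of_real t)) = exp (\<i> * \<rho> * of_real x) - u \<rho> x"
    and "AE t in lborel. t \<in> {-x..x} \<longrightarrow> set_integrable lborel {\<bar>t\<bar>..x} (\<lambda>s. - (h (s, t) * finv s))"
proof -
  define M where "M = 2 * l * B + 2 * (\<integral>x. norm (q x) \<partial>lborel)"
  obtain c where c: "c \<ge> 0" "\<And>x. norm (finv x) \<le> c" using finv_bounded by blast
  define G where "G = (\<lambda>s t. (indicator {0..x} s * indicator {-s..s} t) *\<^sub>R (- (h (s, t) * finv s)))"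
  \<comment> \<open>The triangle |t| \<le> s \<le> x described in the other order of
    integration.\<close>
  have G_eq: "G s t = (indicator {-x..x} t * indicator {\<bar>t\<bar>..x} s) *\<^sub>R (- (h (s, t) * finv s))" for s t
    by (auto simp: G_def indicator_def)
  have hm: "set_integrable lborel {-s..s} (\<lambda>t. - (h (s, t) * finv s))" if "s \<in> {0..x}" for s
    using slice_integrable(1)[of h s] that x set_integrable_mult_left[of "- finv s" lborel "{-s..s}" "\<lambda>t. h (s, t)"] by auto
  have Gm: "case_prod G \<in> borel_measurable (lborel \<Otimes>\<^sub>M lborel)"
  proof -
    have 1: "Measurable.pred (borel \<Otimes>\<^sub>M borel) (\<lambda>p. fst p \<in> {0..x} \<and> snd p \<in> {- fst p..fst p})"
      unfolding atLeastAtMost_iff by measurable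
    have "case_prod G = (\<lambda>p. if fst p \<in> {0..x} \<and> snd p \<in> {- fst p..fst p} then - (h p * finv (fst p)) else 0)"
      by (auto simp: G_def indicator_def fun_eq_iff)
    also have "\<dots> \<in> borel_measurable (borel \<Otimes>\<^sub>M borel)"
    proof (rule measurable_If)
      have "h \<in> borel_measurable (borel \<Otimes>\<^sub>M borel)" by (simp add: borel_prod)
      then show "(\<lambda>p. - (h p * finv (fst p))) \<in> borel_measurable (borel \<Otimes>\<^sub>M borel)" by measurable
    qed (use 1 in \<open>auto simp: pred_def space_pair_measure\<close>)
    finally show ?thesis by (simp add: measurable_lborel1 cong: measurable_cong_sets)
  qed
  have iG1: "integrable lborel (G s)" for s
    using hm[of s] by (cases "s \<in> {0..x}") (simp_all add: G_def set_integrable_def)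
  have iG: "integrable (lborel \<Otimes>\<^sub>M lborel) (case_prod G)"
  proof (rule integrable_pair_of_slices[OF Gm iG1])
    show "integrable lborel (\<lambda>s. (M * c) * indicator {0..x} s)" by (rule integrable_indicator_Icc)
    fix s
    show "(\<integral>t. norm (G s t) \<partial>lborel) \<le> (M * c) * indicator {0..x} s"
    proof (cases "s \<in> {0..x}")
      case True
      have "(\<integral>t. norm (G s t) \<partial>lborel) = (LINT t:{-s..s}|lborel. norm (h (s, t)) * norm (finv s))"
        unfolding set_lebesgue_integral_def
        by (rule Bochner_Integration.integral_cong) (use True in \<open>simp_all add: G_def norm_mult\<close>)
      also have "\<dots> \<le> M * c"
      proof -
        have M: "(LINT t:{-s..s}|lborel. norm (h (s, t))) \<le> M"
          unfolding M_def using slice_integrable(2)[of h s] True x by auto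
        moreover have "0 \<le> (LINT t:{-s..s}|lborel. norm (h (s, t)))"
          unfolding set_lebesgue_integral_def by (rule integral_nonneg_AE) auto
        ultimately show ?thesis
          unfolding set_integral_mult_left by (intro mult_mono c) auto
      qed
      finally show ?thesis using True by simp
    next
      case False
      then show ?thesis by (simp add: G_def)
    qed
  qed
  have inner: "(\<integral>s. G s t \<partial>lborel) = indicator {-x..x} t *\<^sub>R (LINT s:{\<bar>t\<bar>..x}|lborel. - (h (s, t) * finv s))" for t
    unfolding G_eq set_lebesgue_integral_def scaleR_scaleR[symmetric] integral_scaleR_right ..
  have cK: "continuous_on {0..l} (\<lambda>t. 1 - 1 / f t)" by (intro continuous_on_diff continuous_on_const inverse_cont)
  \<comment> \<open>Only t \<ge> 0 contributes, since the edge t = -x carries zero.\<close>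
  have K0_eq: "indicator {-x..x} t *\<^sub>R K_bdry t = indicator {0..x} t *\<^sub>R (1 - 1 / f t)" for t
    using x by (auto simp: K_bdry_def indicator_def)
  have iK0: "set_integrable lborel {-x..x} K_bdry"
    using set_integrable_continuous_Icc[OF continuous_on_subset[OF cK, of "{0..x}"]] x
    unfolding set_integrable_def K0_eq by auto
  have iI: "set_integrable lborel {-x..x} (\<lambda>t. LINT s:{\<bar>t\<bar>..x}|lborel. - (h (s, t) * finv s))"
    using lborel_pair.integrable_snd[OF iG] unfolding inner by (simp add: set_integrable_def)
  show "set_integrable lborel {-x..x} (\<lambda>t. K_int_x (x, t))"
    unfolding K_int_x_def fst_conv snd_conv by (rule set_integral_add(1)[OF iK0 iI])
  show "AE t in lborel. t \<in> {-x..x} \<longrightarrow> set_integrable lborel {\<bar>t\<bar>..x} (\<lambda>s. - (h (s, t) * finv s))"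
    using lborel_pair.AE_integrable_snd[OF iG]
  proof eventually_elim
    case (elim t)
    then show ?case unfolding G_eq set_integrable_def by (auto simp del: scaleR_minus_right)
  qed
  let ?E = "\<lambda>t. exp (\<i> * \<rho> * complex_of_real t)"
  have bE: "continuous_on UNIV ?E" by (intro continuous_intros)
  define GE where "GE = (\<lambda>s t. G s t * ?E t)"
  have GE_z: "GE s t = 0" if "t \<notin> {-l..l}" for s t
    using that x by (auto simp: GE_def G_eq indicator_def)
  have iGE: "integrable (lborel \<Otimes>\<^sub>M lborel) (case_prod GE)"
  proof (rule Bochner_Integration.integrable_bound)
    show "integrable (lborel \<Otimes>\<^sub>M lborel) (\<lambda>p. exp (norm \<rho> * l) * norm (case_prod G p))" 
      using iG by (intro integrable_mult_right integrable_norm)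
    have [measurable]: "?E \<in> borel_measurable borel" by (rule borel_measurable_continuous_onI[OF bE])
    have "case_prod GE = (\<lambda>p. case_prod G p * ?E (snd p))" by (auto simp: GE_def)
    also have "\<dots> \<in> borel_measurable (lborel \<Otimes>\<^sub>M lborel)" using Gm by measurable
    finally show "case_prod GE \<in> borel_measurable (lborel \<Otimes>\<^sub>M lborel)" .
    show "AE p in lborel \<Otimes>\<^sub>M lborel. norm (case_prod GE p) \<le> norm (exp (norm \<rho> * l) * norm (case_prod G p))"
    proof (rule AE_I2, clarsimp)
      fix s t
      show "norm (GE s t) \<le> exp (norm \<rho> * l) * norm (G s t)"
      proof (cases "t \<in> {-l..l}")
        case True
        then have "norm (?E t) \<le> exp (norm \<rho> * l)" by (intro norm_exp_bound) auto
        then show ?thesis unfolding GE_def norm_mult by (subst mult.commute) (rule mult_right_mono, auto)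
      qed (simp add: GE_z)
    qed
  qed
  \<comment> \<open>The slice integral of h e^{i\<rho>t} is z(s) - e^{i\<rho>s}, and z/f =
    w/f^2.\<close>
  have o1: "(\<integral>t. GE s t \<partial>lborel) = indicator {0..x} s *\<^sub>R (?E s * (1 / f s) - w \<rho> s / (f s)\<^sup>2)" for s
  proof (cases "s \<in> {0..x}")
    case True
    then have s: "s \<in> {0..l}" using x by auto
    have "GE s t = (- finv s) * (indicator {-s..s} t *\<^sub>R (h (s, t) * ?E t))" for t
      using True by (simp add: GE_def G_def)
    then have "(\<integral>t. GE s t \<partial>lborel) = (- finv s) * (LINT t:{-s..s}|lborel. h (s, t) * ?E t)"
      unfolding set_lebesgue_integral_def by (simp only: integral_mult_right_zero)
    also have "\<dots> = ?E s * (1 / f s) - w \<rho> s / (f s)\<^sup>2"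
      using f_nz[OF s] s by (simp add: w_def transform_def finv_eq field_simps power2_eq_square)
    finally show ?thesis using True by simp
  next
    case False
    then show ?thesis by (simp add: GE_def G_def)
  qed
  have o2: "(\<integral>s. GE s t \<partial>lborel) = indicator {-x..x} t *\<^sub>R ((LINT s:{\<bar>t\<bar>..x}|lborel. - (h (s, t) * finv s)) * ?E t)" for t
    unfolding GE_def integral_mult_left_zero inner by (simp add: scaleR_conv_of_real)
  have sub: "{0..x} \<subseteq> {0..l}" using x by auto
  have cw: "continuous_on {0..x} (w \<rho>)" by (rule continuous_on_subset[OF ac_on_continuous[OF w_ac] sub])
  have cf: "continuous_on {0..x} f" by (rule continuous_on_subset[OF f_cont sub])
  have nz: "\<forall>s\<in>{0..x}. f s \<noteq> 0" using f_nz sub by auto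
  have j1: "set_integrable lborel {0..x} (\<lambda>s. ?E s * (1 / f s) - w \<rho> s / (f s)\<^sup>2)"
    and j2: "set_integrable lborel {0..x} (\<lambda>t. (1 - 1 / f t) * ?E t)"
    and j3: "set_integrable lborel {0..x} (\<lambda>t. w \<rho> t / (f t)\<^sup>2)"
    and j4: "set_integrable lborel {0..x} ?E"
    using nz by (auto intro!: set_integrable_continuous_Icc continuous_intros cw cf)
  have "(LINT t:{-x..x}|lborel. K_int_x (x, t) * ?E t) = 
     (LINT t:{-x..x}|lborel. K_bdry t * ?E t + (LINT s:{\<bar>t\<bar>..x}|lborel. - (h (s, t) * finv s)) * ?E t)"
    by (simp add: K_int_x_def distrib_right)
  also have "\<dots> = (LINT t:{-x..x}|lborel. K_bdry t * ?E t) + (LINT t:{-x..x}|lborel. (LINT s:{\<bar>t\<bar>..x}|lborel. - (h (s, t) * finv s)) * ?E t)"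
    by (intro set_integral_add(2) set_integrable_mult_exp iK0 iI)
  also have "(LINT t:{-x..x}|lborel. (LINT s:{\<bar>t\<bar>..x}|lborel. - (h (s, t) * finv s)) * ?E t) = (LINT s:{0..x}|lborel. ?E s * (1 / f s) - w \<rho> s / (f s)\<^sup>2)"
    using lborel_pair.Fubini_integral[OF iGE] unfolding o1 o2 by (simp only: set_lebesgue_integral_def)
  also have "(LINT t:{-x..x}|lborel. K_bdry t * ?E t) = (LINT t:{0..x}|lborel. (1 - 1 / f t) * ?E t)"
    unfolding set_lebesgue_integral_def mult_scaleR_left[symmetric] K0_eq ..
  also have "\<dots> + (LINT s:{0..x}|lborel. ?E s * (1 / f s) - w \<rho> s / (f s)\<^sup>2) = 
      (LINT t:{0..x}|lborel. (1 - 1 / f t) * ?E t + (?E t * (1 / f t) - w \<rho> t / (f t)\<^sup>2))"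
    by (rule set_integral_add(2)[OF j2 j1, symmetric])
  also have "\<dots> = (LINT t:{0..x}|lborel. ?E t - w \<rho> t / (f t)\<^sup>2)"
    by (simp add: algebra_simps)
  also have "\<dots> = (LINT t:{0..x}|lborel. ?E t) - (LINT t:{0..x}|lborel. w \<rho> t / (f t)\<^sup>2)"
    by (rule set_integral_diff(2)[OF j4 j3])
  finally have main: "(LINT t:{-x..x}|lborel. K_int_x (x, t) * ?E t) = (LINT t:{0..x}|lborel. ?E t) - (LINT t:{0..x}|lborel. w \<rho> t / (f t)\<^sup>2)" .
  have "\<i> * \<rho> * (LINT t:{0..x}|lborel. ?E t) = ?E x - 1"
    using ac_on_integral_eq[OF ac_on_exp[of 0 l \<rho>] x] by simp
  moreover have "\<i> * \<rho> * (LINT t:{0..x}|lborel. w \<rho> t / (f t)\<^sup>2) = u \<rho> x - 1"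
  proof -
    have "(LINT t:{0..x}|lborel. \<i> * \<rho> * w \<rho> t / (f t)\<^sup>2) = u \<rho> x - 1"
      using ac_on_integral_eq[OF u_ac x] by (simp add: u_def transform_0 f_0)
    then show ?thesis by (simp only: times_divide_eq_right[symmetric] set_integral_mult_right)
  qed
  ultimately show "\<i> * \<rho> * (LINT t:{-x..x}|lborel. K_int_x (x, t) * ?E t) = ?E x - u \<rho> x"
    unfolding main by (simp add: right_diff_distrib)
qed

text \<open>\<open>u \<rho>\<close> is a solution, so the definition of the kernel gives K(x, .) the
  same transform as \<open>g\<close>, both multiplied by i\<rho>. For \<rho> \<noteq> 0 that factor
  cancels, and nonzero exponents are all that the moment argument uses.\<close>

lemma slice_unique:
  assumes x: "x \<in> {0<..l}" and K: "is_K_hat l f K"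
    and g: "set_integrable lborel {-x..x} g"
    and eq: "\<And>\<rho>. \<i> * \<rho> * (LINT t:{-x..x}|lborel. g t * exp (\<i> * \<rho> * of_real t)) = exp (\<i> * \<rho> * of_real x) - u \<rho> x"
  shows "AE t in lebesgue. t \<in> {-x..x} \<longrightarrow> K (x, t) = g t"
proof -
  have "set_integrable lebesgue {-x<..<x} (\<lambda>t. K (x, t))"
    using K x by (intro L2_on_imp_set_integrable) (auto simp: is_K_hat_def)
  then have iK: "set_integrable lebesgue {-x..x} (\<lambda>t. K (x, t))"
    by (simp add: set_integrable_lebesgue_open_closed)
  have gl: "set_integrable lebesgue {-x..x} g"
    using g set_integral_lebesgue_eq_lborel(2)[OF set_borel_measurable_of_integrable[OF g]] by simp
  let ?E = "\<lambda>\<rho> t. exp (\<i> * \<rho> * complex_of_real t)"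
  have mE: "set_integrable lebesgue {-x..x} (\<lambda>t. v t * ?E \<rho> t)" if v: "set_integrable lebesgue {-x..x} v" for v \<rho>
  proof (rule set_integrable_bound[of _ _ "\<lambda>t. norm (v t) * exp (norm \<rho> * x)"])
    show "set_integrable lebesgue {-x..x} (\<lambda>t. norm (v t) * exp (norm \<rho> * x))"
      using set_integrable_norm[OF v] by simp
    have "(\<lambda>t. (indicator {-x..x} t *\<^sub>R v t) * ?E \<rho> t) \<in> borel_measurable lebesgue"
    proof (rule borel_measurable_times)
      show "(\<lambda>t. indicator {-x..x} t *\<^sub>R v t) \<in> borel_measurable lebesgue"
        using v by (auto simp: set_integrable_def)
      show "?E \<rho> \<in> borel_measurable lebesgue"
      proof -
        have "?E \<rho> \<in> borel_measurable borel" by (intro borel_measurable_continuous_onI continuous_intros)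
        then show ?thesis by (intro measurable_completion) simp
      qed
    qed
    then show "set_borel_measurable lebesgue {-x..x} (\<lambda>t. v t * ?E \<rho> t)"
      by (simp add: set_borel_measurable_def)
    show "AE t in lebesgue. t \<in> {-x..x} \<longrightarrow> norm (v t * ?E \<rho> t) \<le> norm (norm (v t) * exp (norm \<rho> * x))"
    proof (intro AE_I2 impI)
      fix t assume "t \<in> {-x..x}"
      then have "norm (?E \<rho> t) \<le> exp (norm \<rho> * x)" by (intro norm_exp_bound) auto
      then show "norm (v t * ?E \<rho> t) \<le> norm (norm (v t) * exp (norm \<rho> * x))"
        by (simp add: norm_mult abs_mult mult_left_mono del: norm_exp_eq_Re)
    qed
  qed
  define G where "G = (\<lambda>t. indicator {-x..x} t *\<^sub>R (K (x, t) - g t))"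
  have "AE t in lebesgue. G t = 0"
  proof (rule exponential_moments_zero_imp_AE_zero)
    show "integrable lebesgue G"
      using set_integral_diff(1)[OF iK gl] by (simp add: G_def set_integrable_def)
    show "G t = 0" if "t \<notin> {-x..x}" for t using that by (simp add: G_def)
    fix \<rho> :: complex assume \<rho>: "\<rho> \<noteq> 0"
    have g': "set_integrable lborel {-x..x} (\<lambda>t. g t * ?E \<rho> t)" by (rule set_integrable_mult_exp[OF g])
    have "(LINT t:{-x..x}|lebesgue. g t * ?E \<rho> t) = (LINT t:{-x..x}|lborel. g t * ?E \<rho> t)"
      by (rule set_integral_lebesgue_eq_lborel(1)[OF set_borel_measurable_of_integrable[OF g']])
    then have "\<i> * \<rho> * (LINT t:{-x..x}|lebesgue. g t * ?E \<rho> t) = ?E \<rho> x - u \<rho> x" using eq by simp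
    moreover have "u \<rho> x = ?E \<rho> x - \<i> * \<rho> * (LINT t:{-x..x}|lebesgue. K (x, t) * ?E \<rho> t)"
      using K u_is_e_hat[of \<rho>] x unfolding is_K_hat_def by blast
    then have "\<i> * \<rho> * (LINT t:{-x..x}|lebesgue. K (x, t) * ?E \<rho> t) = ?E \<rho> x - u \<rho> x"
      by (simp only: diff_diff_eq2) simp
    ultimately have "\<i> * \<rho> * (LINT t:{-x..x}|lebesgue. K (x, t) * ?E \<rho> t) = \<i> * \<rho> * (LINT t:{-x..x}|lebesgue. g t * ?E \<rho> t)"
      by simp
    then have "(LINT t:{-x..x}|lebesgue. K (x, t) * ?E \<rho> t) = (LINT t:{-x..x}|lebesgue. g t * ?E \<rho> t)"
      using \<rho> by simp
    then have "(LINT t:{-x..x}|lebesgue. K (x, t) * ?E \<rho> t - g t * ?E \<rho> t) = 0"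
      by (simp add: set_integral_diff(2)[OF mE[OF iK] mE[OF gl]])
    then show "(\<integral>t. G t * ?E \<rho> t \<partial>lebesgue) = 0"
      by (simp add: G_def set_lebesgue_integral_def left_diff_distrib)
  qed
  then show ?thesis by eventually_elim (auto simp: G_def)
qed

end

section \<open>Weak derivatives on the triangle\<close>

lemma interior_T_set: "interior (T_set l) = {(x, t). 0 < x \<and> x < l \<and> \<bar>t\<bar> < x}" (is "_ = ?O")
proof
  have "?O = {p. 0 < fst p \<and> fst p < l \<and> \<bar>snd p\<bar> < fst p}" by auto
  also have "open \<dots>" by (intro open_Collect_conj open_Collect_less continuous_intros)
  finally show "?O \<subseteq> interior (T_set l)"
    by (intro interior_maximal) (auto simp: T_set_def)
  show "interior (T_set l) \<subseteq> ?O"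
  proof
    fix p assume "p \<in> interior (T_set l)"
    then obtain e where e: "e > 0" "ball p e \<subseteq> T_set l" by (auto simp: mem_interior)
    obtain x t where p: "p = (x, t)" by (cases p)
    have "(x + e / 2, t) \<in> ball p e" "(x - e / 2, t) \<in> ball p e"
      using e(1) by (auto simp: p dist_Pair_Pair dist_real_def)
    then have "(x + e / 2, t) \<in> T_set l" "(x - e / 2, t) \<in> T_set l" using e by auto
    then show "p \<in> ?O" using e(1) by (auto simp: T_set_def p)
  qed
qed

text \<open>\<open>P\<close> is only Lebesgue measurable, so the slices of its non-zero set need not
  be measurable. Tonelli is therefore applied to a Borel subset of the same measure.\<close>

lemma AE_lebesgue_of_slices:
  fixes P :: "real \<times> real \<Rightarrow> complex"
  assumes P: "P \<in> borel_measurable lebesgue" and s: "\<And>x. AE t in lebesgue. P (x, t) = 0"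
  shows "AE p in lebesgue. P p = 0"
proof -
  define N where "N = {p. P p \<noteq> 0}"
  have N: "N \<in> sets lebesgue" 
    using measurable_sets[OF P, of "- {0}"] by (simp add: N_def vimage_def)
  \<comment> \<open>The Borel part of \<open>N\<close>; what is left of \<open>N\<close> lies in a
    null set.\<close>
  define M where "M = main_part lborel N"
  have M: "M \<in> sets lborel" "M \<subseteq> N" 
    using main_part_sets[of N lborel, OF N] main_part_null_part_Un[of N lborel, OF N] unfolding M_def by blast+
  have M2: "M \<in> sets (lborel \<Otimes>\<^sub>M lborel)" unfolding lborel_prod by (rule M(1))
  have "emeasure lborel M = emeasure (lborel \<Otimes>\<^sub>M lborel) M" by (simp add: lborel_prod)
  also have "\<dots> = (\<integral>\<^sup>+x. emeasure lborel (Pair x -` M) \<partial>lborel)"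
    by (rule lborel.emeasure_pair_measure_alt[OF M2])
  also have "\<dots> = (\<integral>\<^sup>+x. 0 \<partial>(lborel::real measure))"
  proof (rule nn_integral_cong)
    fix x
    have "AE t in lborel. P (x, t) = 0" using s[of x] by (simp add: AE_completion_iff)
    then have "AE t in lborel. t \<notin> Pair x -` M" by eventually_elim (use M in \<open>auto simp: N_def\<close>)
    moreover have "Pair x -` M \<in> sets lborel"
      by (rule sets_Pair1[OF M2])
    ultimately show "emeasure lborel (Pair x -` M) = 0"
      by (subst (asm) AE_iff_measurable[of "Pair x -` M"]) auto
  qed
  finally have "emeasure lborel M = 0" by simp
  then have "emeasure lebesgue N = 0"
    using N by (simp add: emeasure_completion M_def)
  then have "N \<in> null_sets lebesgue" using N by (auto simp: null_sets_def)
  then show ?thesis by (rule AE_I') (auto simp: N_def)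
qed

text \<open>Restricted to a line parallel to an axis, a test function is C^1 with the partial
  derivative as its derivative, so the one-dimensional integration by parts applies slice by
  slice.\<close>

lemma test_function_prod_derivative:
  fixes \<phi> :: "real \<times> real \<Rightarrow> real"
  assumes "test_function \<Omega> \<phi>"
  shows "((\<lambda>t. \<phi> (x, t)) has_real_derivative frechet_derivative \<phi> (at (x, t)) (0, 1)) (at t)"
    and "((\<lambda>x. \<phi> (x, t)) has_real_derivative frechet_derivative \<phi> (at (x, t)) (1, 0)) (at x)"
    and "i \<in> Basis \<Longrightarrow> continuous_on UNIV (\<lambda>p. frechet_derivative \<phi> (at p) i)"
    and "continuous_on UNIV \<phi>"
proof -
  have C: "C_k (Suc 0) \<phi>" "C_k 0 \<phi>" using assms unfolding test_function_def by blast+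
  have d: "(\<phi> has_derivative frechet_derivative \<phi> (at p)) (at p)" for p
  proof -
    have "\<forall>p. \<phi> differentiable at p" using C(1) unfolding C_k.simps by blast
    then show ?thesis using frechet_derivative_works by blast
  qed
  have lin: "linear (frechet_derivative \<phi> (at p))" for p
    using has_derivative_linear[OF d] .
  have "((\<lambda>t. (x, t)) has_derivative (\<lambda>h. (0, h))) (at t)" by (auto intro!: derivative_eq_intros)
  from diff_chain_at[OF this d] 
  have 1: "((\<lambda>t. \<phi> (x, t)) has_derivative (\<lambda>h. frechet_derivative \<phi> (at (x, t)) (0, h))) (at t)" by (simp add: o_def)
  have "(\<lambda>h. frechet_derivative \<phi> (at (x, t)) (0, h)) = (*) (frechet_derivative \<phi> (at (x, t)) (0, 1))"
  proof
    fix h show "frechet_derivative \<phi> (at (x, t)) (0, h) = frechet_derivative \<phi> (at (x, t)) (0, 1) * h"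
      using linear_scale[OF lin, of "(x, t)" h "(0, 1)"] by (simp add: mult.commute)
  qed
  with 1 show "((\<lambda>t. \<phi> (x, t)) has_real_derivative frechet_derivative \<phi> (at (x, t)) (0, 1)) (at t)"
    unfolding has_field_derivative_def by (simp only:)
  have "((\<lambda>x. (x, t)) has_derivative (\<lambda>h. (h, 0))) (at x)" by (auto intro!: derivative_eq_intros)
  from diff_chain_at[OF this d] 
  have 2: "((\<lambda>x. \<phi> (x, t)) has_derivative (\<lambda>h. frechet_derivative \<phi> (at (x, t)) (h, 0))) (at x)" by (simp add: o_def)
  have "(\<lambda>h. frechet_derivative \<phi> (at (x, t)) (h, 0)) = (*) (frechet_derivative \<phi> (at (x, t)) (1, 0))"
  proof
    fix h show "frechet_derivative \<phi> (at (x, t)) (h, 0) = frechet_derivative \<phi> (at (x, t)) (1, 0) * h"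
      using linear_scale[OF lin, of "(x, t)" h "(1, 0)"] by (simp add: mult.commute)
  qed
  with 2 show "((\<lambda>x. \<phi> (x, t)) has_real_derivative frechet_derivative \<phi> (at (x, t)) (1, 0)) (at x)"
    unfolding has_field_derivative_def by (simp only:)
  show "i \<in> Basis \<Longrightarrow> continuous_on UNIV (\<lambda>p. frechet_derivative \<phi> (at p) i)" "continuous_on UNIV \<phi>"
    using C by auto
qed

lemma L2_on_imp_locally_integrable:
  assumes "L2_on \<Omega> v" "\<Omega> \<in> lmeasurable"
  shows "locally_integrable \<Omega> v"
  unfolding locally_integrable_def
proof (intro allI impI)
  fix C :: "'a set" assume C: "compact C \<and> C \<subseteq> \<Omega>"
  then have "C \<in> sets lebesgue" by (intro fmeasurableD lmeasurable_compact) simp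
  then show "v absolutely_integrable_on C"
    by (rule set_integrable_subset[OF L2_on_imp_set_integrable[OF assms]]) (use C in simp)
qed

lemma L2_on_subset:
  assumes "L2_on T v" "\<Omega> \<subseteq> T" "\<Omega> \<in> sets lebesgue"
  shows "L2_on \<Omega> v"
proof -
  have "(\<lambda>x. indicator \<Omega> x *\<^sub>R (indicator T x *\<^sub>R v x)) \<in> borel_measurable lebesgue"
    using assms by (intro borel_measurable_scaleR[of "indicator \<Omega>"]) (simp_all add: L2_on_def set_borel_measurable_def)
  moreover have "(\<lambda>x. indicator \<Omega> x *\<^sub>R (indicator T x *\<^sub>R v x)) = (\<lambda>x. indicator \<Omega> x *\<^sub>R v x)"
    using assms(2) by (auto simp: fun_eq_iff split: split_indicator)
  ultimately show ?thesis
    using assms by (auto simp: L2_on_def set_borel_measurable_def intro: set_integrable_subset)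
qed

text \<open>Passes from \<open>v\<close>, known only up to null sets, to a Borel version for which
  iterated integrals are available. The test factor is bounded because the triangle is
  compact.\<close>

lemma test_integral_lborel:
  fixes v V :: "real \<times> real \<Rightarrow> complex" and \<psi> :: "real \<times> real \<Rightarrow> real"
  assumes v: "L2_on \<Omega> v" and O: "\<Omega> \<in> sets borel" "\<Omega> \<subseteq> T_set l"
    and V: "V \<in> borel_measurable borel" "AE p in lebesgue. p \<in> \<Omega> \<longrightarrow> v p = V p"
    and \<psi>: "continuous_on UNIV \<psi>"
  shows "integrable (lborel \<Otimes>\<^sub>M lborel) (\<lambda>p. indicator \<Omega> p *\<^sub>R (\<psi> p *\<^sub>R V p))"
    and "(LINT p:\<Omega>|lebesgue. \<psi> p *\<^sub>R v p) = (\<integral>p. indicator \<Omega> p *\<^sub>R (\<psi> p *\<^sub>R V p) \<partial>(lborel \<Otimes>\<^sub>M lborel))"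
proof -
  obtain C where C: "\<And>p. p \<in> T_set l \<Longrightarrow> norm (\<psi> p) \<le> C"
    using continuous_on_compact_bound[OF compact_T_set continuous_on_subset[OF \<psi> subset_UNIV]] by metis
  have Om: "\<Omega> \<in> lmeasurable"
    using O by (intro fmeasurableI2[OF lmeasurable_compact[OF compact_T_set[of l]]]) auto
  have [measurable]: "\<psi> \<in> borel_measurable borel" using \<psi> by (rule borel_measurable_continuous_onI)
  have \<psi>l: "\<psi> \<in> borel_measurable lebesgue" by (intro measurable_completion) simp
  have iv: "integrable lebesgue (\<lambda>p. indicator \<Omega> p *\<^sub>R v p)"
    using L2_on_imp_set_integrable[OF v Om] by (simp add: set_integrable_def)
  have i\<psi>: "integrable lebesgue (\<lambda>p. \<psi> p *\<^sub>R (indicator \<Omega> p *\<^sub>R v p))"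
  proof (rule Bochner_Integration.integrable_bound)
    show "integrable lebesgue (\<lambda>p. C * norm (indicator \<Omega> p *\<^sub>R v p))"
      using iv by (intro integrable_mult_right integrable_norm)
    show "(\<lambda>p. \<psi> p *\<^sub>R (indicator \<Omega> p *\<^sub>R v p)) \<in> borel_measurable lebesgue"
      using iv by (intro borel_measurable_scaleR[OF \<psi>l]) auto
    show "AE p in lebesgue. norm (\<psi> p *\<^sub>R (indicator \<Omega> p *\<^sub>R v p)) \<le> norm (C * norm (indicator \<Omega> p *\<^sub>R v p))"
    proof (rule AE_I2)
      fix p show "norm (\<psi> p *\<^sub>R (indicator \<Omega> p *\<^sub>R v p)) \<le> norm (C * norm (indicator \<Omega> p *\<^sub>R v p))"
        using O order_trans[OF C[of p] abs_ge_self] by (auto simp: indicator_def abs_mult intro!: mult_right_mono)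
    qed
  qed
  have Vm: "(\<lambda>p. indicator \<Omega> p *\<^sub>R (\<psi> p *\<^sub>R V p)) \<in> borel_measurable lborel"
    using O V(1) by measurable
  have ae: "AE p in lebesgue. \<psi> p *\<^sub>R (indicator \<Omega> p *\<^sub>R v p) = indicator \<Omega> p *\<^sub>R (\<psi> p *\<^sub>R V p)"
    using V(2) by eventually_elim (auto simp: indicator_def)
  have "integrable lebesgue (\<lambda>p. indicator \<Omega> p *\<^sub>R (\<psi> p *\<^sub>R V p))"
    by (rule integrable_cong_AE_imp[OF i\<psi> measurable_completion[OF Vm] ae])
  then show "integrable (lborel \<Otimes>\<^sub>M lborel) (\<lambda>p. indicator \<Omega> p *\<^sub>R (\<psi> p *\<^sub>R V p))"
    using integrable_completion[OF Vm] by (simp add: lborel_prod)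
  have "(LINT p:\<Omega>|lebesgue. \<psi> p *\<^sub>R v p) = (\<integral>p. \<psi> p *\<^sub>R (indicator \<Omega> p *\<^sub>R v p) \<partial>lebesgue)"
    by (simp add: set_lebesgue_integral_def mult.commute)
  also have "\<dots> = (\<integral>p. indicator \<Omega> p *\<^sub>R (\<psi> p *\<^sub>R V p) \<partial>lebesgue)"
    by (rule integral_cong_AE[OF borel_measurable_integrable[OF i\<psi>] measurable_completion[OF Vm] ae])
  also have "\<dots> = (\<integral>p. indicator \<Omega> p *\<^sub>R (\<psi> p *\<^sub>R V p) \<partial>lborel)"
    by (rule integral_completion[OF Vm])
  finally show "(LINT p:\<Omega>|lebesgue. \<psi> p *\<^sub>R v p) = (\<integral>p. indicator \<Omega> p *\<^sub>R (\<psi> p *\<^sub>R V p) \<partial>(lborel \<Otimes>\<^sub>M lborel))"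
    by (simp add: lborel_prod)
qed

context kernel_pair
begin

lemma K_int_t_borel: "K_int_t \<in> borel_measurable borel"
proof -
  have [measurable]: "k \<in> borel_measurable (borel \<Otimes>\<^sub>M borel)" by (simp add: borel_prod)
  have "(\<lambda>p. \<integral>\<tau>. (if - fst p \<le> \<tau> \<and> \<tau> \<le> snd p then k (fst p, \<tau>) else 0) \<partial>lborel) \<in> borel_measurable (borel \<Otimes>\<^sub>M borel)"
    by measurable
  also have "(\<lambda>p. \<integral>\<tau>. (if - fst p \<le> \<tau> \<and> \<tau> \<le> snd p then k (fst p, \<tau>) else 0) \<partial>lborel) = (\<lambda>p. LINT \<tau>:{- fst p..snd p}|lborel. k (fst p, \<tau>))"
    unfolding set_lebesgue_integral_def by (intro ext Bochner_Integration.integral_cong) auto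
  finally have [measurable]: "(\<lambda>p. LINT \<tau>:{- fst p..snd p}|lborel. k (fst p, \<tau>)) \<in> borel_measurable (borel \<Otimes>\<^sub>M borel)" .
  have "K_int_t \<in> borel_measurable (borel \<Otimes>\<^sub>M borel)" unfolding K_int_t_def by measurable
  then show ?thesis by (simp add: borel_prod)
qed

lemma K_int_x_borel: "K_int_x \<in> borel_measurable borel"
proof -
  have [measurable]: "h \<in> borel_measurable (borel \<Otimes>\<^sub>M borel)" by (simp add: borel_prod)
  have [measurable]: "K_bdry \<in> borel_measurable borel"
    unfolding K_bdry_def
    by (rule borel_measurable_continuous_on_indicator[OF _ continuous_on_diff[OF continuous_on_const inverse_cont]]) simp
  have "(\<lambda>p. \<integral>s. (if \<bar>snd p\<bar> \<le> s \<and> s \<le> fst p then - (h (s, snd p) * finv s) else 0) \<partial>lborel) \<in> borel_measurable (borel \<Otimes>\<^sub>M borel)"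
    by measurable
  also have "(\<lambda>p. \<integral>s. (if \<bar>snd p\<bar> \<le> s \<and> s \<le> fst p then - (h (s, snd p) * finv s) else 0) \<partial>lborel) = (\<lambda>p. LINT s:{\<bar>snd p\<bar>..fst p}|lborel. - (h (s, snd p) * finv s))"
    unfolding set_lebesgue_integral_def by (intro ext Bochner_Integration.integral_cong) auto
  finally have [measurable]: "(\<lambda>p. LINT s:{\<bar>snd p\<bar>..fst p}|lborel. - (h (s, snd p) * finv s)) \<in> borel_measurable (borel \<Otimes>\<^sub>M borel)" .
  have "K_int_x \<in> borel_measurable (borel \<Otimes>\<^sub>M borel)" unfolding K_int_x_def by measurable
  then show ?thesis by (simp add: borel_prod)
qed

lemma T_set_borel: "T_set l \<in> sets borel"
  using compact_T_set by (intro borel_compact)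

lemma T_set_lmeasurable: "T_set l \<in> lmeasurable"
  by (rule lmeasurable_compact[OF compact_T_set])

text \<open>Equality on almost every point of each slice becomes equality almost everywhere because
  joint measurability of \<open>K\<close> is part of \<open>is_K_hat\<close>.\<close>

lemma K_eq_of_slices:
  assumes K: "is_K_hat l f K" and g: "g \<in> borel_measurable borel"
    and s: "\<And>x. x \<in> {0<..l} \<Longrightarrow> AE t in lebesgue. t \<in> {-x..x} \<longrightarrow> K (x, t) = g (x, t)"
  shows "AE p in lebesgue. p \<in> T_set l \<longrightarrow> K p = g p"
proof -
  define P where "P = (\<lambda>p. indicator (T_set l) p *\<^sub>R K p - indicator (T_set l) p *\<^sub>R g p)"
  have "AE p in lebesgue. P p = 0"
  proof (rule AE_lebesgue_of_slices)
    have "(\<lambda>p. indicator (T_set l) p *\<^sub>R g p) \<in> borel_measurable borel" using g T_set_borel by measurable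
    then have "(\<lambda>p. indicator (T_set l) p *\<^sub>R g p) \<in> borel_measurable lebesgue" by (intro measurable_completion) simp
    moreover have "(\<lambda>p. indicator (T_set l) p *\<^sub>R K p) \<in> borel_measurable lebesgue"
      using K by (simp add: is_K_hat_def L2_on_def set_borel_measurable_def)
    ultimately show "P \<in> borel_measurable lebesgue" unfolding P_def by (intro borel_measurable_diff)
    fix x
    show "AE t in lebesgue. P (x, t) = 0"
    proof (cases "x \<in> {0<..l}")
      case True
      from s[OF this] show ?thesis by eventually_elim (auto simp: P_def indicator_def T_set_def abs_le_iff)
    next
      case False
      \<comment> \<open>The remaining slices are empty, except the one at x = 0, which is a single
        point.\<close>
      have "AE t in lborel. t \<noteq> (0 :: real)" by (rule AE_lborel_singleton)
      then have "AE t in lebesgue. t \<noteq> (0 :: real)" by (rule AE_completion)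
      then show ?thesis by eventually_elim (use False in \<open>auto simp: P_def indicator_def T_set_def\<close>)
    qed
  qed
  then show ?thesis by eventually_elim (auto simp: P_def)
qed

text \<open>The two primitives are never compared directly: each has the transform that determines
  the slices of \<open>K\<close>.\<close>

lemma
  assumes K: "is_K_hat l f K"
  shows K_eq_int_t: "AE p in lebesgue. p \<in> T_set l \<longrightarrow> K p = K_int_t p"
    and K_eq_int_x: "AE p in lebesgue. p \<in> T_set l \<longrightarrow> K p = K_int_x p"
  by (rule K_eq_of_slices[OF K K_int_t_borel] K_eq_of_slices[OF K K_int_x_borel];
      rule slice_unique[OF _ K K_int_t_transform] slice_unique[OF _ K K_int_x_transform(1,2)]; simp)+

lemma K_int_t_continuous: "continuous_on (T_set l) K_int_t"
proof -
  have "continuous_on (T_set l) (\<lambda>p. 1 / f (fst p))"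
    by (rule continuous_on_compose2[OF inverse_cont]) (auto intro!: continuous_intros simp: T_set_def)
  then have "continuous_on (T_set l) (\<lambda>p. (LINT \<tau>:{- fst p..snd p}|lborel. k (fst p, \<tau>)) * (1 / f (fst p)))"
    by (intro continuous_on_mult k_primitive)
  then show ?thesis
    by (rule continuous_on_eq) (auto simp: K_int_t_def finv_eq T_set_def)
qed

text \<open>The integral over t of |q((x + t)/2)|^2 is twice that of |q|^2, whatever x is, so the
  square of the kernel bound is integrable over the triangle.\<close>

lemma L2_on_kernel:
  assumes n: "n = k \<or> n = h"
  shows "L2_on (T_set l) (\<lambda>p. n p * finv (fst p))"
proof -
  obtain c where c: "c \<ge> 0" "\<And>x. norm (finv x) \<le> c" using finv_bounded by blast
  have [measurable]: "n \<in> borel_measurable (borel \<Otimes>\<^sub>M borel)" using n by (auto simp: borel_prod)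
  have [measurable]: "T_set l \<in> sets (borel \<Otimes>\<^sub>M borel)" unfolding borel_prod by (rule T_set_borel)
  have m: "(\<lambda>p. indicator (T_set l) p *\<^sub>R (n p * finv (fst p))) \<in> borel_measurable (borel \<Otimes>\<^sub>M borel)" by measurable
  then have m': "(\<lambda>p. indicator (T_set l) p *\<^sub>R (n p * finv (fst p))) \<in> borel_measurable borel" by (simp add: borel_prod)
  define W where "W = (\<lambda>x t. indicator {0..l} x * (2 * B\<^sup>2 * indicator {-l..l} t + 2 * (norm (q ((x + t) / 2)))\<^sup>2))"
  have i1: "integrable lborel (\<lambda>t. (norm (q ((x + t) / 2)))\<^sup>2)" for x
    using lborel_integrable_real_affine[OF q_L2, of "1/2" "x/2"] by (simp add: add_divide_distrib)
  have e1: "(\<integral>t. (norm (q ((x + t) / 2)))\<^sup>2 \<partial>lborel) = 2 * (\<integral>t. (norm (q t))\<^sup>2 \<partial>lborel)" for x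
    using lborel_integral_real_affine[of "1/2" "\<lambda>t. (norm (q t))\<^sup>2" "x/2"] by (simp add: add_divide_distrib)
  have iW: "integrable lborel (W x)" for x
    unfolding W_def by (intro integrable_mult_right Bochner_Integration.integrable_add integrable_indicator_Icc i1)
  have W0: "W x t \<ge> 0" for x t by (auto simp: W_def indicator_def)
  have IW: "(\<integral>t. norm (W x t) \<partial>lborel) = (4 * l * B\<^sup>2 + 4 * (\<integral>t. (norm (q t))\<^sup>2 \<partial>lborel)) * indicator {0..l} x" for x
  proof -
    have "(\<integral>t. norm (W x t) \<partial>lborel) = (\<integral>t. W x t \<partial>lborel)" using W0 by simp
    also have "\<dots> = indicator {0..l} x * (\<integral>t. 2 * B\<^sup>2 * indicator {-l..l} t + 2 * (norm (q ((x + t) / 2)))\<^sup>2 \<partial>lborel)"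
      unfolding W_def by (rule integral_mult_right_zero)
    also have "(\<integral>t. 2 * B\<^sup>2 * indicator {-l..l} t + 2 * (norm (q ((x + t) / 2)))\<^sup>2 \<partial>lborel) = 
      (\<integral>t. 2 * B\<^sup>2 * indicator {-l..l} t \<partial>lborel) + (\<integral>t. 2 * (norm (q ((x + t) / 2)))\<^sup>2 \<partial>lborel)"
      by (rule Bochner_Integration.integral_add[OF integrable_indicator_Icc integrable_mult_right[OF i1]])
    also have "(\<integral>t. 2 * B\<^sup>2 * indicator {-l..l} t \<partial>lborel) = 4 * l * B\<^sup>2"
      using l_pos by (subst integral_mult_right_zero) simp
    also have "(\<integral>t. 2 * (norm (q ((x + t) / 2)))\<^sup>2 \<partial>lborel) = 4 * (\<integral>t. (norm (q t))\<^sup>2 \<partial>lborel)"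
      by (subst integral_mult_right_zero) (simp add: e1)
    finally show ?thesis by simp
  qed
  have W: "integrable (lborel \<Otimes>\<^sub>M lborel) (case_prod W)"
  proof (rule integrable_pair_of_slices[OF _ iW])
    have "case_prod W \<in> borel_measurable (borel \<Otimes>\<^sub>M borel)" unfolding W_def by measurable
    then show "case_prod W \<in> borel_measurable (lborel \<Otimes>\<^sub>M lborel)" by (simp cong: measurable_cong_sets)
  qed (rule integrable_indicator_Icc, rule eq_refl[OF IW])
  have "integrable (lborel \<Otimes>\<^sub>M lborel) (\<lambda>p. indicator (T_set l) p *\<^sub>R (norm (n p * finv (fst p)))\<^sup>2)"
  proof (rule Bochner_Integration.integrable_bound)
    show "integrable (lborel \<Otimes>\<^sub>M lborel) (\<lambda>p. c\<^sup>2 * case_prod W p)" using W by (rule integrable_mult_right)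
    have "(\<lambda>p. indicator (T_set l) p *\<^sub>R (norm (n p * finv (fst p)))\<^sup>2) \<in> borel_measurable (borel \<Otimes>\<^sub>M borel)" by measurable
    then show "(\<lambda>p. indicator (T_set l) p *\<^sub>R (norm (n p * finv (fst p)))\<^sup>2) \<in> borel_measurable (lborel \<Otimes>\<^sub>M lborel)"
      by (simp cong: measurable_cong_sets)
    show "AE p in lborel \<Otimes>\<^sub>M lborel. norm (indicator (T_set l) p *\<^sub>R (norm (n p * finv (fst p)))\<^sup>2) \<le> norm (c\<^sup>2 * case_prod W p)"
    proof (rule AE_I2)
      fix p :: "real \<times> real"
      obtain x t where p: "p = (x, t)" by (cases p)
      show "norm (indicator (T_set l) p *\<^sub>R (norm (n p * finv (fst p)))\<^sup>2) \<le> norm (c\<^sup>2 * case_prod W p)"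
      proof (cases "p \<in> T_set l")
        case True
        then have xt: "x \<in> {0..l}" "\<bar>t\<bar> \<le> x" by (auto simp: p T_set_def)
        let ?b = "norm (q ((x + t) / 2))"
        have "norm (n p) \<le> B + ?b" using n k_bound[OF xt] h_bound[OF xt] by (auto simp: p)
        then have "(norm (n p))\<^sup>2 \<le> (B + ?b)\<^sup>2" by (intro power_mono) auto
        also have "\<dots> \<le> 2 * B\<^sup>2 + 2 * ?b\<^sup>2"
          using zero_le_power2[of "B - ?b"] by (simp add: power2_eq_square algebra_simps)
        also have "\<dots> = W x t"
        proof -
          have "t \<in> {-l..l}" using xt by auto
          then show ?thesis using xt by (simp add: W_def)
        qed
        finally have 1: "(norm (n p))\<^sup>2 \<le> W x t" .
        have 2: "(norm (finv x))\<^sup>2 \<le> c\<^sup>2" using c by (intro power_mono) auto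
        have "(norm (n p * finv (fst p)))\<^sup>2 = (norm (finv x))\<^sup>2 * (norm (n p))\<^sup>2"
          by (simp add: p norm_mult power_mult_distrib mult.commute)
        also have "\<dots> \<le> c\<^sup>2 * W x t" using 1 2 by (intro mult_mono) auto
        finally show ?thesis using True W0[of x t] by (simp add: p)
      qed simp
    qed
  qed
  then have "integrable lborel (\<lambda>p. indicator (T_set l) p *\<^sub>R (norm (n p * finv (fst p)))\<^sup>2)" by (simp add: lborel_prod)
  moreover have "(\<lambda>p. indicator (T_set l) p *\<^sub>R (norm (n p * finv (fst p)))\<^sup>2) \<in> borel_measurable lborel"
    using calculation by auto
  ultimately have "integrable lebesgue (\<lambda>p. indicator (T_set l) p *\<^sub>R (norm (n p * finv (fst p)))\<^sup>2)"
    by (simp only: integrable_completion)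
  then show ?thesis
    unfolding L2_on_def set_borel_measurable_def set_integrable_def
    using m' by (auto intro!: measurable_completion)
qed

end

section \<open>Weak partial derivatives of the transmutation kernel\<close>

context kernel_pair
begin

lemma interior_borel: "interior (T_set l) \<in> sets borel"
  by (rule borel_open[OF open_interior])

lemma interior_lmeasurable: "interior (T_set l) \<in> lmeasurable"
  by (rule fmeasurableI2[OF T_set_lmeasurable interior_subset]) (use interior_borel in simp)

lemma L2_on_interior: "L2_on (T_set l) v \<Longrightarrow> L2_on (interior (T_set l)) v"
  by (rule L2_on_subset[OF _ interior_subset]) (use interior_borel in simp_all)

lemma AE_interior:
  "AE p in lebesgue. p \<in> T_set l \<longrightarrow> P p \<Longrightarrow> AE p in lebesgue. p \<in> interior (T_set l) \<longrightarrow> P p"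
  using interior_subset[of "T_set l"] by (auto elim!: eventually_mono)

text \<open>\<open>K\<close> is replaced by its primitive in t and t is integrated first: for fixed
  x the slice is (-x, x), and the test function vanishes at both ends.\<close>

lemma has_weak_partial_t:
  assumes K: "is_K_hat l f K"
  shows "has_weak_partial (interior (T_set l)) (0, 1) K (\<lambda>p. k p * finv (fst p))"
proof -
  let ?O = "interior (T_set l)"
  have LK: "L2_on ?O K" using K by (intro L2_on_interior) (simp add: is_K_hat_def)
  have Lk: "L2_on ?O (\<lambda>p. k p * finv (fst p))" by (intro L2_on_interior L2_on_kernel) simp
  have km: "(\<lambda>p. k p * finv (fst p)) \<in> borel_measurable borel"
  proof -
    have [measurable]: "k \<in> borel_measurable (borel \<Otimes>\<^sub>M borel)" by (simp add: borel_prod)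
    have "(\<lambda>p. k p * finv (fst p)) \<in> borel_measurable (borel \<Otimes>\<^sub>M borel)" by measurable
    then show ?thesis by (simp add: borel_prod)
  qed
  show ?thesis
    unfolding has_weak_partial_def
  proof (intro conjI allI impI)
    show "locally_integrable ?O K" "locally_integrable ?O (\<lambda>p. k p * finv (fst p))"
      by (rule L2_on_imp_locally_integrable[OF LK interior_lmeasurable] L2_on_imp_locally_integrable[OF Lk interior_lmeasurable])+
    fix \<phi> :: "real \<times> real \<Rightarrow> real" assume t: "test_function ?O \<phi>"
    let ?d = "\<lambda>p. frechet_derivative \<phi> (at p) (0, 1)"
    have cd: "continuous_on UNIV ?d" using test_function_prod_derivative(3)[OF t, of "(0, 1)"] by (simp add: Basis_prod_def)
    note A = test_integral_lborel[OF LK interior_borel interior_subset K_int_t_borel AE_interior[OF K_eq_int_t[OF K]] cd]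
    note C = test_integral_lborel[OF Lk interior_borel interior_subset km _ test_function_prod_derivative(4)[OF t]]
    have slice: "(\<integral>t. indicator ?O (x, t) *\<^sub>R (?d (x, t) *\<^sub>R K_int_t (x, t)) \<partial>lborel) =
       - (\<integral>t. indicator ?O (x, t) *\<^sub>R (\<phi> (x, t) *\<^sub>R (k (x, t) * finv x)) \<partial>lborel)" for x
    proof (cases "0 < x \<and> x < l")
      case True
      then have x: "x \<in> {0..l}" by auto
      have ind: "indicator ?O (x, t) = (indicator {-x<..<x} t :: real)" for t
        using True unfolding interior_T_set by (auto simp: indicator_def abs_less_iff)
      have z: "\<phi> (x, - x) = 0" "\<phi> (x, x) = 0"
        using test_function_eq_0[OF t] by (auto simp: interior_T_set)
      have c: "continuous_on UNIV (\<lambda>t. ?d (x, t))"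
        by (rule continuous_on_compose2[OF cd]) (auto intro!: continuous_intros)
      show ?thesis
        unfolding ind set_lebesgue_integral_def[symmetric] set_integral_open_closed(1)
        by (rule ac_on_weak_formula(1)[OF K_int_t_ac[OF x] _ test_function_prod_derivative(1)[OF t] c z]) (use True in simp)
    next
      case False
      then have "indicator ?O (x, t) = (0 :: real)" for t
        unfolding interior_T_set by (auto simp: indicator_def)
      then show ?thesis by simp
    qed
    have "(LINT p:?O|lebesgue. ?d p *\<^sub>R K p) = (\<integral>x. (\<integral>t. indicator ?O (x, t) *\<^sub>R (?d (x, t) *\<^sub>R K_int_t (x, t)) \<partial>lborel) \<partial>lborel)"
      using A(2) lborel_pair.integral_fst'[OF A(1)] by simp
    also have "\<dots> = - (\<integral>x. (\<integral>t. indicator ?O (x, t) *\<^sub>R (\<phi> (x, t) *\<^sub>R (k (x, t) * finv x)) \<partial>lborel) \<partial>lborel)"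
      unfolding slice by simp
    also have "\<dots> = - (LINT p:?O|lebesgue. \<phi> p *\<^sub>R (k p * finv (fst p)))"
      using C(2) lborel_pair.integral_fst'[OF C(1)] by simp
    finally show "(LINT p:?O|lebesgue. ?d p *\<^sub>R K p) = - (LINT p:?O|lebesgue. \<phi> p *\<^sub>R (k p * finv (fst p)))" .
  qed
qed

text \<open>Now \<open>K\<close> is replaced by its primitive in x and x is integrated first, over
  (|t|, l). The boundary data enter as the constant of integration and leave no trace, as the test
  function vanishes on x = |t|.\<close>

lemma has_weak_partial_x:
  assumes K: "is_K_hat l f K"
  shows "has_weak_partial (interior (T_set l)) (1, 0) K (\<lambda>p. - (h p * finv (fst p)))"
proof -
  let ?O = "interior (T_set l)"
  have LK: "L2_on ?O K" using K by (intro L2_on_interior) (simp add: is_K_hat_def)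
  have "L2_on ?O (\<lambda>p. h p * finv (fst p))" by (intro L2_on_interior L2_on_kernel) simp
  then have Lh: "L2_on ?O (\<lambda>p. - (h p * finv (fst p)))"
    by (simp add: L2_on_def set_borel_measurable_def)
  have hm: "(\<lambda>p. - (h p * finv (fst p))) \<in> borel_measurable borel"
  proof -
    have [measurable]: "h \<in> borel_measurable (borel \<Otimes>\<^sub>M borel)" by (simp add: borel_prod)
    have "(\<lambda>p. - (h p * finv (fst p))) \<in> borel_measurable (borel \<Otimes>\<^sub>M borel)" by measurable
    then show ?thesis by (simp add: borel_prod)
  qed
  show ?thesis
    unfolding has_weak_partial_def
  proof (intro conjI allI impI)
    show "locally_integrable ?O K" "locally_integrable ?O (\<lambda>p. - (h p * finv (fst p)))"
      by (rule L2_on_imp_locally_integrable[OF LK interior_lmeasurable] L2_on_imp_locally_integrable[OF Lh interior_lmeasurable])+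
    fix \<phi> :: "real \<times> real \<Rightarrow> real" assume t: "test_function ?O \<phi>"
    let ?d = "\<lambda>p. frechet_derivative \<phi> (at p) (1, 0)"
    have cd: "continuous_on UNIV ?d" using test_function_prod_derivative(3)[OF t, of "(1, 0)"] by (simp add: Basis_prod_def)
    note A = test_integral_lborel[OF LK interior_borel interior_subset K_int_x_borel AE_interior[OF K_eq_int_x[OF K]] cd]
    note C = test_integral_lborel[OF Lh interior_borel interior_subset hm _ test_function_prod_derivative(4)[OF t]]
    \<comment> \<open>Taken at x = l, this gives integrability on the full slice for each admissible
      t.\<close>
    have "AE t in lborel. t \<in> {-l..l} \<longrightarrow> set_integrable lborel {\<bar>t\<bar>..l} (\<lambda>s. - (h (s, t) * finv s))"
      using l_pos by (intro K_int_x_transform(3)) simp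
    then have slice: "AE t in lborel. (\<integral>x. indicator ?O (x, t) *\<^sub>R (?d (x, t) *\<^sub>R K_int_x (x, t)) \<partial>lborel) =
       - (\<integral>x. indicator ?O (x, t) *\<^sub>R (\<phi> (x, t) *\<^sub>R - (h (x, t) * finv x)) \<partial>lborel)"
    proof eventually_elim
      case (elim t')
      show ?case
      proof (cases "\<bar>t'\<bar> < l")
        case True
        have i: "set_integrable lborel {\<bar>t'\<bar>..l} (\<lambda>s. - (h (s, t') * finv s))"
          using elim True by (auto simp: abs_less_iff)
        have ac: "ac_on \<bar>t'\<bar> l (\<lambda>x. K_int_x (x, t')) (\<lambda>x. - (h (x, t') * finv x))"
          unfolding K_int_x_def fst_conv snd_conv by (rule ac_on_integral[OF i])
        have ind: "indicator ?O (x, t') = (indicator {\<bar>t'\<bar><..<l} x :: real)" for x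
          unfolding interior_T_set by (auto simp: indicator_def)
        have z: "\<phi> (\<bar>t'\<bar>, t') = 0" "\<phi> (l, t') = 0"
          using test_function_eq_0[OF t] by (auto simp: interior_T_set)
        have c: "continuous_on UNIV (\<lambda>x. ?d (x, t'))"
          by (rule continuous_on_compose2[OF cd]) (auto intro!: continuous_intros)
        show ?thesis
          unfolding ind set_lebesgue_integral_def[symmetric] set_integral_open_closed(1)
          by (rule ac_on_weak_formula(1)[OF ac _ test_function_prod_derivative(2)[OF t] c z]) (use True in simp)
      next
        case False
        then have "indicator ?O (x, t') = (0 :: real)" for x
          unfolding interior_T_set by (auto simp: indicator_def)
        then show ?thesis by simp
      qed
    qed
    have A': "integrable (lborel \<Otimes>\<^sub>M lborel) (\<lambda>(x, t). indicator ?O (x, t) *\<^sub>R (?d (x, t) *\<^sub>R K_int_x (x, t)))"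
      and C': "integrable (lborel \<Otimes>\<^sub>M lborel) (\<lambda>(x, t). indicator ?O (x, t) *\<^sub>R (\<phi> (x, t) *\<^sub>R - (h (x, t) * finv x)))"
      using A(1) C(1) by (simp_all add: case_prod_beta')
    have "(LINT p:?O|lebesgue. ?d p *\<^sub>R K p) = (\<integral>t. (\<integral>x. indicator ?O (x, t) *\<^sub>R (?d (x, t) *\<^sub>R K_int_x (x, t)) \<partial>lborel) \<partial>lborel)"
      using A(2) lborel_pair.integral_snd[OF A'] by (simp add: case_prod_beta')
    also have "\<dots> = (\<integral>t. - (\<integral>x. indicator ?O (x, t) *\<^sub>R (\<phi> (x, t) *\<^sub>R - (h (x, t) * finv x)) \<partial>lborel) \<partial>lborel)"
      using lborel_pair.integrable_snd[OF A'] lborel_pair.integrable_snd[OF C']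
      by (intro integral_cong_AE slice) (auto dest: borel_measurable_integrable)
    also have "\<dots> = - (LINT p:?O|lebesgue. \<phi> p *\<^sub>R - (h p * finv (fst p)))"
      using C(2) lborel_pair.integral_snd[OF C'] by (simp add: case_prod_beta')
    finally show "(LINT p:?O|lebesgue. ?d p *\<^sub>R K p) = - (LINT p:?O|lebesgue. \<phi> p *\<^sub>R - (h p * finv (fst p)))" .
  qed
qed

theorem K_sobolev:
  assumes K: "is_K_hat l f K"
  shows "sobolev 1 (interior (T_set l)) K"
proof -
  let ?O = "interior (T_set l)"
  have LK: "L2_on ?O K" using K by (intro L2_on_interior) (simp add: is_K_hat_def)
  have Lk: "L2_on ?O (\<lambda>p. k p * finv (fst p))" by (intro L2_on_interior L2_on_kernel) simp
  have "L2_on ?O (\<lambda>p. h p * finv (fst p))" by (intro L2_on_interior L2_on_kernel) simp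
  then have Lh: "L2_on ?O (\<lambda>p. - (h p * finv (fst p)))"
    by (simp add: L2_on_def set_borel_measurable_def)
  show ?thesis
    using LK Lk Lh has_weak_partial_t[OF K] has_weak_partial_x[OF K] by (auto simp: Basis_prod_def zero_prod_def)
qed

theorem K_continuous:
  assumes K: "is_K_hat l f K"
  shows "\<exists>Kc. continuous_on (closure (T_set l)) Kc \<and> (AE p in lebesgue_on (T_set l). K p = Kc p)"
proof (intro exI conjI)
  show "continuous_on (closure (T_set l)) K_int_t"
    using K_int_t_continuous compact_imp_closed[OF compact_T_set] by simp
  show "AE p in lebesgue_on (T_set l). K p = K_int_t p"
    using K_eq_int_t[OF K] T_set_borel by (subst AE_restrict_space_iff) auto
qed

end

text \<open>A continuous \<open>f\<close> without zeros on a compact interval has a bounded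
  reciprocal, so the quotient of its derivative by \<open>f\<close> stays square-integrable.\<close>

lemma impedance_of_sobolev:
  fixes f :: "real \<Rightarrow> complex"
  assumes l: "l > 0" and f: "sobolev 1 {0<..<l} f" "continuous_on {0..l} f" "\<forall>x\<in>{0..l}. f x \<noteq> 0" "f 0 = 1"
  obtains q where "impedance l q f"
proof -
  obtain g where "has_weak_partial {0<..<l} 1 f g" "L2_on {0<..<l} g"
    using f(1) by auto
  then obtain g' where g' [measurable]: "g' \<in> borel_measurable borel" and z: "\<And>x. x \<notin> {0<..<l} \<Longrightarrow> g' x = 0"
    and L2: "integrable lborel (\<lambda>x. (norm (g' x))\<^sup>2)" and ac: "ac_on 0 l f g'"
    using weak_partial_imp_ac_on[OF l f(2)] by metis
  have ci: "continuous_on {0..l} (\<lambda>x. 1 / f x)" using f by (intro continuous_intros) auto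
  define v where "v = (\<lambda>x. indicator {0..l} x *\<^sub>R (1 / f x))"
  have [measurable]: "v \<in> borel_measurable borel"
    unfolding v_def by (rule borel_measurable_continuous_on_indicator[OF _ ci]) simp
  obtain c where c: "\<And>x. x \<in> {0..l} \<Longrightarrow> norm (1 / f x) \<le> c"
    using continuous_on_compact_bound[OF compact_Icc ci] by metis
  have v: "norm (v x) \<le> max 0 c" for x
    using c[of x] by (auto simp: v_def indicator_def)
  define q where "q = (\<lambda>x. g' x * v x)"
  have "impedance l q f"
  proof unfold_locales
    show "q \<in> borel_measurable borel" unfolding q_def by measurable
    show "q x = 0" if "x \<notin> {0..l}" for x using that by (simp add: q_def v_def)
    show "integrable lborel (\<lambda>x. (norm (q x))\<^sup>2)"
    proof (rule Bochner_Integration.integrable_bound)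
      show "integrable lborel (\<lambda>x. (max 0 c)\<^sup>2 * (norm (g' x))\<^sup>2)" using L2 by (rule integrable_mult_right)
      show "(\<lambda>x. (norm (q x))\<^sup>2) \<in> borel_measurable lborel" unfolding q_def by measurable
      show "AE x in lborel. norm ((norm (q x))\<^sup>2) \<le> norm ((max 0 c)\<^sup>2 * (norm (g' x))\<^sup>2)"
      proof (rule AE_I2)
        fix x
        have "(norm (v x))\<^sup>2 \<le> (max 0 c)\<^sup>2" using v by (intro power_mono) auto
        then have "(norm (v x))\<^sup>2 * (norm (g' x))\<^sup>2 \<le> (max 0 c)\<^sup>2 * (norm (g' x))\<^sup>2" by (rule mult_right_mono) simp
        then show "norm ((norm (q x))\<^sup>2) \<le> norm ((max 0 c)\<^sup>2 * (norm (g' x))\<^sup>2)"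
          by (simp add: q_def norm_mult power_mult_distrib mult.commute)
      qed
    qed
    show "ac_on 0 l f (\<lambda>x. q x * f x)"
      by (rule ac_on_cong[OF ac]) (use f(3) in \<open>auto simp: q_def v_def\<close>)
  qed (use l f in auto)
  then show ?thesis by (rule that)
qed

lemma (in impedance) kernel_pair_exists: "\<exists>k h B. kernel_pair l q f k h B"
proof (rule dirac_kernels)
  fix k h :: "real \<times> real \<Rightarrow> complex" and B :: real
  assume *: "0 \<le> B" "k \<in> borel_measurable borel" "h \<in> borel_measurable borel"
    "\<And>x t. x \<in> {0..l} \<Longrightarrow> \<bar>t\<bar> \<le> x \<Longrightarrow> norm (k (x, t)) \<le> B + norm (q ((x + t) / 2))"
    "\<And>x t. x \<in> {0..l} \<Longrightarrow> \<bar>t\<bar> \<le> x \<Longrightarrow> norm (h (x, t)) \<le> B + norm (q ((x + t) / 2))"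
    "continuous_on (T_set l) (\<lambda>p. LINT \<tau>:{- fst p..snd p}|lborel. k (fst p, \<tau>))"
    "continuous_on (T_set l) (\<lambda>p. LINT \<tau>:{- fst p..snd p}|lborel. h (fst p, \<tau>))"
    "\<And>\<rho>. ac_on 0 l (transform k \<rho>) (\<lambda>x. q x * transform k \<rho> x + \<i> * \<rho> * transform h \<rho> x)"
    "\<And>\<rho>. ac_on 0 l (transform h \<rho>) (\<lambda>x. - q x * transform h \<rho> x + \<i> * \<rho> * transform k \<rho> x)"
  have "kernel_pair l q f k h B"
    by unfold_locales (use * in blast)+
  then show ?thesis by blast
qed

theorem theorem51:
  fixes l :: real and f :: "real \<Rightarrow> complex" and K H :: "real \<times> real \<Rightarrow> complex"
  assumes "l > 0"
    and "sobolev 1 {0<..<l} f"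
    and "continuous_on {0..l} f"
    and "\<forall>x\<in>{0..l}. f x \<noteq> 0"
    and "f 0 = 1"
    and "is_K_hat l f K"
    and "is_K_hat l (\<lambda>x. 1 / f x) H"
  shows "(\<exists>Kc. continuous_on (closure (T_set l)) Kc \<and> (AE p in lebesgue_on (T_set l). K p = Kc p))
    \<and> sobolev 1 (interior (T_set l)) K
    \<and> (\<exists>K_x K_t H_x H_t.
         has_weak_partial (interior (T_set l)) (1, 0) K K_x
       \<and> has_weak_partial (interior (T_set l)) (0, 1) K K_t
       \<and> has_weak_partial (interior (T_set l)) (1, 0) H H_x
       \<and> has_weak_partial (interior (T_set l)) (0, 1) H H_t
       \<and> (AE (x, t) in lebesgue_on (interior (T_set l)). H_x (x, t) = - ((f x)\<^sup>2) * K_t (x, t))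
       \<and> (AE (x, t) in lebesgue_on (interior (T_set l)). K_x (x, t) = - (1 / (f x)\<^sup>2) * H_t (x, t)))"
proof -
  obtain q where "impedance l q f"
    by (rule impedance_of_sobolev[OF assms(1-5)])
  then obtain k h B where "kernel_pair l q f k h B"
    using impedance.kernel_pair_exists by blast
  then interpret K: kernel_pair l q f k h B .
  interpret H: kernel_pair l "\<lambda>x. - q x" "\<lambda>x. 1 / f x" h k B by (rule K.kernel_pair_swap)
  \<comment> \<open>With all four partials explicit the relations are pointwise identities: K_t =
    k/f and H_x = - k f, while K_x = - h/f and H_t = h f.\<close>
  have fin: "K.finv x = 1 / f x" "H.finv x = f x" "f x \<noteq> 0" if "(x, t) \<in> interior (T_set l)" for x t
    using that K.finv_eq[of x] H.finv_eq[of x] K.f_nz[of x] by (auto simp: interior_T_set)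
  show ?thesis
  proof (intro conjI[OF K.K_continuous[OF assms(6)] conjI[OF K.K_sobolev[OF assms(6)]]] exI conjI)
    show "has_weak_partial (interior (T_set l)) (1, 0) K (\<lambda>p. - (h p * K.finv (fst p)))"
      "has_weak_partial (interior (T_set l)) (0, 1) K (\<lambda>p. k p * K.finv (fst p))"
      by (rule K.has_weak_partial_x[OF assms(6)] K.has_weak_partial_t[OF assms(6)])+
    show "has_weak_partial (interior (T_set l)) (1, 0) H (\<lambda>p. - (k p * H.finv (fst p)))"
      "has_weak_partial (interior (T_set l)) (0, 1) H (\<lambda>p. h p * H.finv (fst p))"
      by (rule H.has_weak_partial_x[OF assms(7)] H.has_weak_partial_t[OF assms(7)])+
    show "AE (x, t) in lebesgue_on (interior (T_set l)). - (k (x, t) * H.finv (fst (x, t))) = - ((f x)\<^sup>2) * (k (x, t) * K.finv (fst (x, t)))"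
      by (rule AE_I2) (auto simp: fin power2_eq_square)
    show "AE (x, t) in lebesgue_on (interior (T_set l)). - (h (x, t) * K.finv (fst (x, t))) = - (1 / (f x)\<^sup>2) * (h (x, t) * H.finv (fst (x, t)))"
      by (rule AE_I2) (auto simp: fin power2_eq_square)
  qed
qed

end
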